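(* Let $d\ge2$, $\nu\in\mathbb{R}$, let $f:\mathbb{R}^d\to\mathbb{R}$ be locally bounded, let $\Psi_-\le\Psi_+$ be Lipschitz functions on $\mathbb{R}^d$, and let $u_0\in C(\mathbb{R}^d)$ with $\Psi_-\le u_0\le\Psi_+$. For $\epsilon>0$ define $u^\epsilon:\mathbb{R}^d\times\mathbb{R}\to\mathbb{R}$ by $u^\epsilon(x,t)=u_0(x)$ for $t\le0$ and, inductively, for $t>0$, $$u^\epsilon(x,t)=\max\big\{\Psi_-(x),\ \min\{\Psi_+(x),\ S^\epsilon(x,t)\}\big\},$$ where, if $\nu\ge0$, $$S^\epsilon(x,t)=\sup_{(v^1,\dots,v^{d-1}),\,w}\ \min_{b\in\{\pm1\}^{d-1}}\Big[u^\epsilon\Big(x+\sqrt2\,\epsilon\sum_{j=1}^{d-1}b^jv^j+\nu\epsilon^2w,\ t-\epsilon^2\Big)+\epsilon^2f(x)\Big],$$ and, if $\nu<0$, $$S^\epsilon(x,t)=\sup_{(v^1,\dots,v^{d-1})}\ \inf_{w,\ b\in\{\pm1\}^{d-1}}\Big[u^\epsilon\Big(x+\sqrt2\,\epsilon\sum_{j=1}^{d-1}b^jv^j+\nu\epsilon^2w,\ t-\epsilon^2\Big)+\epsilon^2f(x)\Big];$$ here $(v^1,\dots,v^{d-1})$ ranges over $(d-1)$-tuples of mutually orthogonal unit vectors and $w$ over unit vectors in $\mathbb{R}^d$. Define $$\overline u(x,t):=\varlimsup_{\substack{(y,s)\to(x,t)\\ \epsilon\searrow0}}u^\epsilon(y,s),\qquad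 \underline u(x,t):=\varliminf_{\substack{(y,s)\to(x,t)\\ \epsilon\searrow0}}u^\epsilon(y,s).$$ Then $\overline u$ and $\underline u$ are respectively a viscosity subsolution and a viscosity supersolution of $$\begin{cases}u_t-\nu|Du|+F(Du,D^2u)=f(x)&\text{in }\mathbb{R}^d\times(0,\infty),\\ u(x,0)=u_0(x)&\text{in }\mathbb{R}^d,\\ \Psi_-(x)\le u(x,t)\le\Psi_+(x)&\text{in }\mathbb{R}^d\times(0,\infty).\end{cases}$$ Moreover $\overline u(x,0)=\underline u(x,0)=u_0(x)$ for all $x\in\mathbb{R}^d$.
   Context: $F(p,X)=-\mathrm{Tr}\big((I-\frac{p\otimes p}{|p|^2})X\big)$ for $p\in\mathbb{R}^d\setminus\{0\}$ and $X$ a real symmetric $d\times d$ matrix. Upper and lower stars denote upper and lower semicontinuous envelopes. A function $u$ is a viscosity subsolution of the obstacle problem if (a) $\Psi_-(x)\le u^*(x,t)\le\Psi_+(x)$ for all $(x,t)\in\mathbb{R}^d\times(0,\infty)$; (b) $u^*(x,0)\le u_0(x)$ for all $x$; (c) whenever $\phi$ is smooth, $u^*-\phi$ has a local maximum at $(x_0,t_0)\in\mathbb{R}^d\times(0,\infty)$ and $u^*(x_0,t_0)>\Psi_-(x_0)$, one has $\phi_t-\nu|D\phi|+F_*(D\phi,D^2\phi)\le f^*(x_0)$ at $(x_0,t_0)$. It is a viscosity supersolution if (a) $\Psi_-(x)\le u_*(x,t)\le\Psi_+(x)$ for all $(x,t)\in\mathbb{R}^d\times(0,\infty)$; (b) $u_*(x,0)\ge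 u_0(x)$ for all $x$; (c) whenever $\phi$ is smooth, $u_*-\phi$ has a local minimum at $(x_0,t_0)\in\mathbb{R}^d\times(0,\infty)$ and $u_*(x_0,t_0)<\Psi_+(x_0)$, one has $\phi_t-\nu|D\phi|+F^*(D\phi,D^2\phi)\ge f_*(x_0)$ at $(x_0,t_0)$. *)

theory Defs
  imports "HOL-Analysis.Analysis"
begin

text \<open>Envelopes of a function given on \<open>D\<close>, evaluated at points of the closure of \<open>D\<close>.
  The filter is that of the traces on \<open>D\<close> of neighbourhoods of \<open>z\<close>; unlike in
  \<open>at z within D\<close>, the point \<open>z\<close> itself is not removed.\<close>

definition usc_envelope :: "'a::topological_space set \<Rightarrow> ('a \<Rightarrow> ereal) \<Rightarrow> 'a \<Rightarrow> ereal" where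
  "usc_envelope D g z = Limsup (inf (nhds z) (principal D)) g"

definition lsc_envelope :: "'a::topological_space set \<Rightarrow> ('a \<Rightarrow> ereal) \<Rightarrow> 'a \<Rightarrow> ereal" where
  "lsc_envelope D g z = Liminf (inf (nhds z) (principal D)) g"

text \<open>Here \<open>w \<epsilon> y s\<close> is a family of functions of space and time, and
  \<open>(y, s)\<close> is allowed to equal \<open>z\<close>.\<close>

definition upper_relaxed_limit ::
    "(real \<Rightarrow> 'a::topological_space \<Rightarrow> real \<Rightarrow> real) \<Rightarrow> 'a \<times> real \<Rightarrow> ereal" where
  "upper_relaxed_limit w z =
    Limsup (nhds z \<times>\<^sub>F at_right 0) (\<lambda>((y, s), \<epsilon>). ereal (w \<epsilon> y s))"

definition lower_relaxed_limit ::
    "(real \<Rightarrow> 'a::topological_space \<Rightarrow> real \<Rightarrow> real) \<Rightarrow> 'a \<times> real \<Rightarrow> ereal" where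
  "lower_relaxed_limit w z =
    Liminf (nhds z \<times>\<^sub>F at_right 0) (\<lambda>((y, s), \<epsilon>). ereal (w \<epsilon> y s))"

definition locally_bounded :: "('a::metric_space \<Rightarrow> 'b::metric_space) \<Rightarrow> bool" where
  "locally_bounded f \<longleftrightarrow> (\<forall>x. \<exists>r>0. bounded (f ` ball x r))"

fun times_differentiable_on ::
    "nat \<Rightarrow> 'a::real_normed_vector set \<Rightarrow> ('a \<Rightarrow> real) \<Rightarrow> bool" where
  "times_differentiable_on 0 S \<phi> \<longleftrightarrow> continuous_on S \<phi>"
| "times_differentiable_on (Suc k) S \<phi> \<longleftrightarrow>
     (\<forall>z\<in>S. \<phi> differentiable (at z)) \<and>
     (\<forall>h. times_differentiable_on k S (\<lambda>z. frechet_derivative \<phi> (at z) h))"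

text \<open>\<open>C\<^sup>\<infinity>\<close> on an open set \<open>S\<close>: all iterated directional derivatives exist, and
  in finite dimension this is the usual notion.\<close>

definition smooth_fun_on :: "'a::real_normed_vector set \<Rightarrow> ('a \<Rightarrow> real) \<Rightarrow> bool" where
  "smooth_fun_on S \<phi> \<longleftrightarrow> (\<forall>k. times_differentiable_on k S \<phi>)"

definition time_deriv :: "((real^'n) \<times> real \<Rightarrow> real) \<Rightarrow> (real^'n) \<times> real \<Rightarrow> real" where
  "time_deriv \<phi> z = frechet_derivative \<phi> (at z) (0, 1)"

definition space_partial ::
    "'n \<Rightarrow> ((real^'n) \<times> real \<Rightarrow> real) \<Rightarrow> (real^'n) \<times> real \<Rightarrow> real" where
  "space_partial i \<phi> z = frechet_derivative \<phi> (at z) (axis i 1, 0)"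

definition space_grad ::
    "((real^'n) \<times> real \<Rightarrow> real) \<Rightarrow> (real^'n) \<times> real \<Rightarrow> real^'n" where
  "space_grad \<phi> z = (\<chi> i. space_partial i \<phi> z)"

definition space_hessian ::
    "((real^'n) \<times> real \<Rightarrow> real) \<Rightarrow> (real^'n) \<times> real \<Rightarrow> real^'n^'n" where
  "space_hessian \<phi> z = (\<chi> i j. space_partial i (space_partial j \<phi>) z)"

definition tensor_square :: "real^'n \<Rightarrow> real^'n^'n" where
  "tensor_square p = (\<chi> i j. p $ i * p $ j)"

definition mcf_op :: "real^'n \<Rightarrow> real^'n^'n \<Rightarrow> real" where
  "mcf_op p X = - trace ((mat 1 - (1 / (norm p)\<^sup>2) *\<^sub>R tensor_square p) ** X)"

definition mcf_domain :: "((real^'n) \<times> (real^'n^'n)) set" where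
  "mcf_domain = {(p, X). p \<noteq> 0 \<and> transpose X = X}"

definition mcf_op_upper :: "real^'n \<Rightarrow> real^'n^'n \<Rightarrow> ereal" where
  "mcf_op_upper p X = usc_envelope mcf_domain (\<lambda>(q, Y). ereal (mcf_op q Y)) (p, X)"

definition mcf_op_lower :: "real^'n \<Rightarrow> real^'n^'n \<Rightarrow> ereal" where
  "mcf_op_lower p X = lsc_envelope mcf_domain (\<lambda>(q, Y). ereal (mcf_op q Y)) (p, X)"

definition closed_spacetime :: "((real^'n) \<times> real) set" where
  "closed_spacetime = UNIV \<times> {0..}"

definition open_spacetime :: "((real^'n) \<times> real) set" where
  "open_spacetime = UNIV \<times> {0<..}"

text \<open>Sub- and supersolutions are real-valued functions on \<open>\<real>\<^sup>d \<times> [0,\<infinity>)\<close>. They are typed as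
  \<open>ereal\<close>-valued, with finiteness on that set required explicitly, because they arise as
  limits superior and inferior. Values at negative times are irrelevant.\<close>

definition viscosity_subsolution ::
    "real \<Rightarrow> (real^'n \<Rightarrow> real) \<Rightarrow> (real^'n \<Rightarrow> real) \<Rightarrow> (real^'n \<Rightarrow> real) \<Rightarrow> (real^'n \<Rightarrow> real)
      \<Rightarrow> ((real^'n) \<times> real \<Rightarrow> ereal) \<Rightarrow> bool" where
  "viscosity_subsolution \<nu> f \<Psi>m \<Psi>p u0 u \<longleftrightarrow>
    (\<forall>z\<in>closed_spacetime. \<bar>u z\<bar> \<noteq> \<infinity>) \<and>
    (let U = usc_envelope closed_spacetime u in
      (\<forall>x. \<forall>t>0. ereal (\<Psi>m x) \<le> U (x, t) \<and> U (x, t) \<le> ereal (\<Psi>p x)) \<and>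
      (\<forall>x. U (x, 0) \<le> ereal (u0 x)) \<and>
      (\<forall>\<phi> x t. smooth_fun_on open_spacetime \<phi> \<longrightarrow> t > 0 \<longrightarrow>
        (\<forall>\<^sub>F z in nhds (x, t). U z - ereal (\<phi> z) \<le> U (x, t) - ereal (\<phi> (x, t))) \<longrightarrow>
        U (x, t) > ereal (\<Psi>m x) \<longrightarrow>
        ereal (time_deriv \<phi> (x, t) - \<nu> * norm (space_grad \<phi> (x, t)))
          + mcf_op_lower (space_grad \<phi> (x, t)) (space_hessian \<phi> (x, t))
          \<le> usc_envelope UNIV (\<lambda>y. ereal (f y)) x))"

definition viscosity_supersolution ::
    "real \<Rightarrow> (real^'n \<Rightarrow> real) \<Rightarrow> (real^'n \<Rightarrow> real) \<Rightarrow> (real^'n \<Rightarrow> real) \<Rightarrow> (real^'n \<Rightarrow> real)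
      \<Rightarrow> ((real^'n) \<times> real \<Rightarrow> ereal) \<Rightarrow> bool" where
  "viscosity_supersolution \<nu> f \<Psi>m \<Psi>p u0 u \<longleftrightarrow>
    (\<forall>z\<in>closed_spacetime. \<bar>u z\<bar> \<noteq> \<infinity>) \<and>
    (let U = lsc_envelope closed_spacetime u in
      (\<forall>x. \<forall>t>0. ereal (\<Psi>m x) \<le> U (x, t) \<and> U (x, t) \<le> ereal (\<Psi>p x)) \<and>
      (\<forall>x. U (x, 0) \<ge> ereal (u0 x)) \<and>
      (\<forall>\<phi> x t. smooth_fun_on open_spacetime \<phi> \<longrightarrow> t > 0 \<longrightarrow>
        (\<forall>\<^sub>F z in nhds (x, t). U z - ereal (\<phi> z) \<ge> U (x, t) - ereal (\<phi> (x, t))) \<longrightarrow>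
        U (x, t) < ereal (\<Psi>p x) \<longrightarrow>
        ereal (time_deriv \<phi> (x, t) - \<nu> * norm (space_grad \<phi> (x, t)))
          + mcf_op_upper (space_grad \<phi> (x, t)) (space_hessian \<phi> (x, t))
          \<ge> lsc_envelope UNIV (\<lambda>y. ereal (f y)) x))"

text \<open>Tuples indexed by \<open>1, \<dots>, d - 1\<close> are extensional functions on that index set.\<close>

definition orthonormal_tuples :: "(nat \<Rightarrow> real^'n) set" where
  "orthonormal_tuples =
    {v \<in> {1..CARD('n) - 1} \<rightarrow>\<^sub>E sphere 0 1.
      \<forall>i\<in>{1..CARD('n) - 1}. \<forall>j\<in>{1..CARD('n) - 1}. i \<noteq> j \<longrightarrow> v i \<bullet> v j = 0}"

definition sign_tuples :: "'n itself \<Rightarrow> (nat \<Rightarrow> real) set" where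
  "sign_tuples _ = {1..CARD('n) - 1} \<rightarrow>\<^sub>E {-1, 1}"

definition game_move ::
    "real \<Rightarrow> real \<Rightarrow> real^'n \<Rightarrow> (nat \<Rightarrow> real^'n) \<Rightarrow> real^'n \<Rightarrow> (nat \<Rightarrow> real) \<Rightarrow> real^'n" where
  "game_move \<nu> \<epsilon> x v w b =
    x + (sqrt 2 * \<epsilon>) *\<^sub>R (\<Sum>j = 1..CARD('n) - 1. b j *\<^sub>R v j) + (\<nu> * \<epsilon>\<^sup>2) *\<^sub>R w"

text \<open>The suprema and infima are over bounded sets of reals when the payoff \<open>g\<close> is bounded
  on bounded sets, as is the case for every \<open>g\<close> lying between two Lipschitz obstacles.\<close>

definition game_step ::
    "real \<Rightarrow> (real^'n \<Rightarrow> real) \<Rightarrow> real \<Rightarrow> (real^'n \<Rightarrow> real) \<Rightarrow> real^'n \<Rightarrow> real" where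
  "game_step \<nu> f \<epsilon> g x =
    (if \<nu> \<ge> 0
     then SUP (v, w) \<in> orthonormal_tuples \<times> sphere 0 1.
            MIN b \<in> sign_tuples TYPE('n). g (game_move \<nu> \<epsilon> x v w b) + \<epsilon>\<^sup>2 * f x
     else SUP v \<in> orthonormal_tuples.
            INF (w, b) \<in> sphere 0 1 \<times> sign_tuples TYPE('n).
              g (game_move \<nu> \<epsilon> x v w b) + \<epsilon>\<^sup>2 * f x)"

context
  fixes \<nu> :: real and f \<Psi>m \<Psi>p u0 :: "real^'n \<Rightarrow> real"
begin

text \<open>Only \<open>\<epsilon> > 0\<close> is meaningful; the recursion is cut off for \<open>\<epsilon> \<le> 0\<close>, where it would
  not be well-founded.\<close>

function game_value :: "real \<Rightarrow> real^'n \<Rightarrow> real \<Rightarrow> real" where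
  "game_value \<epsilon> x t =
    (if t \<le> 0 \<or> \<epsilon> \<le> 0 then u0 x
     else max (\<Psi>m x) (min (\<Psi>p x)
            (game_step \<nu> f \<epsilon> (\<lambda>y. game_value \<epsilon> y (t - \<epsilon>\<^sup>2)) x)))"
  by pat_completeness auto

termination
proof (relation "Wellfounded.measure (\<lambda>(\<epsilon>, x, t). nat \<lceil>t / \<epsilon>\<^sup>2\<rceil>)")
  fix \<epsilon> t :: real and x y :: "real^'n"
  assume "\<not> (t \<le> 0 \<or> \<epsilon> \<le> 0)"
  then have "t / \<epsilon>\<^sup>2 > 0" "(t - \<epsilon>\<^sup>2) / \<epsilon>\<^sup>2 = t / \<epsilon>\<^sup>2 - 1"
    by (simp_all add: diff_divide_distrib)
  then show "((\<epsilon>, y, t - \<epsilon>\<^sup>2), (\<epsilon>, x, t)) \<in> Wellfounded.measure (\<lambda>(\<epsilon>, x, t). nat \<lceil>t / \<epsilon>\<^sup>2\<rceil>)"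
    by simp
qed simp

end

declare game_value.simps [simp del]

end

theory Submission
  imports Defs
begin

text \<open>The value functions solve a discrete scheme that is monotone, local and consistent with the
  equation, and the half-relaxed limits of such a scheme are viscosity solutions.

  Consistency is the geometric heart (\<open>consistency_upper\<close>, \<open>consistency_lower\<close>). Let \<open>p\<close> and \<open>X\<close> be
  the gradient and the Hessian of a test function and let \<open>\<sigma> = \<Sum>\<^sub>j b\<^sub>j v\<^sub>j\<close>. One move changes the test
  function by \<open>\<surd>2 \<epsilon> p \<bullet> \<sigma> + \<epsilon>\<^sup>2 (\<nu> p \<bullet> w - \<tau> + \<sigma> \<bullet> X \<sigma>)\<close> up to \<open>o(\<epsilon>\<^sup>2)\<close> (\<open>game_move_expansion\<close>).
  The maximiser picks a frame of the hyperplane orthogonal to \<open>p\<close> in which \<open>X\<close> is diagonal: then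
  \<open>p \<bullet> \<sigma> = 0\<close>, and \<open>\<sigma> \<bullet> X \<sigma>\<close> is the trace of \<open>X\<close> over that hyperplane, whatever the signs
  (\<open>diagonalising_frame\<close>). Against an arbitrary frame the minimiser can always
  choose signs for which \<open>\<sigma> \<bullet> X \<sigma>\<close> is at most the trace over the hyperplane of the frame and
  \<open>p \<bullet> \<sigma> \<le> 0\<close> (\<open>exists_signs_curvature_le\<close>); if that hyperplane is not nearly orthogonal to \<open>p\<close>,
  the minimiser instead makes the term of order \<open>\<epsilon>\<close> negative enough to beat everything of order
  \<open>\<epsilon>\<^sup>2\<close> (\<open>frame_dichotomy\<close>). Since \<open>mcf_op n X\<close> depends only on the direction of \<open>n\<close>, a
  vanishing gradient is covered by letting multiples of the unit normal of the frame tend to \<open>0\<close>,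
  which is what the semicontinuous envelopes of the operator allow.

  Suppose the subsolution inequality fails at a maximum of \<open>u - \<phi>\<close>, where \<open>u\<close> is the
  upper limit. The fourth-power perturbation \<open>strict_bump\<close> makes the maximum strict without
  changing the derivatives that enter the equation, so that for some small \<open>\<epsilon>\<close> the value function
  minus the test function has an almost maximum, up to \<open>\<delta> \<epsilon>\<^sup>2\<close>, near the point
  (\<open>approximate_maximum\<close>). There the value lies above the lower obstacle, hence is at most one game
  step of itself, hence by monotonicity at most one game step of the test function plus the maximal
  gap; by consistency this loses \<open>\<delta> \<epsilon>\<^sup>2\<close>, a contradiction. Supersolutions are symmetric, with
  the other consistency estimate.

  At time \<open>0\<close> the functions \<open>u\<^sub>0(x) \<plusminus> (\<eta> + K |y - x|\<^sup>2 + C (s + \<epsilon>\<^sup>2))\<close> enclose the value functions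
  near \<open>x\<close> (\<open>initial_barrier\<close>): a move changes \<open>|y - x|\<^sup>2\<close> by a term of order \<open>\<epsilon>\<close> that either player can
  render harmless, plus \<open>O(\<epsilon>\<^sup>2)\<close>, which is absorbed by the growth in time; away from \<open>x\<close> the
  obstacles keep the values bounded and \<open>K\<close> is chosen to dominate them.\<close>

section \<open>Second-order Taylor expansion and symmetry of the Hessian\<close>

abbreviation second_deriv :: "('a::real_normed_vector \<Rightarrow> real) \<Rightarrow> 'a \<Rightarrow> 'a \<Rightarrow> 'a \<Rightarrow> real" where
  "second_deriv \<phi> z h k \<equiv> frechet_derivative (\<lambda>y. frechet_derivative \<phi> (at y) h) (at z) k"

lemma times_differentiable_2D:
  assumes "times_differentiable_on (Suc (Suc 0)) S \<phi>" "z \<in> S"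
  shows "(\<phi> has_derivative frechet_derivative \<phi> (at z)) (at z)"
    and "((\<lambda>y. frechet_derivative \<phi> (at y) h) has_derivative second_deriv \<phi> z h) (at z)"
    and "continuous_on S (\<lambda>y. second_deriv \<phi> y h k)"
  using assms by (auto simp: frechet_derivative_works[symmetric])

lemma bilinear_second_deriv:
  assumes C2: "times_differentiable_on (Suc (Suc 0)) S \<phi>" and "open S" and z: "z \<in> S"
  shows "bilinear (second_deriv \<phi> z)"
proof -
  note D = times_differentiable_2D[OF C2]
  have lin: "linear (frechet_derivative \<phi> (at y))" if "y \<in> S" for y
    using D(1)[OF that] has_derivative_linear by blast
  have "second_deriv \<phi> z (h + h') k = second_deriv \<phi> z h k + second_deriv \<phi> z h' k" for h h' k
  proof -
    have "((\<lambda>y. frechet_derivative \<phi> (at y) (h + h')) has_derivative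
           (\<lambda>k. second_deriv \<phi> z h k + second_deriv \<phi> z h' k)) (at z)"
      by (rule has_derivative_transform_within_open[OF
            has_derivative_add[OF D(2)[OF z, of h] D(2)[OF z, of h']] \<open>open S\<close> z])
        (use lin linear_add in fastforce)
    from has_derivative_unique[OF this D(2)[OF z]] show ?thesis by metis
  qed
  moreover have "second_deriv \<phi> z (c *\<^sub>R h) k = c *\<^sub>R second_deriv \<phi> z h k" for h c k
  proof -
    have "((\<lambda>y. frechet_derivative \<phi> (at y) (c *\<^sub>R h)) has_derivative
           (\<lambda>k. c *\<^sub>R second_deriv \<phi> z h k)) (at z)"
      by (rule has_derivative_transform_within_open[OF
            has_derivative_scaleR_right[OF D(2)[OF z, of h], of c] \<open>open S\<close> z])
        (use lin linear_scale in fastforce)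
    from has_derivative_unique[OF this D(2)[OF z]] show ?thesis by metis
  qed
  moreover have "linear (second_deriv \<phi> z h)" for h
    using D(2)[OF z] has_derivative_linear by blast
  ultimately show ?thesis
    unfolding bilinear_def by (auto intro!: linearI)
qed

text \<open>Reduces estimates on the second derivative that are uniform in the direction to
  finitely many pairs of basis vectors, for which continuity is available.\<close>

lemma bilinear_basis_expand:
  fixes B :: "'a::euclidean_space \<Rightarrow> 'a \<Rightarrow> real"
  assumes "bilinear B"
  shows "B h k = (\<Sum>(i,j)\<in>Basis \<times> Basis. (h \<bullet> i) * (k \<bullet> j) * B i j)"
proof -
  have "B h k = B (\<Sum>i\<in>Basis. (h \<bullet> i) *\<^sub>R i) (\<Sum>j\<in>Basis. (k \<bullet> j) *\<^sub>R j)"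
    by (simp add: euclidean_representation)
  also have "\<dots> = (\<Sum>(i,j)\<in>Basis \<times> Basis. B ((h \<bullet> i) *\<^sub>R i) ((k \<bullet> j) *\<^sub>R j))"
    by (rule bilinear_sum[OF assms])
  finally show ?thesis
    by (simp add: bilinear_lmul[OF assms] bilinear_rmul[OF assms] mult_ac)
qed

lemma second_deriv_near:
  fixes \<phi> :: "'a::euclidean_space \<Rightarrow> real"
  assumes C2: "times_differentiable_on (Suc (Suc 0)) S \<phi>" and "open S" and z0: "z0 \<in> S"
    and "\<omega> > 0"
  obtains r where "r > 0" "ball z0 r \<subseteq> S"
    "\<And>z h. z \<in> ball z0 r \<Longrightarrow> \<bar>second_deriv \<phi> z h h - second_deriv \<phi> z0 h h\<bar> \<le> \<omega> * (norm h)\<^sup>2"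
proof -
  define n where "n = real (card (Basis \<times> Basis :: ('a \<times> 'a) set))"
  have n: "n > 0" by (auto simp: n_def card_cartesian_product)
  have "\<forall>\<^sub>F z in nhds z0. \<bar>second_deriv \<phi> z i j - second_deriv \<phi> z0 i j\<bar> < \<omega> / n" for i j
  proof -
    have "isCont (\<lambda>y. second_deriv \<phi> y i j) z0"
      using times_differentiable_2D(3)[OF C2 z0] \<open>open S\<close> z0 by (simp add: continuous_on_eq_continuous_at)
    then have "((\<lambda>y. second_deriv \<phi> y i j) \<longlongrightarrow> second_deriv \<phi> z0 i j) (nhds z0)"
      unfolding isCont_def by (simp only: tendsto_at_iff_tendsto_nhds[of "\<lambda>y. second_deriv \<phi> y i j"])
    then show ?thesis
      using \<open>\<omega> > 0\<close> n by (auto dest!: tendstoD[where e = "\<omega> / n"] simp: dist_real_def)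
  qed
  then have "\<forall>\<^sub>F z in nhds z0. \<forall>(i,j)\<in>Basis \<times> Basis.
      \<bar>second_deriv \<phi> z i j - second_deriv \<phi> z0 i j\<bar> < \<omega> / n"
    by (intro eventually_ball_finite) auto
  moreover have "\<forall>\<^sub>F z in nhds z0. z \<in> S" using \<open>open S\<close> z0 by (rule eventually_nhds_in_open)
  ultimately have "\<forall>\<^sub>F z in nhds z0. z \<in> S \<and> (\<forall>(i,j)\<in>Basis \<times> Basis.
      \<bar>second_deriv \<phi> z i j - second_deriv \<phi> z0 i j\<bar> < \<omega> / n)"
    by eventually_elim simp
  then obtain r where r: "r > 0" and
    rr: "\<And>z. z \<in> ball z0 r \<Longrightarrow> z \<in> S \<and> (\<forall>(i,j)\<in>Basis \<times> Basis.
      \<bar>second_deriv \<phi> z i j - second_deriv \<phi> z0 i j\<bar> < \<omega> / n)"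
    unfolding eventually_nhds_metric by (auto simp: dist_commute)
  show ?thesis
  proof
    show "r > 0" by fact
    show sub: "ball z0 r \<subseteq> S" using rr by blast
    fix z h assume z: "z \<in> ball z0 r"
    have zS: "z \<in> S" using z sub by blast
    have "second_deriv \<phi> z h h - second_deriv \<phi> z0 h h =
      (\<Sum>(i,j)\<in>Basis \<times> Basis. (h \<bullet> i) * (h \<bullet> j) * (second_deriv \<phi> z i j - second_deriv \<phi> z0 i j))"
      unfolding bilinear_basis_expand[OF bilinear_second_deriv[OF C2 \<open>open S\<close> zS], of h h]
        bilinear_basis_expand[OF bilinear_second_deriv[OF C2 \<open>open S\<close> z0], of h h]
      by (simp add: right_diff_distrib sum_subtractf case_prod_unfold)
    also have "\<bar>\<dots>\<bar> \<le> (\<Sum>(i,j)\<in>(Basis \<times> Basis :: ('a\<times>'a) set). norm h * norm h * (\<omega> / n))"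
    proof (rule order_trans[OF sum_abs], rule sum_mono, clarsimp simp: abs_mult)
      fix i j :: 'a assume ij: "i \<in> Basis" "j \<in> Basis"
      have le: "\<bar>second_deriv \<phi> z i j - second_deriv \<phi> z0 i j\<bar> \<le> \<omega> / n"
        using rr[OF z] ij by force
      show "\<bar>h \<bullet> i\<bar> * \<bar>h \<bullet> j\<bar> * \<bar>second_deriv \<phi> z i j - second_deriv \<phi> z0 i j\<bar>
         \<le> norm h * norm h * \<omega> / n"
        using mult_mono[OF mult_mono[OF Basis_le_norm[OF ij(1), of h] Basis_le_norm[OF ij(2), of h]] le]
        by simp
    qed
    also have "\<dots> = \<omega> * (norm h)\<^sup>2"
      using n by (simp add: n_def power2_eq_square)
    finally show "\<bar>second_deriv \<phi> z h h - second_deriv \<phi> z0 h h\<bar> \<le> \<omega> * (norm h)\<^sup>2" .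
  qed
qed

text \<open>The second derivative is frozen at \<open>z0\<close> while the base point \<open>z\<close> and the increment vary:
  the error made by freezing is absorbed into \<open>\<omega>\<close> because the second derivative is continuous.\<close>

lemma taylor_second_order:
  fixes \<phi> :: "'a::euclidean_space \<Rightarrow> real"
  assumes C2: "times_differentiable_on (Suc (Suc 0)) S \<phi>" and "open S" and z0: "z0 \<in> S"
    and "\<omega> > 0"
  obtains r where "r > 0" "ball z0 (2 * r) \<subseteq> S"
    "\<And>z h. z \<in> ball z0 r \<Longrightarrow> norm h < r \<Longrightarrow>
      \<bar>\<phi> (z + h) - (\<phi> z + frechet_derivative \<phi> (at z) h + second_deriv \<phi> z0 h h / 2)\<bar>
        \<le> \<omega> * (norm h)\<^sup>2"
proof -
  obtain r where r: "r > 0" "ball z0 r \<subseteq> S" and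
    bnd: "\<And>z h. z \<in> ball z0 r \<Longrightarrow> \<bar>second_deriv \<phi> z h h - second_deriv \<phi> z0 h h\<bar> \<le> \<omega> * (norm h)\<^sup>2"
    using second_deriv_near[OF C2 \<open>open S\<close> z0 \<open>\<omega> > 0\<close>] by metis
  note D = times_differentiable_2D[OF C2]
  show ?thesis
  proof
    show "r / 2 > 0" "ball z0 (2 * (r / 2)) \<subseteq> S" using r by auto
    fix z h :: 'a assume z: "z \<in> ball z0 (r / 2)" and h: "norm h < r / 2"
    have seg: "z + t *\<^sub>R h \<in> ball z0 r" if "0 \<le> t" "t \<le> 1" for t
    proof -
      have "dist z0 (z + t *\<^sub>R h) \<le> dist z0 z + dist z (z + t *\<^sub>R h)" by (rule dist_triangle)
      moreover have "dist z (z + t *\<^sub>R h) = \<bar>t\<bar> * norm h" by (simp add: dist_norm)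
      moreover have "\<dots> \<le> norm h" using that by (simp add: mult_left_le_one_le)
      ultimately show ?thesis using z h by simp
    qed
    define diff where "diff m t = (if m = 0 then \<phi> (z + t *\<^sub>R h) else if m = 1 then
      frechet_derivative \<phi> (at (z + t *\<^sub>R h)) h else second_deriv \<phi> (z + t *\<^sub>R h) h h)" for m :: nat and t
    have line: "((\<lambda>t. z + t *\<^sub>R h) has_derivative (\<lambda>s. s *\<^sub>R h)) (at t)" for t
      by (auto intro!: derivative_eq_intros)
    have scale: "F (s *\<^sub>R h) = s * F h" if "(G has_derivative F) (at y)" for F :: "'a \<Rightarrow> real" and G y s
      using linear_scale[OF has_derivative_linear[OF that]] by simp
    have d0: "DERIV (diff 0) t :> diff 1 t" if "0 \<le> t" "t \<le> 1" for t
    proof -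
      have y: "z + t *\<^sub>R h \<in> S" using seg that r by blast
      show ?thesis
        using has_derivative_compose[OF line D(1)[OF y]]
        unfolding has_field_derivative_def diff_def
        by (simp add: scale[OF D(1)[OF y]] mult.commute[of _ "frechet_derivative \<phi> _ h"])
    qed
    have d1: "DERIV (diff 1) t :> diff 2 t" if "0 \<le> t" "t \<le> 1" for t
    proof -
      have y: "z + t *\<^sub>R h \<in> S" using seg that r by blast
      show ?thesis
        using has_derivative_compose[OF line D(2)[OF y, of h]]
        unfolding has_field_derivative_def diff_def
        by (simp add: scale[OF D(2)[OF y]] mult.commute[of _ "second_deriv \<phi> _ h h"])
    qed
    have "\<exists>t>0. t < 1 \<and> diff 0 1 = (\<Sum>m<2. diff m 0 / fact m * (1 - 0) ^ m) + diff 2 t / fact 2 * (1 - 0)\<^sup>2"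
    proof (rule Taylor_up[of 2 diff "diff 0" 0 1 0], safe)
      fix m :: nat and t :: real assume "m < 2" "0 \<le> t" "t \<le> 1"
      then show "DERIV (diff m) t :> diff (Suc m) t"
        using d0[of t] d1[of t] by (auto simp: numeral_2_eq_2 less_Suc_eq)
    qed auto
    then obtain t where t: "0 < t" "t < 1" and
      eq: "\<phi> (z + h) = \<phi> z + frechet_derivative \<phi> (at z) h + second_deriv \<phi> (z + t *\<^sub>R h) h h / 2"
      by (auto simp: diff_def numeral_2_eq_2)
    have "\<bar>second_deriv \<phi> (z + t *\<^sub>R h) h h - second_deriv \<phi> z0 h h\<bar> \<le> \<omega> * (norm h)\<^sup>2"
      using bnd seg t by simp
    then show "\<bar>\<phi> (z + h) - (\<phi> z + frechet_derivative \<phi> (at z) h + second_deriv \<phi> z0 h h / 2)\<bar>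
        \<le> \<omega> * (norm h)\<^sup>2"
      unfolding eq using \<open>\<omega> > 0\<close> by (smt (verit) field_sum_of_halves)
  qed
qed

text \<open>Second differences of \<open>\<phi>\<close> are symmetric in the two increments. By the Taylor expansion,
  a second difference over \<open>t h\<close> and \<open>t k\<close>, divided by \<open>t\<^sup>2\<close>, is close to the difference quotient in
  direction \<open>h\<close> of the derivative in direction \<open>k\<close>: the terms \<open>second_deriv \<phi> z k k / 2\<close> at the two
  base points cancel since they are frozen at \<open>z\<close>.\<close>

lemma second_deriv_symmetric:
  fixes \<phi> :: "'a::euclidean_space \<Rightarrow> real"
  assumes C2: "times_differentiable_on (Suc (Suc 0)) S \<phi>" and "open S" and z: "z \<in> S"
  shows "second_deriv \<phi> z h k = second_deriv \<phi> z k h"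
proof -
  note D = times_differentiable_2D[OF C2]
  define \<Delta> where "\<Delta> h k t = (\<phi> (z + t *\<^sub>R h + t *\<^sub>R k) - \<phi> (z + t *\<^sub>R h)) - (\<phi> (z + t *\<^sub>R k) - \<phi> z)" for h k and t :: real
  have sym: "\<Delta> h k = \<Delta> k h" for h k by (auto simp: \<Delta>_def fun_eq_iff add_ac)
  have lim: "((\<lambda>t. \<Delta> h k t / t\<^sup>2) \<longlongrightarrow> second_deriv \<phi> z k h) (at_right 0)" for h k
  proof (rule tendstoI)
    fix e :: real assume e: "e > 0"
    define D where "D = (norm k)\<^sup>2 + 1"
    have D0: "D > 0" by (simp add: D_def add_nonneg_pos)
    define \<omega> where "\<omega> = e / (4 * D)"
    have \<omega>: "\<omega> > 0" using e D0 by (simp add: \<omega>_def)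
    obtain r where r: "r > 0" "ball z (2 * r) \<subseteq> S" and
      T: "\<And>y h. y \<in> ball z r \<Longrightarrow> norm h < r \<Longrightarrow>
       \<bar>\<phi> (y + h) - (\<phi> y + frechet_derivative \<phi> (at y) h + second_deriv \<phi> z h h / 2)\<bar> \<le> \<omega> * (norm h)\<^sup>2"
      using taylor_second_order[OF C2 \<open>open S\<close> z \<omega>] by metis
    define G where "G t = (frechet_derivative \<phi> (at (z + t *\<^sub>R h)) k - frechet_derivative \<phi> (at z) k) / t" for t
    have "((\<lambda>t. z + t *\<^sub>R h) has_derivative (\<lambda>s. s *\<^sub>R h)) (at 0)"
      by (auto intro!: derivative_eq_intros)
    from has_derivative_compose[OF this, of "\<lambda>y. frechet_derivative \<phi> (at y) k" "second_deriv \<phi> z k"]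
    have "((\<lambda>t. frechet_derivative \<phi> (at (z + t *\<^sub>R h)) k) has_derivative
        (\<lambda>s. second_deriv \<phi> z k (s *\<^sub>R h))) (at 0)"
      using D(2)[OF z] by simp
    then have "DERIV (\<lambda>t. frechet_derivative \<phi> (at (z + t *\<^sub>R h)) k) 0 :> second_deriv \<phi> z k h"
      unfolding has_field_derivative_def
      using linear_scale[OF has_derivative_linear[OF D(2)[OF z]]]
      by (simp add: mult.commute[of "second_deriv \<phi> z k h"] mult_commute_abs)
    then have "(G \<longlongrightarrow> second_deriv \<phi> z k h) (at 0)"
      unfolding DERIV_def G_def by simp
    then have "(G \<longlongrightarrow> second_deriv \<phi> z k h) (at_right 0)"
      by (rule tendsto_within_subset) simp
    then have "\<forall>\<^sub>F t in at_right 0. dist (G t) (second_deriv \<phi> z k h) < e / 2"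
      using e by (intro tendstoD) auto
    moreover have "\<forall>\<^sub>F t in at_right 0. t \<in> {0<..<r / (1 + norm h + norm k)}"
      by (rule eventually_at_right_real) (use r in \<open>simp add: divide_pos_pos add_pos_nonneg\<close>)
    ultimately show "\<forall>\<^sub>F t in at_right 0. dist (\<Delta> h k t / t\<^sup>2) (second_deriv \<phi> z k h) < e"
    proof eventually_elim
      case (elim t)
      then have t: "t > 0" "t * (1 + norm h + norm k) < r"
        by (simp_all add: pos_less_divide_eq add_pos_nonneg)
      have "t + t * norm h + t * norm k < r" using t(2) by (simp add: distrib_left)
      moreover have "t * norm h \<ge> 0" "t * norm k \<ge> 0" using t(1) by simp_all
      ultimately have "t * norm h < r" "t * norm k < r" using t(1) by linarith+
      then have "\<bar>\<phi> (z + t *\<^sub>R h + t *\<^sub>R k) - (\<phi> (z + t *\<^sub>R h) + frechet_derivative \<phi> (at (z + t *\<^sub>R h)) (t *\<^sub>R k)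
            + second_deriv \<phi> z (t *\<^sub>R k) (t *\<^sub>R k) / 2)\<bar> \<le> \<omega> * (norm (t *\<^sub>R k))\<^sup>2"
         "\<bar>\<phi> (z + t *\<^sub>R k) - (\<phi> z + frechet_derivative \<phi> (at z) (t *\<^sub>R k)
            + second_deriv \<phi> z (t *\<^sub>R k) (t *\<^sub>R k) / 2)\<bar> \<le> \<omega> * (norm (t *\<^sub>R k))\<^sup>2"
        and y: "z + t *\<^sub>R h \<in> S"
        using r t T[of "z + t *\<^sub>R h" "t *\<^sub>R k"] T[of z "t *\<^sub>R k"] subsetD[OF r(2), of "z + t *\<^sub>R h"]
        by (simp_all add: dist_norm)
      then have "\<bar>\<Delta> h k t - (frechet_derivative \<phi> (at (z + t *\<^sub>R h)) (t *\<^sub>R k) - frechet_derivative \<phi> (at z) (t *\<^sub>R k))\<bar>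
         \<le> 2 * \<omega> * (norm (t *\<^sub>R k))\<^sup>2"
        unfolding \<Delta>_def by linarith
      also have "frechet_derivative \<phi> (at (z + t *\<^sub>R h)) (t *\<^sub>R k) - frechet_derivative \<phi> (at z) (t *\<^sub>R k) = t\<^sup>2 * G t"
        using t linear_scale[OF has_derivative_linear[OF D(1)[OF y]]]
          linear_scale[OF has_derivative_linear[OF D(1)[OF z]]]
        by (simp add: G_def power2_eq_square field_simps)
      finally have "\<bar>\<Delta> h k t - t\<^sup>2 * G t\<bar> \<le> t\<^sup>2 * (2 * \<omega> * (norm k)\<^sup>2)"
        by (simp add: power_mult_distrib algebra_simps)
      then have "\<bar>\<Delta> h k t / t\<^sup>2 - G t\<bar> \<le> 2 * \<omega> * (norm k)\<^sup>2"
        using t by (simp add: abs_le_iff field_simps)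
      also have "\<dots> \<le> 2 * \<omega> * D" using \<omega> by (simp add: D_def)
      also have "\<dots> = e / 2" using D0 by (simp add: \<omega>_def)
      finally show ?case using elim(1) unfolding dist_real_def by linarith
    qed
  qed
  from tendsto_unique[OF _ lim[of h k] lim[of k h, unfolded sym[of k h]]]
  show ?thesis by simp
qed

section \<open>Orthonormal frames of hyperplanes\<close>

abbreviation frame_sum :: "(nat \<Rightarrow> real^'n) \<Rightarrow> (nat \<Rightarrow> real) \<Rightarrow> real^'n" where
  "frame_sum v b \<equiv> (\<Sum>j = 1..CARD('n) - 1. b j *\<^sub>R v j)"

definition unit_normal :: "(nat \<Rightarrow> real^'n) \<Rightarrow> real^'n \<Rightarrow> bool" where
  "unit_normal v n \<longleftrightarrow> norm n = 1 \<and> (\<forall>j\<in>{1..CARD('n) - 1}. v j \<bullet> n = 0)"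

lemma orthonormal_tuplesD:
  assumes "v \<in> (orthonormal_tuples :: (nat \<Rightarrow> real^'n) set)"
  shows "\<And>j. j \<in> {1..CARD('n) - 1} \<Longrightarrow> norm (v j) = 1"
    and "\<And>i j. i \<in> {1..CARD('n) - 1} \<Longrightarrow> j \<in> {1..CARD('n) - 1} \<Longrightarrow> i \<noteq> j \<Longrightarrow> v i \<bullet> v j = 0"
  using assms unfolding orthonormal_tuples_def by (auto dest!: PiE_mem)

lemma sign_tuplesD:
  assumes "b \<in> sign_tuples TYPE('n)" "j \<in> {1..CARD('n) - 1}"
  shows "b j = -1 \<or> b j = 1"
  using assms unfolding sign_tuples_def by (auto dest!: PiE_mem)

text \<open>At most \<open>d - 1\<close> vectors cannot span a space of dimension \<open>d\<close>.\<close>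

lemma unit_normal_exists:
  fixes v :: "nat \<Rightarrow> real^'n"
  obtains n where "unit_normal v n"
proof -
  have "dim (v ` {1..CARD('n) - 1}) \<le> card {1..CARD('n) - 1}"
    by (meson card_image_le dim_le_card' finite_atLeastAtMost finite_imageI le_trans)
  also have "\<dots> < DIM(real^'n)" by (simp add: card_gt_0_iff)
  finally obtain x where "x \<noteq> 0" "\<And>y. y \<in> span (v ` {1..CARD('n) - 1}) \<Longrightarrow> orthogonal x y"
    using orthogonal_to_subspace_exists by blast
  then have "unit_normal v (sgn x)"
    unfolding unit_normal_def
    by (auto simp: norm_sgn sgn_div_norm orthogonal_def inner_commute[of "v _"] span_base)
  then show ?thesis by (rule that)
qed

lemma inner_frame_expand:
  fixes v :: "nat \<Rightarrow> real^'n"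
  assumes v: "v \<in> orthonormal_tuples" and n: "unit_normal v n"
  shows "x \<bullet> y = (\<Sum>j = 1..CARD('n) - 1. (x \<bullet> v j) * (y \<bullet> v j)) + (x \<bullet> n) * (y \<bullet> n)"
proof -
  let ?I = "{1..CARD('n) - 1}"
  define B where "B = insert n (v ` ?I)"
  note vD = orthonormal_tuplesD[OF v]
  have nD: "norm n = 1" "\<And>j. j \<in> ?I \<Longrightarrow> v j \<bullet> n = 0" using n by (auto simp: unit_normal_def)
  have inj: "inj_on v ?I"
    by (rule inj_onI) (metis inner_eq_zero_iff norm_zero vD zero_neq_one)
  have nB: "n \<notin> v ` ?I"
    using nD by (metis imageE inner_eq_zero_iff norm_zero zero_neq_one)
  have orth: "pairwise orthogonal B"
    unfolding B_def pairwise_insert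
    by (auto simp: pairwise_def orthogonal_def nD inner_commute[of n] intro!: vD(2))
  have norm1: "\<And>x. x \<in> B \<Longrightarrow> norm x = 1" unfolding B_def using vD(1) nD(1) by auto
  have "independent B"
    by (rule pairwise_orthogonal_independent[OF orth]) (use norm1 in fastforce)
  moreover have "card B = DIM(real^'n)"
    unfolding B_def using nB inj by (simp add: card_image)
  ultimately have "span B = UNIV"
    by (metis card_eq_dim dim_UNIV dim_eq_full independent_bound le_refl subset_UNIV top.extremum_unique
        card_ge_dim_independent)
  then have "y = (\<Sum>b\<in>B. (b \<bullet> y) *\<^sub>R b)"
    using orthonormal_basis_expand[OF orth norm1, of y] by (simp add: B_def inner_commute)
  then have "x \<bullet> y = (\<Sum>b\<in>B. (b \<bullet> y) * (x \<bullet> b))"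
    by (metis (mono_tags, lifting) inner_scaleR_right inner_sum_right sum.cong)
  also have "\<dots> = (x \<bullet> n) * (y \<bullet> n) + (\<Sum>j\<in>?I. (x \<bullet> v j) * (y \<bullet> v j))"
    unfolding B_def using nB inj by (simp add: sum.reindex inner_commute mult.commute)
  finally show ?thesis by simp
qed

lemma trace_frame_expand:
  fixes v :: "nat \<Rightarrow> real^'n" and X :: "real^'n^'n"
  assumes v: "v \<in> orthonormal_tuples" and n: "unit_normal v n"
  shows "trace X = (\<Sum>j = 1..CARD('n) - 1. v j \<bullet> (X *v v j)) + n \<bullet> (X *v n)"
proof -
  have "X $ i $ i = (\<Sum>j = 1..CARD('n) - 1. v j $ i * (X *v v j) $ i) + n $ i * (X *v n) $ i" for i
    using inner_frame_expand[OF v n, of "X $ i" "axis i 1"]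
    by (simp add: inner_axis inner_axis' matrix_vector_mul_component mult.commute)
  then have "trace X = (\<Sum>i\<in>UNIV. (\<Sum>j = 1..CARD('n) - 1. v j $ i * (X *v v j) $ i) + n $ i * (X *v n) $ i)"
    unfolding trace_def by simp
  also have "\<dots> = (\<Sum>j = 1..CARD('n) - 1. \<Sum>i\<in>UNIV. v j $ i * (X *v v j) $ i) + n \<bullet> (X *v n)"
    by (simp add: sum.distrib inner_vec_def sum.swap[of _ UNIV])
  finally show ?thesis by (simp add: inner_vec_def)
qed

lemma matrix_diff_mult_distrib:
  fixes A B C :: "real^'n^'n"
  shows "(A - B) ** C = A ** C - B ** C"
  by (simp add: matrix_matrix_mult_def vec_eq_iff left_diff_distrib sum_subtractf)

lemma mcf_op_eq: "mcf_op q X = (q \<bullet> (X *v q)) / (norm q)\<^sup>2 - trace X"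
proof -
  have "trace (tensor_square q ** X) = (\<Sum>i\<in>UNIV. \<Sum>j\<in>UNIV. q $ i * q $ j * X $ j $ i)"
    by (simp add: trace_def matrix_matrix_mult_def tensor_square_def)
  also have "\<dots> = (\<Sum>j\<in>UNIV. \<Sum>i\<in>UNIV. q $ j * (X $ j $ i * q $ i))"
    by (subst sum.swap) (simp add: mult_ac)
  also have "\<dots> = q \<bullet> (X *v q)"
    by (simp add: inner_vec_def matrix_vector_mult_def sum_distrib_left)
  finally have *: "trace (tensor_square q ** X) = q \<bullet> (X *v q)" .
  have "trace ((mat 1 - (1 / (norm q)\<^sup>2) *\<^sub>R tensor_square q) ** X)
      = trace X - trace (((1 / (norm q)\<^sup>2) *\<^sub>R tensor_square q) ** X)"
    by (simp add: matrix_diff_mult_distrib trace_sub)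
  also have "((1 / (norm q)\<^sup>2) *\<^sub>R tensor_square q) ** X = (1 / (norm q)\<^sup>2) *\<^sub>R (tensor_square q ** X)"
    by (simp add: matrix_matrix_mult_def vec_eq_iff sum_divide_distrib)
  also have "trace \<dots> = (1 / (norm q)\<^sup>2) * trace (tensor_square q ** X)"
    by (simp add: trace_def sum_divide_distrib)
  finally show ?thesis by (simp add: mcf_op_def *)
qed

text \<open>The curvature operator is minus the trace of \<open>X\<close> over the hyperplane orthogonal to its first
  argument, and any orthonormal frame of that hyperplane computes the trace.\<close>

lemma mcf_op_frame:
  fixes v :: "nat \<Rightarrow> real^'n"
  assumes "v \<in> orthonormal_tuples" and n: "unit_normal v n" and "s \<noteq> 0"
  shows "mcf_op (s *\<^sub>R n) X = - (\<Sum>j = 1..CARD('n) - 1. v j \<bullet> (X *v v j))"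
proof -
  have "norm n = 1" using n by (simp add: unit_normal_def)
  then show ?thesis
    unfolding mcf_op_eq trace_frame_expand[OF assms(1,2)]
    using \<open>s \<noteq> 0\<close> by (simp add: scaleR_matrix_vector_assoc[symmetric] matrix_vector_mult_scaleR power2_eq_square)
qed

lemma norm_frame_sum_le:
  fixes v :: "nat \<Rightarrow> real^'n"
  assumes v: "v \<in> orthonormal_tuples" and b: "b \<in> sign_tuples TYPE('n)"
  shows "norm (frame_sum v b) \<le> real CARD('n)"
proof -
  have "norm (b j *\<^sub>R v j) = 1" if "j \<in> {1..CARD('n) - 1}" for j
    using orthonormal_tuplesD(1)[OF v that] sign_tuplesD[OF b that] by auto
  then have "norm (frame_sum v b) \<le> (\<Sum>j = 1..CARD('n) - 1. 1)"
    by (intro sum_norm_le) simp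
  then show ?thesis by simp
qed

text \<open>The average over all signs of the left-hand side is the right-hand side. The induction derandomises
  this: each new sign is chosen to make the cross terms with the preceding ones nonpositive.\<close>

lemma exists_signs_quadratic_le:
  fixes f :: "'a::real_inner \<Rightarrow> 'a"
  assumes "linear f" "finite I"
  shows "\<exists>b. (\<forall>j\<in>I. b j \<in> {-1, 1::real}) \<and>
    (\<Sum>j\<in>I. b j *\<^sub>R v j) \<bullet> f (\<Sum>j\<in>I. b j *\<^sub>R v j) \<le> (\<Sum>j\<in>I. v j \<bullet> f (v j))"
  using \<open>finite I\<close>
proof (induction I)
  case empty
  then show ?case by simp
next
  case (insert k I)
  then obtain b where b: "\<forall>j\<in>I. b j \<in> {-1, 1::real}"
    and le: "(\<Sum>j\<in>I. b j *\<^sub>R v j) \<bullet> f (\<Sum>j\<in>I. b j *\<^sub>R v j) \<le> (\<Sum>j\<in>I. v j \<bullet> f (v j))" by blast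
  define s where "s = (\<Sum>j\<in>I. b j *\<^sub>R v j)"
  define c where "c = (if s \<bullet> f (v k) + v k \<bullet> f s \<le> 0 then 1 else -1 :: real)"
  have c: "c \<in> {-1, 1}" "c * c = 1" "c * (s \<bullet> f (v k) + v k \<bullet> f s) \<le> 0" by (auto simp: c_def)
  have "(\<Sum>j\<in>insert k I. (b(k := c)) j *\<^sub>R v j) = c *\<^sub>R v k + s"
    using insert by (auto simp: s_def intro!: sum.cong)
  moreover have "(c *\<^sub>R v k + s) \<bullet> f (c *\<^sub>R v k + s)
      = (c * c) * (v k \<bullet> f (v k)) + c * (s \<bullet> f (v k) + v k \<bullet> f s) + s \<bullet> f s"
    using \<open>linear f\<close> by (simp add: linear_add linear_scale inner_add_left inner_add_right algebra_simps)
  moreover have "\<dots> \<le> v k \<bullet> f (v k) + (\<Sum>j\<in>I. v j \<bullet> f (v j))"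
    using c le by (simp add: s_def)
  moreover have "\<forall>j\<in>insert k I. (b(k := c)) j \<in> {-1, 1}" using b c(1) by auto
  ultimately show ?case
    using insert.hyps by (intro exI[of _ "b(k := c)"]) auto
qed

text \<open>Flipping all signs at once leaves the quadratic term unchanged and negates the linear one, so both
  can be controlled simultaneously.\<close>

lemma exists_signs_curvature_le:
  fixes v :: "nat \<Rightarrow> real^'n" and X :: "real^'n^'n"
  obtains b where "b \<in> sign_tuples TYPE('n)" "q \<bullet> frame_sum v b \<le> 0"
    "frame_sum v b \<bullet> (X *v frame_sum v b) \<le> (\<Sum>j = 1..CARD('n) - 1. v j \<bullet> (X *v v j))"
proof -
  let ?I = "{1..CARD('n) - 1}"
  obtain b where b: "\<forall>j\<in>?I. b j \<in> {-1, 1::real}"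
    and le: "frame_sum v b \<bullet> (X *v frame_sum v b) \<le> (\<Sum>j\<in>?I. v j \<bullet> (X *v v j))"
    using exists_signs_quadratic_le[of "(*v) X" ?I v] by auto
  define c where "c = (if q \<bullet> frame_sum v b \<le> 0 then 1 else -1 :: real)"
  define b' where "b' = (\<lambda>j\<in>?I. c * b j)"
  have "frame_sum v b' = (\<Sum>j\<in>?I. c *\<^sub>R (b j *\<^sub>R v j))" unfolding b'_def by (rule sum.cong) auto
  then have s: "frame_sum v b' = c *\<^sub>R frame_sum v b" by (simp add: scaleR_sum_right)
  show ?thesis
  proof (rule that[of b'])
    show "b' \<in> sign_tuples TYPE('n)"
      using b by (auto simp: b'_def sign_tuples_def c_def)
    show "q \<bullet> frame_sum v b' \<le> 0" unfolding s by (auto simp: c_def)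
    show "frame_sum v b' \<bullet> (X *v frame_sum v b') \<le> (\<Sum>j\<in>?I. v j \<bullet> (X *v v j))"
      using le unfolding s by (auto simp: c_def matrix_vector_mult_scaleR scaleR_minus_left[symmetric] simp del: scaleR_minus_left)
  qed
qed

lemma exists_signs_steepest:
  fixes v :: "nat \<Rightarrow> real^'n"
  obtains b where "b \<in> sign_tuples TYPE('n)"
    "p \<bullet> frame_sum v b = - (\<Sum>j = 1..CARD('n) - 1. \<bar>p \<bullet> v j\<bar>)"
proof
  let ?b = "\<lambda>j\<in>{1..CARD('n) - 1}. if p \<bullet> v j \<le> 0 then 1 else -1 :: real"
  show "?b \<in> sign_tuples TYPE('n)" by (auto simp: sign_tuples_def)
  have "p \<bullet> frame_sum v ?b = (\<Sum>j = 1..CARD('n) - 1. ?b j * (p \<bullet> v j))"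
    by (simp add: inner_sum_right)
  also have "\<dots> = (\<Sum>j = 1..CARD('n) - 1. - \<bar>p \<bullet> v j\<bar>)" by (rule sum.cong) auto
  finally show "p \<bullet> frame_sum v ?b = - (\<Sum>j = 1..CARD('n) - 1. \<bar>p \<bullet> v j\<bar>)" by (simp add: sum_negf)
qed

text \<open>The first-order condition for a maximum of the Rayleigh quotient: otherwise replacing \<open>u\<close> by
  \<open>u + t w\<close>, with \<open>t\<close> a small multiple of \<open>u \<bullet> f w\<close>, would increase it.\<close>

lemma quadratic_max_orthogonal:
  fixes f :: "'a::euclidean_space \<Rightarrow> 'a"
  assumes f: "linear f" and sym: "\<And>x y. x \<bullet> f y = f x \<bullet> y" and S: "subspace S"
    and u: "u \<in> S" "norm u = 1" and max: "\<And>x. x \<in> S \<Longrightarrow> norm x = 1 \<Longrightarrow> x \<bullet> f x \<le> u \<bullet> f u"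
    and w: "w \<in> S" "u \<bullet> w = 0"
  shows "u \<bullet> f w = 0"
proof (rule ccontr)
  assume ne: "u \<bullet> f w \<noteq> 0"
  define a where "a = u \<bullet> f w"
  define C where "C = \<bar>w \<bullet> f w\<bar> + \<bar>u \<bullet> f u\<bar> * (w \<bullet> w) + 1"
  have C: "C > 0" by (simp add: C_def add_nonneg_pos)
  have ineq: "2 * t * a + t\<^sup>2 * (w \<bullet> f w) \<le> t\<^sup>2 * ((u \<bullet> f u) * (w \<bullet> w))" for t
  proof -
    let ?x = "u + t *\<^sub>R w"
    have uu: "u \<bullet> u = 1" using u(2) by (simp add: norm_eq_1)
    have nx: "?x \<bullet> ?x = 1 + t\<^sup>2 * (w \<bullet> w)"
      using w(2) uu by (simp add: inner_add_left inner_add_right inner_commute power2_eq_square)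
    have x0: "?x \<noteq> 0" using nx by (metis add_pos_nonneg inner_ge_zero inner_zero_left mult_nonneg_nonneg less_irrefl zero_le_power2 zero_less_one)
    have "sgn ?x \<bullet> f (sgn ?x) \<le> u \<bullet> f u"
      using x0 by (intro max) (auto simp: norm_sgn sgn_div_norm intro!: subspace_scale subspace_add S u w)
    then have "(?x \<bullet> f ?x) / (norm ?x)\<^sup>2 \<le> u \<bullet> f u"
      using f by (simp add: sgn_div_norm linear_scale power2_eq_square divide_inverse mult_ac)
    then have "?x \<bullet> f ?x \<le> (u \<bullet> f u) * (1 + t\<^sup>2 * (w \<bullet> w))"
      using x0 nx by (simp add: divide_le_eq dot_square_norm)
    moreover have "w \<bullet> f u = a" using sym[of w u] by (simp add: a_def inner_commute)
    then have "?x \<bullet> f ?x = u \<bullet> f u + 2 * t * a + t\<^sup>2 * (w \<bullet> f w)"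
      using f by (simp add: linear_add linear_scale inner_add_left inner_add_right a_def power2_eq_square algebra_simps)
    ultimately show ?thesis by (simp add: algebra_simps)
  qed
  \<comment> \<open>The step \<open>a / C\<close> makes the linear gain \<open>2 t a\<close> exceed the quadratic loss, at most \<open>C t\<^sup>2\<close>.\<close>
  have "2 * (a / C) * a \<le> (a / C)\<^sup>2 * ((u \<bullet> f u) * (w \<bullet> w) - w \<bullet> f w)"
    using ineq[of "a / C"] by (simp add: algebra_simps)
  also have "\<dots> \<le> (a / C)\<^sup>2 * C"
    using mult_right_mono[OF abs_ge_self, of "w \<bullet> w" "u \<bullet> f u"]
    by (intro mult_left_mono) (auto simp: C_def)
  also have "\<dots> = (a / C) * a" using C by (simp add: power2_eq_square)
  finally have "a * a \<le> 0" using C by (simp add: field_simps)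
  then have "a = 0" using zero_le_square[of a] by (metis antisym mult_eq_0_iff)
  then show False using ne by (simp add: a_def)
qed

text \<open>Spectral theorem for the compression of \<open>f\<close> to \<open>S\<close>, which \<open>f\<close> need not leave invariant: a maximiser
  of the Rayleigh quotient on \<open>S\<close> is split off and its orthogonal complement in \<open>S\<close> is treated
  by induction.\<close>

lemma orthonormal_diagonalisation:
  fixes f :: "'a::euclidean_space \<Rightarrow> 'a"
  assumes f: "linear f" and sym: "\<And>x y. x \<bullet> f y = f x \<bullet> y" and "subspace S"
  shows "\<exists>B\<subseteq>S. finite B \<and> card B = dim S \<and> (\<forall>x\<in>B. norm x = 1) \<and>
    (\<forall>x\<in>B. \<forall>y\<in>B. x \<noteq> y \<longrightarrow> x \<bullet> y = 0 \<and> x \<bullet> f y = 0)"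
  using \<open>subspace S\<close>
proof (induction "dim S" arbitrary: S)
  case 0
  then show ?case by (intro exI[of _ "{}"]) auto
next
  case (Suc m)
  then obtain x0 where x0: "x0 \<in> S" "x0 \<noteq> 0" by (metis dim_eq_0 subsetI singletonI nat.simps(3))
  have span_sub: "span {u} \<subseteq> S" if "u \<in> S" for u
    using that Suc.prems by (intro span_minimal) auto
  have "compact (S \<inter> sphere 0 1)"
    by (simp add: closed_subspace[OF Suc.prems] closed_Int_compact)
  moreover have "sgn x0 \<in> S \<inter> sphere 0 1"
    using x0 Suc.prems by (auto simp: norm_sgn sgn_div_norm intro: subspace_scale)
  moreover have "continuous_on (S \<inter> sphere 0 1) (\<lambda>x. x \<bullet> f x)"
    using f by (intro continuous_intros linear_continuous_on) (simp add: linear_conv_bounded_linear)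
  ultimately obtain u where u: "u \<in> S" "norm u = 1"
    and max: "\<And>x. x \<in> S \<Longrightarrow> norm x = 1 \<Longrightarrow> x \<bullet> f x \<le> u \<bullet> f u"
    using continuous_attains_sup[of "S \<inter> sphere 0 1" "\<lambda>x. x \<bullet> f x"] by force
  note ortho = quadratic_max_orthogonal[OF f sym Suc.prems u max]
  define T where "T = {y \<in> S. \<forall>x\<in>span {u}. orthogonal x y}"
  have T: "y \<in> S" "u \<bullet> y = 0" if "y \<in> T" for y
    using that span_base[of u "{u}"] by (auto simp: T_def orthogonal_def)
  have "subspace T"
    using Suc.prems by (auto simp: T_def subspace_def orthogonal_clauses)
  moreover have "dim T = m"
  proof -
    have "dim T + dim (span {u}) = dim S"
      unfolding T_def using u Suc.prems by (intro dim_subspace_orthogonal_to_vectors) (use span_sub[OF u(1)] in auto)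
    moreover have "dim (span {u}) = 1" using u(2) by (auto simp: dim_insert)
    ultimately show ?thesis using Suc.hyps(2) by simp
  qed
  ultimately obtain B where B: "B \<subseteq> T" "finite B" "card B = m" "\<forall>x\<in>B. norm x = 1"
    "\<forall>x\<in>B. \<forall>y\<in>B. x \<noteq> y \<longrightarrow> x \<bullet> y = 0 \<and> x \<bullet> f y = 0"
    using Suc.hyps(1) by metis
  have uB: "u \<notin> B" using B(1) T(2)[of u] u(2) by auto
  have uy: "u \<bullet> y = 0 \<and> u \<bullet> f y = 0 \<and> y \<bullet> u = 0 \<and> y \<bullet> f u = 0" if "y \<in> B" for y
    using that B(1) T[of y] ortho[of y] sym[of y u] by (auto simp: inner_commute)
  show ?case
  proof (intro exI[of _ "insert u B"] conjI)
    show "insert u B \<subseteq> S" using u B(1) T by auto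
    show "card (insert u B) = dim S" using B uB Suc.hyps(2) by simp
  qed (use B u uy in auto)
qed

text \<open>A frame of the hyperplane orthogonal to \<open>q\<close> in which \<open>X\<close> is diagonal makes the displacement
  \<open>frame_sum v b\<close> orthogonal to \<open>q\<close> and its second-order contribution independent of the signs.\<close>

lemma diagonalising_frame:
  fixes q :: "real^'n" and X :: "real^'n^'n"
  assumes X: "transpose X = X"
  obtains v n where "v \<in> orthonormal_tuples" "unit_normal v n" "q = norm q *\<^sub>R n"
    "\<And>b. q \<bullet> frame_sum v b = 0"
    "\<And>b. b \<in> sign_tuples TYPE('n) \<Longrightarrow>
      frame_sum v b \<bullet> (X *v frame_sum v b) = (\<Sum>j = 1..CARD('n) - 1. v j \<bullet> (X *v v j))"
proof -
  let ?I = "{1..CARD('n) - 1}"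
  obtain n where n: "norm n = 1" "q = norm q *\<^sub>R n"
  proof (cases "q = 0")
    case True
    then show thesis using that[of "axis undefined 1"] by simp
  next
    case False
    then show thesis using that[of "sgn q"] by (simp add: norm_sgn sgn_div_norm)
  qed
  have sym: "x \<bullet> (X *v y) = (X *v x) \<bullet> y" for x y
    by (metis X dot_lmul_matrix transpose_matrix_vector)
  have dimS: "dim {y. n \<bullet> y = 0} = CARD('n) - 1"
    using dim_hyperplane[of n] n(1) by force
  obtain B where B: "B \<subseteq> {y. n \<bullet> y = 0}" "finite B" "card B = CARD('n) - 1" "\<forall>x\<in>B. norm x = 1"
    "\<forall>x\<in>B. \<forall>y\<in>B. x \<noteq> y \<longrightarrow> x \<bullet> y = 0 \<and> x \<bullet> (X *v y) = 0"
    using orthonormal_diagonalisation[of "(*v) X" "{y. n \<bullet> y = 0}"] sym subspace_hyperplane[of n]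
    unfolding dimS by auto
  obtain h where h: "bij_betw h ?I B"
    using ex_bij_betw_nat_finite_1[OF B(2)] unfolding B(3) by blast
  define v where "v = restrict h ?I"
  have vI: "v j = h j" "v j \<in> B" if "j \<in> ?I" for j
    using that bij_betw_apply[OF h] by (auto simp: v_def)
  have neq: "v i \<noteq> v j" if "i \<in> ?I" "j \<in> ?I" "i \<noteq> j" for i j
    using that h vI by (metis bij_betw_inv_into_left)
  have v: "v \<in> orthonormal_tuples"
    unfolding orthonormal_tuples_def
    using B(4,5) vI(2) neq by (auto simp: v_def)
  have nv: "n \<bullet> v j = 0" if "j \<in> ?I" for j
    using B(1) vI(2)[OF that] by auto
  have s: "n \<bullet> frame_sum v b = 0" for b by (simp add: inner_sum_right nv)
  show ?thesis
  proof (rule that[OF v _ n(2)])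
    show "unit_normal v n" using n(1) nv by (auto simp: unit_normal_def inner_commute)
    show "q \<bullet> frame_sum v b = 0" for b by (subst n(2)) (simp only: inner_scaleR_left s mult_zero_right)
    fix b assume b: "b \<in> sign_tuples TYPE('n)"
    have "frame_sum v b \<bullet> (X *v frame_sum v b)
      = (\<Sum>i\<in>?I. \<Sum>j\<in>?I. b i * (b j * (v j \<bullet> (X *v v i))))"
      by (simp add: inner_sum_left inner_sum_right matrix_vector_mult_scaleR
          linear_sum[OF matrix_vector_mul_linear] sum_distrib_left)
    also have "\<dots> = (\<Sum>i\<in>?I. \<Sum>j\<in>?I. if j = i then v i \<bullet> (X *v v i) else 0)"
    proof (intro sum.cong refl)
      fix i j assume ij: "i \<in> ?I" "j \<in> ?I"
      then show "b i * (b j * (v j \<bullet> (X *v v i))) = (if j = i then v i \<bullet> (X *v v i) else 0)"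
        using sign_tuplesD[OF b ij(1)] B(5) vI(2) neq[of i j] by auto
    qed
    finally show "frame_sum v b \<bullet> (X *v frame_sum v b) = (\<Sum>j\<in>?I. v j \<bullet> (X *v v j))" by simp
  qed
qed

lemma frame_orthogonal_to:
  fixes q :: "real^'n"
  obtains v :: "nat \<Rightarrow> real^'n" where "v \<in> orthonormal_tuples" "\<And>b. q \<bullet> frame_sum v b = 0"
proof (rule diagonalising_frame[of "mat 1 :: real^'n^'n" q])
  show "transpose (mat 1 :: real^'n^'n) = mat 1" by (rule transpose_mat)
  fix v :: "nat \<Rightarrow> real^'n" and n assume "v \<in> orthonormal_tuples" "\<And>b. q \<bullet> frame_sum v b = 0"
  then show thesis by (rule that)
qed

section \<open>Parabolic expansions\<close>

abbreviation expansion_error ::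
    "((real^'n) \<times> real \<Rightarrow> real) \<Rightarrow> real^'n \<Rightarrow> real \<Rightarrow> real^'n^'n \<Rightarrow> real^'n \<Rightarrow> real \<Rightarrow> real^'n \<Rightarrow> real \<Rightarrow> real" where
  "expansion_error \<phi> q \<tau> X y s k e \<equiv>
    \<bar>\<phi> (y + k, s - e) - (\<phi> (y, s) + q \<bullet> k - e * \<tau> + (k \<bullet> (X *v k)) / 2)\<bar>"

text \<open>A second-order expansion at \<open>z0\<close> that weighs time like the square of space, uniform over base
  points near \<open>z0\<close>. Only the gradient \<open>q\<close> is allowed to follow the base point, because it multiplies
  increments of order \<open>\<epsilon>\<close>; the time derivative and the Hessian may be frozen at \<open>z0\<close>.
  In this form a test function can be perturbed by a sum rule, without differentiating again.\<close>

definition parabolic_expansion ::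
    "((real^'n) \<times> real \<Rightarrow> real) \<Rightarrow> (real^'n) \<times> real \<Rightarrow> real^'n \<Rightarrow> real \<Rightarrow> real^'n^'n \<Rightarrow> bool" where
  "parabolic_expansion \<phi> z0 p \<tau> X \<longleftrightarrow>
    (\<forall>\<omega>>0. \<exists>r>0. \<forall>y s. (y, s) \<in> ball z0 r \<longrightarrow> (\<exists>q\<in>ball p \<omega>.
      \<forall>k e. norm k < r \<longrightarrow> 0 \<le> e \<longrightarrow> e < r \<longrightarrow>
        expansion_error \<phi> q \<tau> X y s k e \<le> \<omega> * ((norm k)\<^sup>2 + e)))"

lemma parabolic_expansion_uminus:
  fixes \<phi> :: "(real^'n) \<times> real \<Rightarrow> real"
  assumes "parabolic_expansion \<phi> z0 p \<tau> X"
  shows "parabolic_expansion (\<lambda>z. - \<phi> z) z0 (- p) (- \<tau>) (- X)"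
  unfolding parabolic_expansion_def
proof (intro allI impI)
  fix \<omega> :: real assume "\<omega> > 0"
  then obtain r where "r > 0" and r: "\<And>y s. (y, s) \<in> ball z0 r \<Longrightarrow> \<exists>q\<in>ball p \<omega>.
      \<forall>k e. norm k < r \<longrightarrow> 0 \<le> e \<longrightarrow> e < r \<longrightarrow>
        expansion_error \<phi> q \<tau> X y s k e \<le> \<omega> * ((norm k)\<^sup>2 + e)"
    using assms unfolding parabolic_expansion_def by meson
  have neg: "(- X) *v k = - (X *v k)" for k
    by (simp add: vec_eq_iff matrix_vector_mult_def sum_negf)
  show "\<exists>r>0. \<forall>y s. (y, s) \<in> ball z0 r \<longrightarrow> (\<exists>q\<in>ball (- p) \<omega>.
      \<forall>k e. norm k < r \<longrightarrow> 0 \<le> e \<longrightarrow> e < r \<longrightarrow>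
        \<bar>- \<phi> (y + k, s - e) - (- \<phi> (y, s) + q \<bullet> k - e * - \<tau> + (k \<bullet> ((- X) *v k)) / 2)\<bar>
          \<le> \<omega> * ((norm k)\<^sup>2 + e))"
  proof (intro exI[of _ r] conjI allI impI)
    fix y s assume "(y, s) \<in> ball z0 r"
    then obtain q where q: "q \<in> ball p \<omega>" and
      qq: "\<And>k e. norm k < r \<Longrightarrow> 0 \<le> e \<Longrightarrow> e < r \<Longrightarrow>
        expansion_error \<phi> q \<tau> X y s k e \<le> \<omega> * ((norm k)\<^sup>2 + e)" using r by blast
    show "\<exists>q\<in>ball (- p) \<omega>.
      \<forall>k e. norm k < r \<longrightarrow> 0 \<le> e \<longrightarrow> e < r \<longrightarrow>
        \<bar>- \<phi> (y + k, s - e) - (- \<phi> (y, s) + q \<bullet> k - e * - \<tau> + (k \<bullet> ((- X) *v k)) / 2)\<bar>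
          \<le> \<omega> * ((norm k)\<^sup>2 + e)"
    proof (intro bexI[of _ "- q"] allI impI)
      show "- q \<in> ball (- p) \<omega>" using q by (simp add: dist_minus)
      fix k :: "real^'n" and e assume "norm k < r" "0 \<le> e" "e < r"
      from qq[OF this] show "\<bar>- \<phi> (y + k, s - e) - (- \<phi> (y, s) + - q \<bullet> k - e * - \<tau> + (k \<bullet> ((- X) *v k)) / 2)\<bar>
          \<le> \<omega> * ((norm k)\<^sup>2 + e)"
        unfolding neg inner_minus_left inner_minus_right by (simp add: abs_le_iff)
    qed
  qed fact
qed

lemma parabolic_expansion_add:
  fixes \<phi>1 \<phi>2 :: "(real^'n) \<times> real \<Rightarrow> real"
  assumes 1: "parabolic_expansion \<phi>1 z0 p1 \<tau>1 X1" and 2: "parabolic_expansion \<phi>2 z0 p2 \<tau>2 X2"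
  shows "parabolic_expansion (\<lambda>z. \<phi>1 z + \<phi>2 z) z0 (p1 + p2) (\<tau>1 + \<tau>2) (X1 + X2)"
  unfolding parabolic_expansion_def
proof (intro allI impI)
  fix \<omega> :: real assume "\<omega> > 0"
  then have \<omega>: "\<omega> / 2 > 0" by simp
  obtain r1 where "r1 > 0" and r1: "\<And>y s. (y, s) \<in> ball z0 r1 \<Longrightarrow> \<exists>q\<in>ball p1 (\<omega> / 2).
      \<forall>k e. norm k < r1 \<longrightarrow> 0 \<le> e \<longrightarrow> e < r1 \<longrightarrow>
        expansion_error \<phi>1 q \<tau>1 X1 y s k e \<le> (\<omega> / 2) * ((norm k)\<^sup>2 + e)"
    using 1 \<omega> unfolding parabolic_expansion_def by meson
  obtain r2 where "r2 > 0" and r2: "\<And>y s. (y, s) \<in> ball z0 r2 \<Longrightarrow> \<exists>q\<in>ball p2 (\<omega> / 2).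
      \<forall>k e. norm k < r2 \<longrightarrow> 0 \<le> e \<longrightarrow> e < r2 \<longrightarrow>
        expansion_error \<phi>2 q \<tau>2 X2 y s k e \<le> (\<omega> / 2) * ((norm k)\<^sup>2 + e)"
    using 2 \<omega> unfolding parabolic_expansion_def by meson
  define r where "r = min r1 r2"
  show "\<exists>r>0. \<forall>y s. (y, s) \<in> ball z0 r \<longrightarrow> (\<exists>q\<in>ball (p1 + p2) \<omega>.
      \<forall>k e. norm k < r \<longrightarrow> 0 \<le> e \<longrightarrow> e < r \<longrightarrow>
        \<bar>\<phi>1 (y + k, s - e) + \<phi>2 (y + k, s - e) - (\<phi>1 (y, s) + \<phi>2 (y, s) + q \<bullet> k - e * (\<tau>1 + \<tau>2)
            + (k \<bullet> ((X1 + X2) *v k)) / 2)\<bar> \<le> \<omega> * ((norm k)\<^sup>2 + e))"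
  proof (intro exI[of _ r] conjI allI impI)
    show "r > 0" using \<open>r1 > 0\<close> \<open>r2 > 0\<close> by (simp add: r_def)
    fix y s assume "(y, s) \<in> ball z0 r"
    then have "(y, s) \<in> ball z0 r1" "(y, s) \<in> ball z0 r2" by (simp_all add: r_def)
    then obtain q1 q2 where q: "q1 \<in> ball p1 (\<omega> / 2)" "q2 \<in> ball p2 (\<omega> / 2)" and
      q1: "\<And>k e. norm k < r1 \<Longrightarrow> 0 \<le> e \<Longrightarrow> e < r1 \<Longrightarrow>
        expansion_error \<phi>1 q1 \<tau>1 X1 y s k e \<le> (\<omega> / 2) * ((norm k)\<^sup>2 + e)" and
      q2: "\<And>k e. norm k < r2 \<Longrightarrow> 0 \<le> e \<Longrightarrow> e < r2 \<Longrightarrow>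
        expansion_error \<phi>2 q2 \<tau>2 X2 y s k e \<le> (\<omega> / 2) * ((norm k)\<^sup>2 + e)"
      using r1[of y s] r2[of y s] by blast
    show "\<exists>q\<in>ball (p1 + p2) \<omega>.
      \<forall>k e. norm k < r \<longrightarrow> 0 \<le> e \<longrightarrow> e < r \<longrightarrow>
        \<bar>\<phi>1 (y + k, s - e) + \<phi>2 (y + k, s - e) - (\<phi>1 (y, s) + \<phi>2 (y, s) + q \<bullet> k - e * (\<tau>1 + \<tau>2)
            + (k \<bullet> ((X1 + X2) *v k)) / 2)\<bar> \<le> \<omega> * ((norm k)\<^sup>2 + e)"
    proof (intro bexI[of _ "q1 + q2"] allI impI)
      have "dist (p1 + p2) (q1 + q2) \<le> dist p1 q1 + dist p2 q2" by (rule dist_triangle_add)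
      then show "q1 + q2 \<in> ball (p1 + p2) \<omega>" using q by simp
      fix k :: "real^'n" and e assume "norm k < r" "0 \<le> e" "e < r"
      then have "expansion_error \<phi>1 q1 \<tau>1 X1 y s k e
          + expansion_error \<phi>2 q2 \<tau>2 X2 y s k e \<le> \<omega> * ((norm k)\<^sup>2 + e)"
        using q1[of k e] q2[of k e] by (simp add: r_def)
      moreover have "(k \<bullet> ((X1 + X2) *v k)) / 2 = (k \<bullet> (X1 *v k)) / 2 + (k \<bullet> (X2 *v k)) / 2"
        by (simp add: matrix_vector_mult_add_rdistrib inner_add_right add_divide_distrib)
      ultimately show "\<bar>\<phi>1 (y + k, s - e) + \<phi>2 (y + k, s - e) - (\<phi>1 (y, s) + \<phi>2 (y, s) + (q1 + q2) \<bullet> k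
            - e * (\<tau>1 + \<tau>2) + (k \<bullet> ((X1 + X2) *v k)) / 2)\<bar> \<le> \<omega> * ((norm k)\<^sup>2 + e)"
        unfolding inner_add_left distrib_left by linarith
    qed
  qed
qed

lemma parabolic_expansion_const:
  "parabolic_expansion (\<lambda>_. c) z0 (0 :: real^'n) 0 0"
  unfolding parabolic_expansion_def by (intro allI impI exI[of _ 1]) (auto intro!: bexI[of _ 0])

text \<open>The fourth power in space has vanishing second derivatives at \<open>z0\<close>; in time the square is enough,
  as only first derivatives in time matter.\<close>

definition strict_bump :: "(real^'n) \<times> real \<Rightarrow> (real^'n) \<times> real \<Rightarrow> real" where
  "strict_bump z0 z = ((norm (fst z - fst z0))\<^sup>2)\<^sup>2 + (snd z - snd z0)\<^sup>2"

lemma strict_bump_pos: "z \<noteq> z0 \<Longrightarrow> strict_bump z0 z > 0"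
  unfolding strict_bump_def
  by (cases "fst z = fst z0") (auto simp: prod_eq_iff intro!: add_pos_nonneg)

lemma strict_bump_self [simp]: "strict_bump z0 z0 = 0"
  by (simp add: strict_bump_def)

lemma continuous_on_strict_bump [continuous_intros]: "continuous_on S (strict_bump z0)"
  unfolding strict_bump_def by (intro continuous_intros)

lemma parabolic_expansion_strict_bump:
  fixes z0 :: "(real^'n) \<times> real"
  shows "parabolic_expansion (strict_bump z0) z0 0 0 0"
  unfolding parabolic_expansion_def
proof (intro allI impI)
  fix \<omega> :: real assume \<omega>: "\<omega> > 0"
  define r where "r = min 1 (\<omega> / 12)"
  have r: "0 < r" "r \<le> 1" "12 * r \<le> \<omega>" using \<omega> by (auto simp: r_def)
  obtain x0 t0 where z0: "z0 = (x0, t0)" by (cases z0)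
  show "\<exists>r>0. \<forall>y s. (y, s) \<in> ball z0 r \<longrightarrow> (\<exists>q\<in>ball 0 \<omega>.
      \<forall>k e. norm k < r \<longrightarrow> 0 \<le> e \<longrightarrow> e < r \<longrightarrow>
        \<bar>strict_bump z0 (y + k, s - e) - (strict_bump z0 (y, s) + q \<bullet> k - e * 0
          + (k \<bullet> ((0::real^'n^'n) *v k)) / 2)\<bar> \<le> \<omega> * ((norm k)\<^sup>2 + e))"
  proof (intro exI[of _ r] conjI allI impI)
    fix y s assume ys: "(y, s) \<in> ball z0 r"
    define a where "a = y - x0"
    have a: "norm a < r" "\<bar>s - t0\<bar> < r"
      using ys dist_fst_le[of z0 "(y, s)"] dist_snd_le[of z0 "(y, s)"]
      by (auto simp: z0 a_def dist_norm norm_minus_commute)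
    have a2: "(norm a)\<^sup>2 \<le> r"
    proof -
      have "(norm a)\<^sup>2 \<le> r * r" unfolding power2_eq_square using a(1) r(1) by (intro mult_mono) auto
      also have "\<dots> \<le> r" using r by (simp add: mult_left_le)
      finally show ?thesis .
    qed
    show "\<exists>q\<in>ball 0 \<omega>. \<forall>k e. norm k < r \<longrightarrow> 0 \<le> e \<longrightarrow> e < r \<longrightarrow>
        \<bar>strict_bump z0 (y + k, s - e) - (strict_bump z0 (y, s) + q \<bullet> k - e * 0
          + (k \<bullet> ((0::real^'n^'n) *v k)) / 2)\<bar> \<le> \<omega> * ((norm k)\<^sup>2 + e)"
    proof (intro bexI[of _ "(4 * (norm a)\<^sup>2) *\<^sub>R a"] allI impI)
      have "4 * (norm a)\<^sup>2 * norm a \<le> 4 * r * 1"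
        using a a2 r by (intro mult_mono) auto
      then show "(4 * (norm a)\<^sup>2) *\<^sub>R a \<in> ball 0 \<omega>" using r by simp
      fix k :: "real^'n" and e assume k: "norm k < r" and e: "0 \<le> e" "e < r"
      have ak: "\<bar>a \<bullet> k\<bar> \<le> norm a * norm k" by (rule Cauchy_Schwarz_ineq2)
      have n2: "(norm (y + k - x0))\<^sup>2 = (norm a)\<^sup>2 + 2 * (a \<bullet> k) + (norm k)\<^sup>2"
        by (simp add: a_def power2_norm_eq_inner inner_add_left inner_add_right inner_diff_left inner_diff_right inner_commute)
      have k2: "(norm k)\<^sup>2 \<le> r"
      proof -
        have "(norm k)\<^sup>2 \<le> r * r" unfolding power2_eq_square using k r(1) by (intro mult_mono) auto
        also have "\<dots> \<le> r" using r by (simp add: mult_left_le)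
        finally show ?thesis .
      qed
      have rr: "\<bar>a \<bullet> k\<bar> \<le> r"
      proof -
        have "norm a * norm k \<le> r * 1" using a k r by (intro mult_mono) auto
        then show ?thesis using ak by simp
      qed
      have ak2: "(a \<bullet> k)\<^sup>2 \<le> r * (norm k)\<^sup>2"
      proof -
        have "(a \<bullet> k)\<^sup>2 \<le> (norm a * norm k)\<^sup>2" using power_mono[OF ak abs_ge_zero, of 2] by simp
        also have "\<dots> \<le> r * (norm k)\<^sup>2" unfolding power_mult_distrib by (intro mult_right_mono a2) simp
        finally show ?thesis .
      qed
      have "strict_bump z0 (y + k, s - e) - (strict_bump z0 (y, s) + ((4 * (norm a)\<^sup>2) *\<^sub>R a) \<bullet> k)
        = (2 * (norm a)\<^sup>2 + 4 * (a \<bullet> k) + (norm k)\<^sup>2) * (norm k)\<^sup>2 + 4 * (a \<bullet> k)\<^sup>2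
          + (e - 2 * (s - t0)) * e" (is "?l = ?A + 4 * (a \<bullet> k)\<^sup>2 + ?B")
        unfolding strict_bump_def z0 fst_conv snd_conv n2 a_def[symmetric] inner_scaleR_left
        by (simp add: power2_eq_square algebra_simps)
      moreover have "\<bar>?A\<bar> \<le> (7 * r) * (norm k)\<^sup>2"
        unfolding abs_mult abs_power2[of "norm k"]
      proof (rule mult_right_mono)
        show "\<bar>2 * (norm a)\<^sup>2 + 4 * (a \<bullet> k) + (norm k)\<^sup>2\<bar> \<le> 7 * r"
          using a2 k2 rr zero_le_power2[of "norm a"] zero_le_power2[of "norm k"] by linarith
      qed simp
      moreover have "\<bar>?B\<bar> \<le> (3 * r) * e"
        unfolding abs_mult using a e by (intro mult_mono) auto
      ultimately have "\<bar>?l\<bar> \<le> (7 * r) * (norm k)\<^sup>2 + 4 * (r * (norm k)\<^sup>2) + (3 * r) * e"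
        using ak2 zero_le_power2[of "a \<bullet> k"] by linarith
      also have "\<dots> \<le> 12 * r * ((norm k)\<^sup>2 + e)"
        using r e by (simp add: algebra_simps)
      also have "\<dots> \<le> \<omega> * ((norm k)\<^sup>2 + e)"
        using r e by (intro mult_right_mono) auto
      finally show "\<bar>strict_bump z0 (y + k, s - e) - (strict_bump z0 (y, s) + ((4 * (norm a)\<^sup>2) *\<^sub>R a) \<bullet> k - e * 0
          + (k \<bullet> ((0::real^'n^'n) *v k)) / 2)\<bar> \<le> \<omega> * ((norm k)\<^sup>2 + e)" by simp
    qed
  qed (use r in auto)
qed

lemma space_hessian_symmetric:
  fixes \<phi> :: "(real^'n) \<times> real \<Rightarrow> real"
  assumes "times_differentiable_on (Suc (Suc 0)) S \<phi>" "open S" "z \<in> S"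
  shows "transpose (space_hessian \<phi> z) = space_hessian \<phi> z"
  using second_deriv_symmetric[OF assms]
  by (simp add: transpose_def space_hessian_def space_partial_def[abs_def] vec_eq_iff)

text \<open>In the full space-time Taylor expansion, the mixed and the pure second time derivatives contribute
  \<open>O(e |k| + e\<^sup>2)\<close>, which is negligible at the parabolic scale.\<close>

lemma parabolic_expansion_smooth:
  fixes \<phi> :: "(real^'n) \<times> real \<Rightarrow> real"
  assumes C2: "times_differentiable_on (Suc (Suc 0)) S \<phi>" and S: "open S" "z0 \<in> S"
  shows "parabolic_expansion \<phi> z0 (space_grad \<phi> z0) (time_deriv \<phi> z0) (space_hessian \<phi> z0)"
  unfolding parabolic_expansion_def
proof (intro allI impI)
  fix \<omega> :: real assume \<omega>: "\<omega> > 0"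
  note D = times_differentiable_2D[OF C2]
  let ?B = "second_deriv \<phi> z0"
  have bil: "bilinear ?B" by (rule bilinear_second_deriv[OF C2 S])
  obtain M where M: "M > 0" "\<And>h k. \<bar>?B h k\<bar> \<le> M * norm h * norm k"
    using bilinear_bounded_pos[OF bil] by (auto simp: real_norm_def)
  have decomp: "(k, c) = (\<Sum>i\<in>UNIV. (k $ i) *\<^sub>R (axis i 1, 0::real)) + c *\<^sub>R (0 :: real^'n, 1)" for k :: "real^'n" and c
    by (simp add: prod_eq_iff fst_sum snd_sum basis_expansion[symmetric] vec_eq_iff axis_def if_distrib cong: if_cong)
  have grad: "frechet_derivative \<phi> (at z) (k, - e) = space_grad \<phi> z \<bullet> k - e * time_deriv \<phi> z"
    if "z \<in> S" for z k e
  proof -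
    have lin: "linear (frechet_derivative \<phi> (at z))" using D(1)[OF that] has_derivative_linear by blast
    show ?thesis
      unfolding decomp[of k] linear_add[OF lin] linear_sum[OF lin] linear_scale[OF lin]
      by (simp add: space_grad_def space_partial_def time_deriv_def inner_vec_def mult.commute)
  qed
  have hess: "?B (k, 0) (k, 0) = k \<bullet> (space_hessian \<phi> z0 *v k)" for k
  proof -
    have k: "(k, 0) = (\<Sum>i\<in>UNIV. (k $ i) *\<^sub>R (axis i 1, 0::real))" using decomp[of k 0] by (simp only: scaleR_zero_left add_0_right)
    have "?B (k, 0) (k, 0) = (\<Sum>(i,j)\<in>UNIV \<times> UNIV. ?B ((k $ i) *\<^sub>R (axis i 1, 0)) ((k $ j) *\<^sub>R (axis j 1, 0)))"
      unfolding k by (rule bilinear_sum[OF bil])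
    also have "\<dots> = (\<Sum>i\<in>UNIV. \<Sum>j\<in>UNIV. k $ i * k $ j * ?B (axis i 1, 0) (axis j 1, 0))"
      unfolding sum.cartesian_product
      by (rule sum.cong) (auto simp only: bilinear_lmul[OF bil] bilinear_rmul[OF bil] real_scaleR_def mult_ac)
    also have "\<dots> = (\<Sum>i\<in>UNIV. \<Sum>j\<in>UNIV. k $ i * (space_hessian \<phi> z0 $ i $ j * k $ j))"
      using second_deriv_symmetric[OF C2 S]
      by (simp add: space_hessian_def space_partial_def[abs_def] mult_ac)
    finally show ?thesis by (simp add: inner_vec_def matrix_vector_mult_def sum_distrib_left)
  qed
  have expand: "?B (k, - e) (k, - e) = k \<bullet> (space_hessian \<phi> z0 *v k)
      - 2 * e * ?B (k, 0) (0, 1) + e\<^sup>2 * ?B (0, 1) (0, 1)" for k e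
  proof -
    have ke: "(k, - e) = (k, 0) + (- e) *\<^sub>R (0, 1)" by simp
    show ?thesis
      unfolding ke bilinear_ladd[OF bil] bilinear_radd[OF bil] bilinear_lmul[OF bil] bilinear_rmul[OF bil] hess
      using second_deriv_symmetric[OF C2 S, of "(k, 0)" "(0, 1)"]
      by (simp add: power2_eq_square algebra_simps)
  qed
  have "\<forall>\<^sub>F z in nhds z0. dist (frechet_derivative \<phi> (at z) h) (frechet_derivative \<phi> (at z0) h) < c" if "c > 0" for h c
    using has_derivative_continuous[OF D(2)[OF S(2), of h]] that
    unfolding isCont_def tendsto_at_iff_tendsto_nhds[of "\<lambda>z. frechet_derivative \<phi> (at z) h"] by (rule tendstoD)
  note near = this
  define c where "c = \<omega> / 4"
  have c: "c > 0" using \<omega> by (simp add: c_def)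
  have "((\<lambda>z. space_grad \<phi> z) \<longlongrightarrow> space_grad \<phi> z0) (nhds z0)"
    unfolding space_grad_def space_partial_def
    by (intro tendsto_vec_lambda tendstoI near)
  then have "\<forall>\<^sub>F z in nhds z0. dist (space_grad \<phi> z) (space_grad \<phi> z0) < \<omega>"
    using \<omega> by (rule tendstoD)
  moreover have "\<forall>\<^sub>F z in nhds z0. dist (time_deriv \<phi> z) (time_deriv \<phi> z0) < c"
    unfolding time_deriv_def by (rule near[OF c])
  ultimately have "\<forall>\<^sub>F z in nhds z0. dist (space_grad \<phi> z) (space_grad \<phi> z0) < \<omega>
      \<and> dist (time_deriv \<phi> z) (time_deriv \<phi> z0) < c" by eventually_elim simp
  then obtain r1 where r1: "r1 > 0" "\<And>z. z \<in> ball z0 r1 \<Longrightarrow> dist (space_grad \<phi> z0) (space_grad \<phi> z) < \<omega>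
      \<and> \<bar>time_deriv \<phi> z - time_deriv \<phi> z0\<bar> < c"
    unfolding eventually_nhds_metric by (auto simp: dist_commute dist_real_def)
  obtain r2 where r2: "r2 > 0" "ball z0 (2 * r2) \<subseteq> S" and
      T: "\<And>z h. z \<in> ball z0 r2 \<Longrightarrow> norm h < r2 \<Longrightarrow>
       \<bar>\<phi> (z + h) - (\<phi> z + frechet_derivative \<phi> (at z) h + second_deriv \<phi> z0 h h / 2)\<bar> \<le> c * (norm h)\<^sup>2"
    using taylor_second_order[OF C2 S c] by metis
  define r where "r = Min {1, r1, r2 / 2, c / (2 * M)}"
  have r: "0 < r" "r \<le> 1" "r \<le> r1" "r \<le> r2 / 2" "r \<le> c / (2 * M)"
    using r1 r2 c M by (auto simp: r_def)
  show "\<exists>r>0. \<forall>y s. (y, s) \<in> ball z0 r \<longrightarrow> (\<exists>q\<in>ball (space_grad \<phi> z0) \<omega>.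
      \<forall>k e. norm k < r \<longrightarrow> 0 \<le> e \<longrightarrow> e < r \<longrightarrow>
        \<bar>\<phi> (y + k, s - e) - (\<phi> (y, s) + q \<bullet> k - e * time_deriv \<phi> z0 + (k \<bullet> (space_hessian \<phi> z0 *v k)) / 2)\<bar>
          \<le> \<omega> * ((norm k)\<^sup>2 + e))"
  proof (intro exI[of _ r] conjI allI impI)
    fix y s assume "(y, s) \<in> ball z0 r"
    then have z: "(y, s) \<in> ball z0 r1" "(y, s) \<in> ball z0 r2" "(y, s) \<in> S"
      using r r2 by (auto intro!: subsetD[OF r2(2)])
    show "\<exists>q\<in>ball (space_grad \<phi> z0) \<omega>.
      \<forall>k e. norm k < r \<longrightarrow> 0 \<le> e \<longrightarrow> e < r \<longrightarrow>
        \<bar>\<phi> (y + k, s - e) - (\<phi> (y, s) + q \<bullet> k - e * time_deriv \<phi> z0 + (k \<bullet> (space_hessian \<phi> z0 *v k)) / 2)\<bar>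
          \<le> \<omega> * ((norm k)\<^sup>2 + e)"
    proof (intro bexI[of _ "space_grad \<phi> (y, s)"] allI impI)
      show "space_grad \<phi> (y, s) \<in> ball (space_grad \<phi> z0) \<omega>" using r1(2)[OF z(1)] by simp
      fix k :: "real^'n" and e assume k: "norm k < r" and e: "0 \<le> e" "e < r"
      let ?h = "(k, - e)"
      have nh: "(norm ?h)\<^sup>2 = (norm k)\<^sup>2 + e\<^sup>2" by (simp add: norm_Pair)
      have ee: "e\<^sup>2 \<le> e" using e r by (simp add: power2_eq_square mult_left_le)
      have "norm ?h \<le> norm k + e" using norm_Pair_le[of k "- e"] e by simp
      then have "norm ?h < r2" using k e r by linarith
      from T[OF z(2) this]
      have "\<bar>\<phi> (y + k, s - e) - (\<phi> (y, s) + (space_grad \<phi> (y, s) \<bullet> k - e * time_deriv \<phi> (y, s)) + ?B ?h ?h / 2)\<bar>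
          \<le> c * ((norm k)\<^sup>2 + e\<^sup>2)"
        unfolding nh grad[OF z(3)] by simp
      also have "\<dots> \<le> c * ((norm k)\<^sup>2 + e)" using ee c by simp
      finally have 1: "\<bar>\<phi> (y + k, s - e) - (\<phi> (y, s) + (space_grad \<phi> (y, s) \<bullet> k - e * time_deriv \<phi> (y, s)) + ?B ?h ?h / 2)\<bar>
          \<le> c * ((norm k)\<^sup>2 + e)" .
      have 2: "\<bar>e * time_deriv \<phi> (y, s) - e * time_deriv \<phi> z0\<bar> \<le> e * c"
        unfolding right_diff_distrib[symmetric] abs_mult using e r1(2)[OF z(1)] by (intro mult_mono) auto
      have "M * r \<le> M * (c / (2 * M))" using r(5) M by (intro mult_left_mono) auto
      also have "\<dots> \<le> c" using M c by simp
      finally have Mr: "M * r \<le> c" .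
      have 3: "\<bar>e * ?B (k, 0) (0, 1)\<bar> \<le> e * c"
      proof -
        have "\<bar>?B (k, 0) (0, 1)\<bar> \<le> M * norm k" using M(2)[of "(k, 0)" "(0, 1)"] by simp
        also have "\<dots> \<le> M * r" using k M by (intro mult_left_mono) auto
        also have "\<dots> \<le> c" by (rule Mr)
        finally show ?thesis unfolding abs_mult using e by (intro mult_mono) auto
      qed
      have 4: "\<bar>e\<^sup>2 * ?B (0, 1) (0, 1)\<bar> \<le> e * c"
      proof -
        have "\<bar>?B (0, 1) (0, 1)\<bar> \<le> M" using M(2)[of "(0, 1)" "(0, 1)"] by simp
        then have "\<bar>e * ?B (0, 1) (0, 1)\<bar> \<le> r * M" unfolding abs_mult using e r M by (intro mult_mono) auto
        also have "\<dots> \<le> c" using Mr by (simp add: mult.commute)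
        finally have "e * \<bar>e * ?B (0, 1) (0, 1)\<bar> \<le> e * c" using e by (intro mult_left_mono) auto
        then show ?thesis using e by (simp add: power2_eq_square abs_mult mult.assoc)
      qed
      have half: "?B ?h ?h / 2 = (k \<bullet> (space_hessian \<phi> z0 *v k)) / 2 - e * ?B (k, 0) (0, 1)
          + (e\<^sup>2 * ?B (0, 1) (0, 1)) / 2"
        unfolding expand by (simp add: add_divide_distrib diff_divide_distrib)
      have "\<bar>\<phi> (y + k, s - e) - (\<phi> (y, s) + space_grad \<phi> (y, s) \<bullet> k - e * time_deriv \<phi> z0
          + (k \<bullet> (space_hessian \<phi> z0 *v k)) / 2)\<bar> \<le> c * ((norm k)\<^sup>2 + e) + e * c + e * c + e * c"
        using 1 2 3 4 half by linarith
      also have "\<dots> \<le> \<omega> * ((norm k)\<^sup>2 + e)"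
        using \<omega> by (simp add: c_def algebra_simps)
      finally show "\<bar>\<phi> (y + k, s - e) - (\<phi> (y, s) + space_grad \<phi> (y, s) \<bullet> k - e * time_deriv \<phi> z0
          + (k \<bullet> (space_hessian \<phi> z0 *v k)) / 2)\<bar> \<le> \<omega> * ((norm k)\<^sup>2 + e)" .
    qed
  qed (use r in auto)
qed

section \<open>One step of the game against a test function\<close>

lemma matrix_form_bound:
  fixes X :: "real^'n^'n"
  obtains M where "M > 0" "\<And>x y. \<bar>x \<bullet> (X *v y)\<bar> \<le> M * norm x * norm y"
proof -
  obtain M where M: "M > 0" "\<And>y. norm (X *v y) \<le> M * norm y"
    using linear_bounded_pos[OF matrix_vector_mul_linear, of X] by (metis mult.commute)
  have "\<bar>x \<bullet> (X *v y)\<bar> \<le> M * norm x * norm y" for x y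
  proof -
    have "\<bar>x \<bullet> (X *v y)\<bar> \<le> norm x * norm (X *v y)" by (rule Cauchy_Schwarz_ineq2)
    also have "\<dots> \<le> norm x * (M * norm y)" by (intro mult_left_mono M) simp
    finally show ?thesis by (simp add: mult_ac)
  qed
  then show ?thesis using M(1) that by blast
qed

lemma norm_displacement_le:
  fixes v :: "nat \<Rightarrow> real^'n"
  assumes v: "v \<in> orthonormal_tuples" and b: "b \<in> sign_tuples TYPE('n)" and w: "w \<in> sphere 0 1"
    and \<epsilon>: "0 < \<epsilon>" "\<epsilon> \<le> 1"
  shows "norm ((sqrt 2 * \<epsilon>) *\<^sub>R frame_sum v b + (\<nu> * \<epsilon>\<^sup>2) *\<^sub>R w) \<le> (2 * real CARD('n) + \<bar>\<nu>\<bar>) * \<epsilon>"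
proof -
  have s2: "sqrt 2 \<le> 2" by (rule real_le_lsqrt) auto
  have "norm ((sqrt 2 * \<epsilon>) *\<^sub>R frame_sum v b) \<le> (2 * \<epsilon>) * real CARD('n)"
    using norm_frame_sum_le[OF v b] s2 \<epsilon> unfolding norm_scaleR by (intro mult_mono) (auto simp: abs_mult)
  moreover have "norm ((\<nu> * \<epsilon>\<^sup>2) *\<^sub>R w) \<le> \<bar>\<nu>\<bar> * \<epsilon>"
    using w \<epsilon> by (simp add: abs_mult power2_eq_square mult_left_mono mult_left_le)
  ultimately show ?thesis
    using norm_triangle_ineq[of "(sqrt 2 * \<epsilon>) *\<^sub>R frame_sum v b" "(\<nu> * \<epsilon>\<^sup>2) *\<^sub>R w"]
    by (simp add: algebra_simps)
qed

lemma dist_game_move_le: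
  fixes v :: "nat \<Rightarrow> real^'n"
  assumes "v \<in> orthonormal_tuples" "w \<in> sphere 0 1" "b \<in> sign_tuples TYPE('n)" "0 < \<epsilon>" "\<epsilon> \<le> 1"
  shows "dist y (game_move \<nu> \<epsilon> y v w b) \<le> (2 * real CARD('n) + \<bar>\<nu>\<bar>) * \<epsilon>"
proof -
  have "dist y (game_move \<nu> \<epsilon> y v w b) = norm ((sqrt 2 * \<epsilon>) *\<^sub>R frame_sum v b + (\<nu> * \<epsilon>\<^sup>2) *\<^sub>R w)"
    unfolding dist_commute[of y "game_move \<nu> \<epsilon> y v w b"] by (simp add: game_move_def dist_norm add.assoc)
  then show ?thesis using norm_displacement_le[OF assms(1,3,2,4,5)] by simp
qed

lemma move_in_cball:
  fixes v :: "nat \<Rightarrow> real^'n"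
  assumes "(y, s) \<in> ball z0 (\<rho> / 2)" "0 < \<epsilon>" "\<epsilon> \<le> 1" "(2 * real CARD('n) + \<bar>\<nu>\<bar> + 1) * \<epsilon> \<le> \<rho> / 2"
    and "v \<in> orthonormal_tuples" "w \<in> sphere 0 1" "b \<in> sign_tuples TYPE('n)"
  shows "(game_move \<nu> \<epsilon> y v w b, s - \<epsilon>\<^sup>2) \<in> cball z0 \<rho>"
proof -
  let ?m = "game_move \<nu> \<epsilon> y v w b"
  have "dist (y, s) (?m, s - \<epsilon>\<^sup>2) \<le> dist y ?m + \<epsilon>\<^sup>2"
    using sqrt_sum_squares_le_sum[of "dist y ?m" "\<epsilon>\<^sup>2"] by (simp add: dist_Pair_Pair dist_real_def)
  also have "\<dots> \<le> (2 * real CARD('n) + \<bar>\<nu>\<bar>) * \<epsilon> + 1 * \<epsilon>"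
  proof (rule add_mono)
    show "dist y ?m \<le> (2 * real CARD('n) + \<bar>\<nu>\<bar>) * \<epsilon>" by (rule dist_game_move_le) (use assms in auto)
    show "\<epsilon>\<^sup>2 \<le> 1 * \<epsilon>" using assms(2,3) by (simp add: power2_eq_square mult_left_le)
  qed
  also have "\<dots> \<le> \<rho> / 2" using assms(4) by (simp add: distrib_right)
  finally show ?thesis using assms(1) dist_triangle[of z0 "(?m, s - \<epsilon>\<^sup>2)" "(y, s)"] by simp
qed

abbreviation move_error ::
    "((real^'n) \<times> real \<Rightarrow> real) \<Rightarrow> real^'n \<Rightarrow> real \<Rightarrow> real^'n^'n \<Rightarrow> real \<Rightarrow> real \<Rightarrow> real^'n \<Rightarrow> real \<Rightarrow>
      (nat \<Rightarrow> real^'n) \<Rightarrow> real^'n \<Rightarrow> (nat \<Rightarrow> real) \<Rightarrow> real" where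
  "move_error \<phi> q \<tau> X \<nu> \<epsilon> y s v w b \<equiv>
    \<bar>\<phi> (game_move \<nu> \<epsilon> y v w b, s - \<epsilon>\<^sup>2) - (\<phi> (y, s) + (sqrt 2 * \<epsilon>) * (q \<bullet> frame_sum v b)
      + \<epsilon>\<^sup>2 * (\<nu> * (q \<bullet> w) - \<tau> + frame_sum v b \<bullet> (X *v frame_sum v b)))\<bar>"

lemma game_move_expansion:
  fixes \<phi> :: "(real^'n) \<times> real \<Rightarrow> real"
  assumes exp: "parabolic_expansion \<phi> z0 p \<tau> X" and \<omega>: "\<omega> > 0"
  obtains r \<epsilon>0 where "r > 0" "\<epsilon>0 > 0"
    "\<And>y s \<epsilon>. (y, s) \<in> ball z0 r \<Longrightarrow> 0 < \<epsilon> \<Longrightarrow> \<epsilon> < \<epsilon>0 \<Longrightarrow>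
      \<exists>q\<in>ball p \<omega>. \<forall>v\<in>orthonormal_tuples. \<forall>w\<in>sphere 0 1. \<forall>b\<in>sign_tuples TYPE('n).
        move_error \<phi> q \<tau> X \<nu> \<epsilon> y s v w b \<le> \<omega> * \<epsilon>\<^sup>2"
proof -
  define n where "n = real CARD('n)"
  have n: "n > 0" by (simp add: n_def)
  define C where "C = 2 * n + \<bar>\<nu>\<bar>"
  have C: "C > 0" using n by (simp add: C_def add_pos_nonneg)
  obtain M where M: "M > 0" "\<And>x y. \<bar>x \<bullet> (X *v y)\<bar> \<le> M * norm x * norm y"
    using matrix_form_bound[of X] by blast
  define Q where "Q = C\<^sup>2 + 1"
  define c where "c = \<omega> / (2 * Q)"
  have C1: "C\<^sup>2 + 1 \<ge> 1" by simp
  have C1p: "0 < C\<^sup>2 + 1" using C1 by linarith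
  then have c: "c > 0" using \<omega> by (simp add: c_def Q_def)
  have c2: "c * (C\<^sup>2 + 1) = \<omega> / 2" using C1p unfolding Q_def[symmetric] by (simp add: c_def)
  have c\<omega>: "c \<le> \<omega>" using mult_left_mono[OF C1, of c] c c2 \<omega> by simp
  obtain r where r: "r > 0" and rr: "\<And>y s. (y, s) \<in> ball z0 r \<Longrightarrow> \<exists>q\<in>ball p c.
      \<forall>k e. norm k < r \<longrightarrow> 0 \<le> e \<longrightarrow> e < r \<longrightarrow>
        expansion_error \<phi> q \<tau> X y s k e \<le> c * ((norm k)\<^sup>2 + e)"
    using exp c unfolding parabolic_expansion_def by meson
  define D where "D = 2 * \<bar>\<nu>\<bar> * (M * n) + \<nu>\<^sup>2 * M + 1"
  have D: "D > 0" using n M by (simp add: D_def add_nonneg_pos)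
  define \<epsilon>0 where "\<epsilon>0 = Min {1, r / C, r, \<omega> / (2 * D)}"
  have \<epsilon>0: "\<epsilon>0 > 0" "\<epsilon>0 \<le> 1" "\<epsilon>0 \<le> r / C" "\<epsilon>0 \<le> r" "\<epsilon>0 \<le> \<omega> / (2 * D)"
    using r C \<omega> D by (auto simp: \<epsilon>0_def)
  show ?thesis
  proof (rule that[OF r \<epsilon>0(1)])
    fix y s \<epsilon> assume ys: "(y, s) \<in> ball z0 r" and \<epsilon>: "0 < \<epsilon>" "\<epsilon> < \<epsilon>0"
    obtain q where q: "q \<in> ball p c" and qq: "\<And>k e. norm k < r \<Longrightarrow> 0 \<le> e \<Longrightarrow> e < r \<Longrightarrow>
        expansion_error \<phi> q \<tau> X y s k e \<le> c * ((norm k)\<^sup>2 + e)" using rr[OF ys] by blast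
    have \<epsilon>1: "\<epsilon> \<le> 1" using \<epsilon> \<epsilon>0 by linarith
    have \<epsilon>2: "\<epsilon>\<^sup>2 \<le> \<epsilon>" using \<epsilon> \<epsilon>1 by (simp add: power2_eq_square mult_left_le)
    have \<epsilon>D: "D * \<epsilon> \<le> \<omega> / 2"
    proof -
      have "D * \<epsilon> \<le> D * \<epsilon>0" using D \<epsilon> by (intro mult_mono) auto
      also have "\<dots> \<le> D * (\<omega> / (2 * D))" using D \<epsilon>0 by (intro mult_left_mono) auto
      also have "\<dots> = \<omega> / 2" using D by simp
      finally show ?thesis .
    qed
    show "\<exists>q\<in>ball p \<omega>. \<forall>v\<in>orthonormal_tuples. \<forall>w\<in>sphere 0 1. \<forall>b\<in>sign_tuples TYPE('n).
        move_error \<phi> q \<tau> X \<nu> \<epsilon> y s v w b \<le> \<omega> * \<epsilon>\<^sup>2"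
    proof (intro bexI[of _ q] ballI)
      show "q \<in> ball p \<omega>" using q c\<omega> by simp
      fix v :: "nat \<Rightarrow> real^'n" and w :: "real^'n" and b
      assume v: "v \<in> orthonormal_tuples" and w: "w \<in> sphere 0 1" and b: "b \<in> sign_tuples TYPE('n)"
      let ?s = "frame_sum v b"
      let ?k = "(sqrt 2 * \<epsilon>) *\<^sub>R ?s + (\<nu> * \<epsilon>\<^sup>2) *\<^sub>R w"
      have s: "norm ?s \<le> n" unfolding n_def by (rule norm_frame_sum_le[OF v b])
      have k: "norm ?k \<le> C * \<epsilon>"
        using norm_displacement_le[OF v b w \<epsilon>(1) \<epsilon>1] by (simp add: C_def n_def)
      also have "\<dots> < r"
      proof -
        have "C * \<epsilon> < C * \<epsilon>0" using C \<epsilon> by simp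
        also have "\<dots> \<le> C * (r / C)" using C \<epsilon>0 by (intro mult_left_mono) auto
        also have "\<dots> = r" using C by simp
        finally show ?thesis .
      qed
      finally have "norm ?k < r" .
      moreover have "\<epsilon>\<^sup>2 < r" using \<epsilon>2 \<epsilon> \<epsilon>0 by linarith
      ultimately have "\<bar>\<phi> (y + ?k, s - \<epsilon>\<^sup>2) - (\<phi> (y, s) + q \<bullet> ?k - \<epsilon>\<^sup>2 * \<tau> + (?k \<bullet> (X *v ?k)) / 2)\<bar>
          \<le> c * ((norm ?k)\<^sup>2 + \<epsilon>\<^sup>2)"
        by (intro qq) auto
      also have "\<dots> \<le> c * (C\<^sup>2 * \<epsilon>\<^sup>2 + \<epsilon>\<^sup>2)"
        using power_mono[OF k norm_ge_zero, of 2] c by (simp add: power_mult_distrib)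
      also have "\<dots> = (\<omega> / 2) * \<epsilon>\<^sup>2" unfolding c2[symmetric] by (simp add: algebra_simps)
      finally have 1: "\<bar>\<phi> (y + ?k, s - \<epsilon>\<^sup>2) - (\<phi> (y, s) + q \<bullet> ?k - \<epsilon>\<^sup>2 * \<tau> + (?k \<bullet> (X *v ?k)) / 2)\<bar>
          \<le> (\<omega> / 2) * \<epsilon>\<^sup>2" .
      define E where "E = (sqrt 2 / 2 * \<nu>) * (?s \<bullet> (X *v w) + w \<bullet> (X *v ?s)) + \<nu>\<^sup>2 / 2 * \<epsilon> * (w \<bullet> (X *v w))"
      have quad: "(?k \<bullet> (X *v ?k)) / 2 = \<epsilon>\<^sup>2 * (?s \<bullet> (X *v ?s)) + \<epsilon>\<^sup>2 * (\<epsilon> * E)"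
      proof -
        have "?k \<bullet> (X *v ?k) = (sqrt 2 * \<epsilon>)\<^sup>2 * (?s \<bullet> (X *v ?s))
          + (sqrt 2 * \<epsilon>) * (\<nu> * \<epsilon>\<^sup>2) * (?s \<bullet> (X *v w) + w \<bullet> (X *v ?s)) + (\<nu> * \<epsilon>\<^sup>2)\<^sup>2 * (w \<bullet> (X *v w))"
          by (simp add: matrix_vector_right_distrib matrix_vector_mult_scaleR inner_add_left inner_add_right
              power2_eq_square algebra_simps)
        then show ?thesis
          by (simp add: E_def power_mult_distrib power2_eq_square algebra_simps)
      qed
      have "\<bar>E\<bar> \<le> D"
      proof -
        have a: "\<bar>?s \<bullet> (X *v w)\<bar> \<le> M * n" "\<bar>w \<bullet> (X *v ?s)\<bar> \<le> M * n" "\<bar>w \<bullet> (X *v w)\<bar> \<le> M"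
        proof -
          have ns: "M * norm ?s \<le> M * n" using s M(1) by (intro mult_left_mono) auto
          have w1: "norm w = 1" using w by simp
          show "\<bar>?s \<bullet> (X *v w)\<bar> \<le> M * n" "\<bar>w \<bullet> (X *v ?s)\<bar> \<le> M * n" "\<bar>w \<bullet> (X *v w)\<bar> \<le> M"
            using M(2)[of ?s w] M(2)[of w ?s] M(2)[of w w] ns unfolding w1 by linarith+
        qed
        have s2: "sqrt 2 / 2 \<le> 1" using real_le_lsqrt[of 2 2] by auto
        have "\<bar>(sqrt 2 / 2 * \<nu>) * (?s \<bullet> (X *v w) + w \<bullet> (X *v ?s))\<bar> \<le> (1 * \<bar>\<nu>\<bar>) * (2 * (M * n))"
          unfolding abs_mult using a s2 by (intro mult_mono) auto
        moreover have "\<bar>\<nu>\<^sup>2 / 2 * \<epsilon> * (w \<bullet> (X *v w))\<bar> \<le> (\<nu>\<^sup>2 * 1) * M"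
          unfolding abs_mult using a \<epsilon> \<epsilon>1 by (intro mult_mono) auto
        ultimately show ?thesis unfolding E_def D_def by (simp add: mult_ac)
      qed
      then have "\<epsilon> * \<bar>E\<bar> \<le> \<epsilon> * D" using \<epsilon> by (intro mult_left_mono) auto
      also have "\<dots> \<le> \<omega> / 2" using \<epsilon>D by (simp only: mult.commute[of \<epsilon>])
      finally have "\<bar>\<epsilon> * E\<bar> \<le> \<omega> / 2" using \<epsilon> by (simp add: abs_mult)
      then have 2: "\<bar>\<epsilon>\<^sup>2 * (\<epsilon> * E)\<bar> \<le> (\<omega> / 2) * \<epsilon>\<^sup>2"
      proof -
        assume "\<bar>\<epsilon> * E\<bar> \<le> \<omega> / 2"
        then have "\<bar>\<epsilon> * E\<bar> * \<epsilon>\<^sup>2 \<le> (\<omega> / 2) * \<epsilon>\<^sup>2" by (intro mult_right_mono) auto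
        then show ?thesis unfolding abs_mult[of "\<epsilon>\<^sup>2"] abs_power2 by (simp only: mult.commute)
      qed
      have move: "game_move \<nu> \<epsilon> y v w b = y + ?k" by (simp add: game_move_def)
      have lin: "q \<bullet> ?k = (sqrt 2 * \<epsilon>) * (q \<bullet> ?s) + \<epsilon>\<^sup>2 * (\<nu> * (q \<bullet> w))"
        by (simp only: inner_add_right inner_scaleR_right mult_ac)
      have dist: "\<epsilon>\<^sup>2 * (\<nu> * (q \<bullet> w) - \<tau> + ?s \<bullet> (X *v ?s))
          = \<epsilon>\<^sup>2 * (\<nu> * (q \<bullet> w)) - \<epsilon>\<^sup>2 * \<tau> + \<epsilon>\<^sup>2 * (?s \<bullet> (X *v ?s))"
        by (simp only: distrib_left right_diff_distrib)
      show "move_error \<phi> q \<tau> X \<nu> \<epsilon> y s v w b \<le> \<omega> * \<epsilon>\<^sup>2"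
        using 1[unfolded quad lin] 2 unfolding move dist by linarith
    qed
  qed
qed

lemma finite_sign_tuples: "finite (sign_tuples TYPE('n))" and sign_tuples_ne: "sign_tuples TYPE('n) \<noteq> {}"
  unfolding sign_tuples_def by (auto intro!: finite_PiE simp: PiE_eq_empty_iff)

lemma orthonormal_tuples_ne: "(orthonormal_tuples :: (nat \<Rightarrow> real^'n) set) \<noteq> {}"
  using diagonalising_frame[of "mat 1 :: real^'n^'n"] by (metis empty_iff transpose_mat)

lemma sphere_ne: "sphere (0 :: real^'n) 1 \<noteq> {}" by simp

text \<open>An upper bound on the game step needs a reply by the minimiser to every choice of the maximiser.
  The vector \<open>w\<close> belongs to the maximiser for \<open>\<nu> \<ge> 0\<close> and to the minimiser for \<open>\<nu> < 0\<close>; the guard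
  \<open>\<nu> \<ge> 0 \<longrightarrow> w' = w\<close> treats both regimes together.\<close>

lemma game_step_le:
  fixes g :: "real^'n \<Rightarrow> real"
  assumes bdd: "\<And>v w b. v \<in> orthonormal_tuples \<Longrightarrow> w \<in> sphere 0 1 \<Longrightarrow> b \<in> sign_tuples TYPE('n) \<Longrightarrow>
      \<bar>g (game_move \<nu> \<epsilon> x v w b)\<bar> \<le> B"
    and le: "\<And>v w. v \<in> orthonormal_tuples \<Longrightarrow> w \<in> sphere 0 1 \<Longrightarrow>
      \<exists>w'\<in>sphere 0 1. \<exists>b\<in>sign_tuples TYPE('n). (\<nu> \<ge> 0 \<longrightarrow> w' = w) \<and>
        g (game_move \<nu> \<epsilon> x v w' b) + \<epsilon>\<^sup>2 * f x \<le> C"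
  shows "game_step \<nu> f \<epsilon> g x \<le> C"
proof (cases "\<nu> \<ge> 0")
  case True
  have "(SUP (v, w) \<in> orthonormal_tuples \<times> sphere 0 1.
            MIN b \<in> sign_tuples TYPE('n). g (game_move \<nu> \<epsilon> x v w b) + \<epsilon>\<^sup>2 * f x) \<le> C"
  proof (rule cSUP_least)
    show "(orthonormal_tuples :: (nat \<Rightarrow> real^'n) set) \<times> sphere (0 :: real^'n) 1 \<noteq> {}"
      using orthonormal_tuples_ne by simp
    fix vw :: "(nat \<Rightarrow> real^'n) \<times> (real^'n)" assume "vw \<in> orthonormal_tuples \<times> sphere 0 1"
    then obtain v w where vw: "vw = (v, w)" "v \<in> orthonormal_tuples" "w \<in> sphere 0 1" by auto
    obtain b where b: "b \<in> sign_tuples TYPE('n)" "g (game_move \<nu> \<epsilon> x v w b) + \<epsilon>\<^sup>2 * f x \<le> C"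
      using le[OF vw(2,3)] True by auto
    have "(MIN b \<in> sign_tuples TYPE('n). g (game_move \<nu> \<epsilon> x v w b) + \<epsilon>\<^sup>2 * f x) \<le> g (game_move \<nu> \<epsilon> x v w b) + \<epsilon>\<^sup>2 * f x"
      using b(1) by (intro Min_le) (auto simp: finite_sign_tuples)
    then show "(case vw of (v, w) \<Rightarrow> MIN b \<in> sign_tuples TYPE('n). g (game_move \<nu> \<epsilon> x v w b) + \<epsilon>\<^sup>2 * f x) \<le> C"
      using b vw by simp
  qed
  then show ?thesis using True by (simp add: game_step_def)
next
  case False
  have "(SUP v \<in> orthonormal_tuples. INF (w, b) \<in> sphere 0 1 \<times> sign_tuples TYPE('n).
              g (game_move \<nu> \<epsilon> x v w b) + \<epsilon>\<^sup>2 * f x) \<le> C"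
  proof (rule cSUP_least[OF orthonormal_tuples_ne])
    fix v :: "nat \<Rightarrow> real^'n" assume v: "v \<in> orthonormal_tuples"
    obtain w where w: "w \<in> sphere (0 :: real^'n) 1" using sphere_ne by blast
    obtain w' b where wb: "w' \<in> sphere 0 1" "b \<in> sign_tuples TYPE('n)" "g (game_move \<nu> \<epsilon> x v w' b) + \<epsilon>\<^sup>2 * f x \<le> C"
      using le[OF v w] by auto
    have "bdd_below ((\<lambda>(w, b). g (game_move \<nu> \<epsilon> x v w b) + \<epsilon>\<^sup>2 * f x) ` (sphere 0 1 \<times> sign_tuples TYPE('n)))"
    proof (rule bdd_belowI2[where m = "- B + \<epsilon>\<^sup>2 * f x"], clarify)
      fix w b assume "w \<in> sphere (0 :: real^'n) 1" "b \<in> sign_tuples TYPE('n)"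
      then show "- B + \<epsilon>\<^sup>2 * f x \<le> g (game_move \<nu> \<epsilon> x v w b) + \<epsilon>\<^sup>2 * f x"
        using bdd[OF v, of w b] by auto
    qed
    then show "(INF (w, b) \<in> sphere 0 1 \<times> sign_tuples TYPE('n). g (game_move \<nu> \<epsilon> x v w b) + \<epsilon>\<^sup>2 * f x) \<le> C"
      by (rule cINF_lower2[where x = "(w', b)"]) (use wb in auto)
  qed
  then show ?thesis using False by (simp add: game_step_def)
qed

lemma game_step_ge:
  fixes g :: "real^'n \<Rightarrow> real"
  assumes bdd: "\<And>v w b. v \<in> orthonormal_tuples \<Longrightarrow> w \<in> sphere 0 1 \<Longrightarrow> b \<in> sign_tuples TYPE('n) \<Longrightarrow>
      \<bar>g (game_move \<nu> \<epsilon> x v w b)\<bar> \<le> B"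
    and v: "v \<in> orthonormal_tuples" and w: "w \<in> sphere 0 1"
    and ge: "\<And>w' b. w' \<in> sphere 0 1 \<Longrightarrow> b \<in> sign_tuples TYPE('n) \<Longrightarrow> (\<nu> \<ge> 0 \<Longrightarrow> w' = w) \<Longrightarrow>
        C \<le> g (game_move \<nu> \<epsilon> x v w' b) + \<epsilon>\<^sup>2 * f x"
  shows "C \<le> game_step \<nu> f \<epsilon> g x"
proof (cases "\<nu> \<ge> 0")
  case True
  have "C \<le> (SUP (v, w) \<in> orthonormal_tuples \<times> sphere 0 1.
            MIN b \<in> sign_tuples TYPE('n). g (game_move \<nu> \<epsilon> x v w b) + \<epsilon>\<^sup>2 * f x)"
  proof (rule cSUP_upper2[where x = "(v, w)"])
    show "(v, w) \<in> orthonormal_tuples \<times> sphere 0 1" using v w by simp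
    show "C \<le> (case (v, w) of (v, w) \<Rightarrow> MIN b \<in> sign_tuples TYPE('n). g (game_move \<nu> \<epsilon> x v w b) + \<epsilon>\<^sup>2 * f x)"
      using ge[OF w] by (auto simp: finite_sign_tuples sign_tuples_ne)
    show "bdd_above ((\<lambda>(v, w). MIN b \<in> sign_tuples TYPE('n). g (game_move \<nu> \<epsilon> x v w b) + \<epsilon>\<^sup>2 * f x)
        ` (orthonormal_tuples \<times> sphere 0 1))"
    proof (rule bdd_aboveI2[where M = "B + \<epsilon>\<^sup>2 * f x"], clarify)
      fix v :: "nat \<Rightarrow> real^'n" and w assume vw: "v \<in> orthonormal_tuples" "w \<in> sphere (0 :: real^'n) 1"
      obtain b where b: "b \<in> sign_tuples TYPE('n)" using sign_tuples_ne by blast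
      have "(MIN b \<in> sign_tuples TYPE('n). g (game_move \<nu> \<epsilon> x v w b) + \<epsilon>\<^sup>2 * f x) \<le> g (game_move \<nu> \<epsilon> x v w b) + \<epsilon>\<^sup>2 * f x"
        using b by (intro Min_le) (auto simp: finite_sign_tuples)
      then show "(MIN b \<in> sign_tuples TYPE('n). g (game_move \<nu> \<epsilon> x v w b) + \<epsilon>\<^sup>2 * f x) \<le> B + \<epsilon>\<^sup>2 * f x"
        using bdd[OF vw b] by linarith
    qed
  qed
  then show ?thesis using True by (simp add: game_step_def)
next
  case False
  have "C \<le> (SUP v \<in> orthonormal_tuples. INF (w, b) \<in> sphere 0 1 \<times> sign_tuples TYPE('n).
              g (game_move \<nu> \<epsilon> x v w b) + \<epsilon>\<^sup>2 * f x)"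
  proof (rule cSUP_upper2[OF _ v])
    show "bdd_above ((\<lambda>v. INF (w, b) \<in> sphere 0 1 \<times> sign_tuples TYPE('n). g (game_move \<nu> \<epsilon> x v w b) + \<epsilon>\<^sup>2 * f x)
        ` orthonormal_tuples)"
    proof (rule bdd_aboveI2[where M = "B + \<epsilon>\<^sup>2 * f x"])
      fix v :: "nat \<Rightarrow> real^'n" assume v: "v \<in> orthonormal_tuples"
      obtain b where b: "b \<in> sign_tuples TYPE('n)" using sign_tuples_ne by blast
      have "bdd_below ((\<lambda>(w, b). g (game_move \<nu> \<epsilon> x v w b) + \<epsilon>\<^sup>2 * f x) ` (sphere 0 1 \<times> sign_tuples TYPE('n)))"
      proof (rule bdd_belowI2[where m = "- B + \<epsilon>\<^sup>2 * f x"], clarify)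
        fix w b assume "w \<in> sphere (0 :: real^'n) 1" "b \<in> sign_tuples TYPE('n)"
        then show "- B + \<epsilon>\<^sup>2 * f x \<le> g (game_move \<nu> \<epsilon> x v w b) + \<epsilon>\<^sup>2 * f x"
          using bdd[OF v, of w b] by auto
      qed
      then show "(INF (w, b) \<in> sphere 0 1 \<times> sign_tuples TYPE('n). g (game_move \<nu> \<epsilon> x v w b) + \<epsilon>\<^sup>2 * f x) \<le> B + \<epsilon>\<^sup>2 * f x"
        by (rule cINF_lower2[where x = "(w, b)"]) (use w b bdd[OF v w b] in auto)
    qed
    show "C \<le> (INF (w, b) \<in> sphere 0 1 \<times> sign_tuples TYPE('n). g (game_move \<nu> \<epsilon> x v w b) + \<epsilon>\<^sup>2 * f x)"
      using ge False sphere_ne sign_tuples_ne by (intro cINF_greatest) auto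
  qed
  then show ?thesis using False by (simp add: game_step_def)
qed

section \<open>Consistency of the game with the equation\<close>

lemma usc_envelope_less_D:
  fixes z :: "'a::metric_space"
  assumes "usc_envelope D g z < c"
  obtains r where "r > 0" "\<And>y. y \<in> D \<Longrightarrow> dist z y < r \<Longrightarrow> g y < c"
proof -
  have "\<forall>\<^sub>F y in nhds z. y \<in> D \<longrightarrow> g y < c"
    using Limsup_lessD[OF assms[unfolded usc_envelope_def]] by (simp add: eventually_inf_principal)
  then show ?thesis using that unfolding eventually_nhds_metric by (metis dist_commute)
qed

lemma lsc_envelope_greater_D:
  fixes z :: "'a::metric_space"
  assumes "c < lsc_envelope D g z"
  obtains r where "r > 0" "\<And>y. y \<in> D \<Longrightarrow> dist z y < r \<Longrightarrow> c < g y"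
proof -
  have "\<forall>\<^sub>F y in nhds z. y \<in> D \<longrightarrow> c < g y"
    using less_LiminfD[OF assms[unfolded lsc_envelope_def]] by (simp add: eventually_inf_principal)
  then show ?thesis using that unfolding eventually_nhds_metric by (metis dist_commute)
qed

lemma mcf_op_lower_greater_D:
  assumes "ereal c < mcf_op_lower p X" "transpose X = X"
  obtains \<rho> where "\<rho> > 0" "\<And>q. q \<noteq> 0 \<Longrightarrow> dist p q < \<rho> \<Longrightarrow> c < mcf_op q X"
proof -
  obtain r where r: "r > 0" "\<And>z. z \<in> mcf_domain \<Longrightarrow> dist (p, X) z < r \<Longrightarrow> ereal c < (case z of (q, Y) \<Rightarrow> ereal (mcf_op q Y))"
    using lsc_envelope_greater_D[OF assms(1)[unfolded mcf_op_lower_def]] by metis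
  have "c < mcf_op q X" if "q \<noteq> 0" "dist p q < r" for q
    using r(2)[of "(q, X)"] that assms(2) by (simp add: mcf_domain_def dist_Pair_Pair)
  then show ?thesis using r(1) that by blast
qed

lemma mcf_op_upper_less_D:
  assumes "mcf_op_upper p X < ereal c" "transpose X = X"
  obtains \<rho> where "\<rho> > 0" "\<And>q. q \<noteq> 0 \<Longrightarrow> dist p q < \<rho> \<Longrightarrow> mcf_op q X < c"
proof -
  obtain r where r: "r > 0" "\<And>z. z \<in> mcf_domain \<Longrightarrow> dist (p, X) z < r \<Longrightarrow> (case z of (q, Y) \<Rightarrow> ereal (mcf_op q Y)) < ereal c"
    using usc_envelope_less_D[OF assms(1)[unfolded mcf_op_upper_def]] by metis
  have "mcf_op q X < c" if "q \<noteq> 0" "dist p q < r" for q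
    using r(2)[of "(q, X)"] that assms(2) by (simp add: mcf_domain_def dist_Pair_Pair)
  then show ?thesis using r(1) that by blast
qed

lemma inner_sgn_self: "q \<bullet> sgn q = norm q" for q :: "'a::real_inner"
  by (cases "q = 0") (simp_all add: sgn_div_norm dot_square_norm power2_eq_square)

lemma drift_upper:
  fixes q :: "real^'n"
  assumes "w \<in> sphere 0 1"
  obtains w' where "w' \<in> sphere 0 1" "\<nu> \<ge> 0 \<longrightarrow> w' = w" "\<nu> * (q \<bullet> w') \<le> \<nu> * norm q"
proof (cases "\<nu> \<ge> 0 \<or> q = 0")
  case True
  have "q \<bullet> w \<le> norm q" using norm_cauchy_schwarz[of q w] assms by simp
  then have "\<nu> * (q \<bullet> w) \<le> \<nu> * norm q" using True by (auto intro: mult_left_mono)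
  then show ?thesis using that assms by blast
next
  case False
  then show ?thesis using that[of "sgn q"] by (simp add: norm_sgn inner_sgn_self)
qed

lemma drift_lower:
  fixes q :: "real^'n"
  obtains w where "w \<in> sphere 0 1"
    "\<And>w'. w' \<in> sphere 0 1 \<Longrightarrow> (\<nu> \<ge> 0 \<Longrightarrow> w' = w) \<Longrightarrow> \<nu> * norm q \<le> \<nu> * (q \<bullet> w')"
proof (cases "q = 0")
  case True
  obtain w where "w \<in> sphere (0 :: real^'n) 1" using sphere_ne by blast
  then show ?thesis using that True by auto
next
  case False
  show ?thesis
  proof (rule that[of "sgn q"])
    show "sgn q \<in> sphere 0 1" using False by (simp add: norm_sgn)
    fix w' :: "real^'n" assume w': "w' \<in> sphere 0 1" "\<nu> \<ge> 0 \<Longrightarrow> w' = sgn q"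
    show "\<nu> * norm q \<le> \<nu> * (q \<bullet> w')"
    proof (cases "\<nu> \<ge> 0")
      case True
      then show ?thesis using w'(2) by (simp add: inner_sgn_self)
    next
      case nonpos: False
      have "q \<bullet> w' \<le> norm q" using norm_cauchy_schwarz[of q w'] w'(1) by simp
      then show ?thesis using nonpos by (intro mult_left_mono_neg) auto
    qed
  qed
qed

lemma drift_near:
  fixes p q :: "real^'n"
  assumes "q \<in> ball p \<omega>"
  shows "\<bar>\<nu> * norm q - \<nu> * norm p\<bar> \<le> \<bar>\<nu>\<bar> * \<omega>"
proof -
  have "\<bar>norm q - norm p\<bar> \<le> \<omega>"
    using norm_triangle_ineq3[of q p] assms by (simp add: dist_norm norm_minus_commute)
  then have "\<bar>\<nu> * (norm q - norm p)\<bar> \<le> \<bar>\<nu>\<bar> * \<omega>" unfolding abs_mult by (intro mult_left_mono) auto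
  then show ?thesis by (simp add: right_diff_distrib)
qed

text \<open>The sum on the right bounds the distance from \<open>p\<close> to the line spanned by the normal \<open>n\<close>. The
  multiple \<open>s = 0\<close> is excluded because the curvature operator is evaluated at \<open>s *\<^sub>R n\<close>; if \<open>p\<close> itself is
  shorter than \<open>\<rho>\<close>, a small nonzero multiple serves instead.\<close>

lemma frame_dichotomy:
  fixes v :: "nat \<Rightarrow> real^'n"
  assumes v: "v \<in> orthonormal_tuples" and n: "unit_normal v n"
  shows "(\<exists>s. s \<noteq> 0 \<and> dist p (s *\<^sub>R n) < \<rho>) \<or> \<rho> \<le> (\<Sum>j = 1..CARD('n) - 1. \<bar>p \<bullet> v j\<bar>)"
proof (cases "\<exists>s. s \<noteq> 0 \<and> dist p (s *\<^sub>R n) < \<rho>")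
  case False
  then have far: "\<rho> \<le> dist p (s *\<^sub>R n)" if "s \<noteq> 0" for s using that by force
  have n1: "norm n = 1" using n by (simp add: unit_normal_def)
  have "\<rho> \<le> norm (p - (p \<bullet> n) *\<^sub>R n)"
  proof (cases "p \<bullet> n = 0")
    case False
    then show ?thesis using far[of "p \<bullet> n"] by (simp add: dist_norm)
  next
    case True
    have "\<rho> \<le> norm p + s" if "s > 0" for s
      using far[of s] norm_triangle_ineq4[of p "s *\<^sub>R n"] that n1 by (simp add: dist_norm)
    then show ?thesis using True field_le_epsilon[of \<rho> "norm p"] by simp
  qed
  also have "\<dots> = L2_set (\<lambda>j. p \<bullet> v j) {1..CARD('n) - 1}"
  proof -
    have "(norm (p - (p \<bullet> n) *\<^sub>R n))\<^sup>2 = p \<bullet> p - (p \<bullet> n)\<^sup>2 * (2 - n \<bullet> n)"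
      unfolding power2_norm_eq_inner
      by (simp add: inner_diff_left inner_diff_right inner_commute[of n p] power2_eq_square algebra_simps)
    also have "n \<bullet> n = 1" using n1 by (simp add: norm_eq_1)
    also have "p \<bullet> p - (p \<bullet> n)\<^sup>2 * (2 - 1) = (\<Sum>j = 1..CARD('n) - 1. (p \<bullet> v j)\<^sup>2)"
      using inner_frame_expand[OF v n, of p p] by (simp add: power2_eq_square)
    finally show ?thesis by (simp add: L2_set_def real_sqrt_unique)
  qed
  also have "\<dots> \<le> (\<Sum>j = 1..CARD('n) - 1. \<bar>p \<bullet> v j\<bar>)" by (rule L2_set_le_sum_abs)
  finally show ?thesis ..
qed blast

lemma ereal_less_add_D:
  assumes "ereal \<kappa> < ereal A + L" shows "ereal (\<kappa> - A) < L"
  using assms by (cases L) auto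

lemma ereal_add_less_D:
  assumes "ereal A + L < ereal \<kappa>" shows "L < ereal (\<kappa> - A)"
  using assms by (cases L) auto

text \<open>Strictness of the inequality leaves room \<open>2 \<delta>\<close> between a bound on \<open>f\<close> near \<open>x0\<close> and a bound on the
  operator near \<open>(p, X)\<close>. If the normal of the frame has a multiple close to \<open>p\<close>, the curvature term is
  controlled by the operator there; otherwise the minimiser moves against \<open>p\<close> and gains
  order \<open>\<epsilon>\<close>.\<close>

lemma consistency_upper:
  fixes \<phi> :: "(real^'n) \<times> real \<Rightarrow> real"
  assumes exp: "parabolic_expansion \<phi> (x0, t0) p \<tau> X" and X: "transpose X = X"
    and less: "usc_envelope UNIV (\<lambda>y. ereal (f y)) x0 < ereal (\<tau> - \<nu> * norm p) + mcf_op_lower p X"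
  obtains \<delta> r \<epsilon>0 where "\<delta> > 0" "r > 0" "\<epsilon>0 > 0"
    "\<And>y s \<epsilon> v (w :: real^'n). (y, s) \<in> ball (x0, t0) r \<Longrightarrow> 0 < \<epsilon> \<Longrightarrow> \<epsilon> < \<epsilon>0 \<Longrightarrow> v \<in> orthonormal_tuples \<Longrightarrow> w \<in> sphere 0 1 \<Longrightarrow>
      \<exists>w'\<in>sphere 0 1. \<exists>b\<in>sign_tuples TYPE('n). (\<nu> \<ge> 0 \<longrightarrow> w' = w) \<and>
        \<phi> (game_move \<nu> \<epsilon> y v w' b, s - \<epsilon>\<^sup>2) + \<epsilon>\<^sup>2 * f y \<le> \<phi> (y, s) - \<delta> * \<epsilon>\<^sup>2"
proof -
  obtain \<kappa> where \<kappa>: "usc_envelope UNIV (\<lambda>y. ereal (f y)) x0 < ereal \<kappa>"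
    "ereal \<kappa> < ereal (\<tau> - \<nu> * norm p) + mcf_op_lower p X"
    using ereal_dense2[OF less] by blast
  obtain \<kappa>1 where \<kappa>1: "usc_envelope UNIV (\<lambda>y. ereal (f y)) x0 < ereal \<kappa>1" "\<kappa>1 < \<kappa>"
    using ereal_dense2[OF \<kappa>(1)] by auto
  define \<kappa>2 where "\<kappa>2 = \<kappa> - (\<tau> - \<nu> * norm p)"
  obtain \<rho> where \<rho>: "\<rho> > 0" "\<And>q. q \<noteq> 0 \<Longrightarrow> dist p q < \<rho> \<Longrightarrow> \<kappa>2 < mcf_op q X"
    using mcf_op_lower_greater_D[OF ereal_less_add_D[OF \<kappa>(2)] X] unfolding \<kappa>2_def by blast
  obtain r1 where r1: "r1 > 0" "\<And>y. dist x0 y < r1 \<Longrightarrow> f y < \<kappa>1"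
    using usc_envelope_less_D[OF \<kappa>1(1)] by auto
  define n where "n = real CARD('n)"
  have n: "n > 0" by (simp add: n_def)
  obtain M where M: "M > 0" "\<And>x y. \<bar>x \<bullet> (X *v y)\<bar> \<le> M * norm x * norm y"
    using matrix_form_bound[of X] by blast
  define \<delta> where "\<delta> = (\<kappa> - \<kappa>1) / 2"
  have \<delta>: "\<delta> > 0" using \<kappa>1 by (simp add: \<delta>_def)
  define \<omega> where "\<omega> = min (\<delta> / (1 + \<bar>\<nu>\<bar>)) (\<rho> / (2 * n))"
  have \<omega>: "\<omega> > 0" "(1 + \<bar>\<nu>\<bar>) * \<omega> \<le> \<delta>" "\<omega> * n \<le> \<rho> / 2"
  proof -
    show "\<omega> > 0" using \<delta> \<rho> n by (simp add: \<omega>_def add_pos_nonneg)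
    have "\<omega> \<le> \<delta> / (1 + \<bar>\<nu>\<bar>)" "\<omega> \<le> \<rho> / (2 * n)" by (simp_all add: \<omega>_def)
    then show "(1 + \<bar>\<nu>\<bar>) * \<omega> \<le> \<delta>" "\<omega> * n \<le> \<rho> / 2"
      using n by (simp_all add: pos_le_divide_eq add_pos_nonneg mult_ac)
  qed
  obtain r2 \<epsilon>1 where r2: "r2 > 0" "\<epsilon>1 > 0" and step:
    "\<And>y s \<epsilon>. (y, s) \<in> ball (x0, t0) r2 \<Longrightarrow> 0 < \<epsilon> \<Longrightarrow> \<epsilon> < \<epsilon>1 \<Longrightarrow>
      \<exists>q\<in>ball p \<omega>. \<forall>v\<in>orthonormal_tuples. \<forall>w\<in>sphere 0 1. \<forall>b\<in>sign_tuples TYPE('n).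
        move_error \<phi> q \<tau> X \<nu> \<epsilon> y s v w b \<le> \<omega> * \<epsilon>\<^sup>2"
    using game_move_expansion[OF exp \<omega>(1), where \<nu> = \<nu>] by blast
  define K where "K = \<bar>\<nu> * norm p\<bar> + \<bar>\<tau>\<bar> + M * n * n + \<bar>\<kappa>1\<bar> + 2 * \<delta>"
  have K: "K > 0" using \<delta> M n by (simp add: K_def add_nonneg_pos)
  define \<epsilon>0 where "\<epsilon>0 = min \<epsilon>1 (\<rho> / (2 * K))"
  show ?thesis
  proof (rule that[of \<delta> "min r1 r2" \<epsilon>0])
    show "\<delta> > 0" "min r1 r2 > 0" "\<epsilon>0 > 0" using \<delta> r1 r2 K \<rho> by (auto simp: \<epsilon>0_def)
    fix y s \<epsilon> and v :: "nat \<Rightarrow> real^'n" and w :: "real^'n"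
    assume ys: "(y, s) \<in> ball (x0, t0) (min r1 r2)" and \<epsilon>: "0 < \<epsilon>" "\<epsilon> < \<epsilon>0"
      and v: "v \<in> orthonormal_tuples" and w: "w \<in> sphere 0 1"
    have fy: "f y \<le> \<kappa>1"
      using r1(2)[of y] ys dist_fst_le[of "(x0, t0)" "(y, s)"] by simp
    obtain q where q: "q \<in> ball p \<omega>" and qq: "\<And>w b. w \<in> sphere 0 1 \<Longrightarrow> b \<in> sign_tuples TYPE('n) \<Longrightarrow>
        move_error \<phi> q \<tau> X \<nu> \<epsilon> y s v w b \<le> \<omega> * \<epsilon>\<^sup>2"
      using step[of y s \<epsilon>] ys \<epsilon> v by (auto simp: \<epsilon>0_def)
    obtain n' where n': "unit_normal v n'" by (rule unit_normal_exists)
    obtain w' where w': "w' \<in> sphere 0 1" "\<nu> \<ge> 0 \<longrightarrow> w' = w" "\<nu> * (q \<bullet> w') \<le> \<nu> * norm q"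
      using drift_upper[OF w, where q = q and \<nu> = \<nu>] by blast
    have drift: "\<nu> * (q \<bullet> w') \<le> \<nu> * norm p + \<bar>\<nu>\<bar> * \<omega>"
      using drift_near[OF q, of \<nu>] w'(3) by linarith
    have \<omega>': "\<bar>\<nu>\<bar> * \<omega> + \<omega> \<le> \<delta>" using \<omega>(2) by (simp add: algebra_simps)
    have split: "\<epsilon>\<^sup>2 * (A + \<omega> + f y) = \<epsilon>\<^sup>2 * A + \<omega> * \<epsilon>\<^sup>2 + \<epsilon>\<^sup>2 * f y" for A
      by (simp add: algebra_simps)
    have "\<exists>b\<in>sign_tuples TYPE('n). (sqrt 2 * \<epsilon>) * (q \<bullet> frame_sum v b)
          + \<epsilon>\<^sup>2 * (\<nu> * (q \<bullet> w') - \<tau> + frame_sum v b \<bullet> (X *v frame_sum v b)) + \<omega> * \<epsilon>\<^sup>2 + \<epsilon>\<^sup>2 * f y \<le> - \<delta> * \<epsilon>\<^sup>2"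
    proof (cases "\<exists>s. s \<noteq> 0 \<and> dist p (s *\<^sub>R n') < \<rho>")
      case True
      then obtain c where c: "c \<noteq> 0" "dist p (c *\<^sub>R n') < \<rho>" by blast
      have "c *\<^sub>R n' \<noteq> 0" using c n' by (auto simp: unit_normal_def)
      then have curv: "(\<Sum>j = 1..CARD('n) - 1. v j \<bullet> (X *v v j)) \<le> - \<kappa>2"
        using \<rho>(2)[OF _ c(2)] mcf_op_frame[OF v n' c(1), of X] by simp
      obtain b where b: "b \<in> sign_tuples TYPE('n)" "q \<bullet> frame_sum v b \<le> 0"
         "frame_sum v b \<bullet> (X *v frame_sum v b) \<le> (\<Sum>j = 1..CARD('n) - 1. v j \<bullet> (X *v v j))"
        by (rule exists_signs_curvature_le)
      have "(sqrt 2 * \<epsilon>) * (q \<bullet> frame_sum v b) \<le> 0"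
        using b(2) \<epsilon> by (intro mult_nonneg_nonpos) auto
      moreover have "\<nu> * (q \<bullet> w') - \<tau> + frame_sum v b \<bullet> (X *v frame_sum v b) + \<omega> + f y \<le> - \<delta>"
      proof -
        have "\<kappa>2 = \<kappa> - \<tau> + \<nu> * norm p" "\<kappa> - \<kappa>1 = 2 * \<delta>" by (simp_all add: \<kappa>2_def \<delta>_def)
        then show ?thesis using drift b(3) curv fy \<omega>' by linarith
      qed
      then have "\<epsilon>\<^sup>2 * (\<nu> * (q \<bullet> w') - \<tau> + frame_sum v b \<bullet> (X *v frame_sum v b) + \<omega> + f y) \<le> \<epsilon>\<^sup>2 * (- \<delta>)"
        by (intro mult_left_mono) auto
      then have "\<epsilon>\<^sup>2 * (\<nu> * (q \<bullet> w') - \<tau> + frame_sum v b \<bullet> (X *v frame_sum v b) + \<omega> + f y) \<le> - \<delta> * \<epsilon>\<^sup>2"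
        by (simp only: mult_minus_right mult_minus_left mult.commute[of \<delta>])
      ultimately have "(sqrt 2 * \<epsilon>) * (q \<bullet> frame_sum v b) + \<epsilon>\<^sup>2 * (\<nu> * (q \<bullet> w') - \<tau> + frame_sum v b \<bullet> (X *v frame_sum v b))
          + \<omega> * \<epsilon>\<^sup>2 + \<epsilon>\<^sup>2 * f y \<le> - \<delta> * \<epsilon>\<^sup>2"
        unfolding split by linarith
      then show ?thesis using b(1) by blast
    next
      case False
      then have far: "\<rho> \<le> (\<Sum>j = 1..CARD('n) - 1. \<bar>p \<bullet> v j\<bar>)" using frame_dichotomy[OF v n', of p \<rho>] by blast
      \<comment> \<open>Signs are chosen against the frozen gradient \<open>p\<close>; passing to \<open>q\<close> costs at most \<open>\<rho> / 2\<close>.\<close>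
      obtain b where b: "b \<in> sign_tuples TYPE('n)" "p \<bullet> frame_sum v b = - (\<Sum>j = 1..CARD('n) - 1. \<bar>p \<bullet> v j\<bar>)"
        using exists_signs_steepest[of p v] by blast
      let ?s = "frame_sum v b"
      have s: "norm ?s \<le> n" unfolding n_def by (rule norm_frame_sum_le[OF v b(1)])
      have "\<bar>(q - p) \<bullet> ?s\<bar> \<le> norm (q - p) * norm ?s" by (rule Cauchy_Schwarz_ineq2)
      also have "\<dots> \<le> \<omega> * n" using q s \<omega>(1) by (intro mult_mono) (auto simp: dist_norm norm_minus_commute)
      finally have qs: "q \<bullet> ?s \<le> - (\<rho> / 2)"
        using b(2) far \<omega>(3) by (simp add: inner_diff_left)
      have "(sqrt 2 * \<epsilon>) * (q \<bullet> ?s) \<le> (sqrt 2 * \<epsilon>) * (- (\<rho> / 2))"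
        using qs \<epsilon> by (intro mult_left_mono) auto
      also have "\<dots> \<le> (1 * \<epsilon>) * (- (\<rho> / 2))"
        using \<epsilon> \<rho> by (intro mult_right_mono_neg mult_right_mono) auto
      finally have lin: "(sqrt 2 * \<epsilon>) * (q \<bullet> ?s) \<le> - \<epsilon> * (\<rho> / 2)" by simp
      have "?s \<bullet> (X *v ?s) \<le> M * n * n"
      proof -
        have "?s \<bullet> (X *v ?s) \<le> M * norm ?s * norm ?s" using M(2)[of ?s ?s] by linarith
        also have "\<dots> \<le> M * n * n" using s M n by (intro mult_mono) auto
        finally show ?thesis .
      qed
      then have "\<nu> * (q \<bullet> w') - \<tau> + ?s \<bullet> (X *v ?s) + \<omega> + f y \<le> K - \<delta>"
        using drift fy \<omega>' unfolding K_def by linarith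
      then have "\<epsilon>\<^sup>2 * (\<nu> * (q \<bullet> w') - \<tau> + ?s \<bullet> (X *v ?s) + \<omega> + f y) \<le> \<epsilon>\<^sup>2 * (K - \<delta>)"
        by (intro mult_left_mono) auto
      moreover have "\<epsilon>\<^sup>2 * K \<le> \<epsilon> * (\<rho> / 2)"
      proof -
        have "\<epsilon> * K \<le> (\<rho> / (2 * K)) * K" using \<epsilon> K by (intro mult_right_mono) (auto simp: \<epsilon>0_def)
        also have "\<dots> = \<rho> / 2" using K by simp
        finally show ?thesis using \<epsilon> by (simp add: power2_eq_square mult.assoc)
      qed
      moreover have "\<epsilon>\<^sup>2 * (K - \<delta>) = \<epsilon>\<^sup>2 * K - \<delta> * \<epsilon>\<^sup>2" by (simp add: algebra_simps)
      ultimately have "(sqrt 2 * \<epsilon>) * (q \<bullet> ?s) + \<epsilon>\<^sup>2 * (\<nu> * (q \<bullet> w') - \<tau> + ?s \<bullet> (X *v ?s) + \<omega> + f y) \<le> - \<delta> * \<epsilon>\<^sup>2"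
        using lin by linarith
      then have "(sqrt 2 * \<epsilon>) * (q \<bullet> ?s) + \<epsilon>\<^sup>2 * (\<nu> * (q \<bullet> w') - \<tau> + ?s \<bullet> (X *v ?s)) + \<omega> * \<epsilon>\<^sup>2 + \<epsilon>\<^sup>2 * f y \<le> - \<delta> * \<epsilon>\<^sup>2"
        unfolding split by linarith
      then show ?thesis using b(1) by blast
    qed
    then obtain b where b: "b \<in> sign_tuples TYPE('n)" "(sqrt 2 * \<epsilon>) * (q \<bullet> frame_sum v b)
          + \<epsilon>\<^sup>2 * (\<nu> * (q \<bullet> w') - \<tau> + frame_sum v b \<bullet> (X *v frame_sum v b)) + \<omega> * \<epsilon>\<^sup>2 + \<epsilon>\<^sup>2 * f y \<le> - \<delta> * \<epsilon>\<^sup>2"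
      by blast
    have "\<phi> (game_move \<nu> \<epsilon> y v w' b, s - \<epsilon>\<^sup>2) + \<epsilon>\<^sup>2 * f y \<le> \<phi> (y, s) - \<delta> * \<epsilon>\<^sup>2"
      using qq[OF w'(1) b(1)] b(2) by linarith
    then show "\<exists>w'\<in>sphere 0 1. \<exists>b\<in>sign_tuples TYPE('n). (\<nu> \<ge> 0 \<longrightarrow> w' = w) \<and>
        \<phi> (game_move \<nu> \<epsilon> y v w' b, s - \<epsilon>\<^sup>2) + \<epsilon>\<^sup>2 * f y \<le> \<phi> (y, s) - \<delta> * \<epsilon>\<^sup>2"
      using w' b(1) by blast
  qed
qed

text \<open>The frame diagonalising \<open>X\<close> on the hyperplane orthogonal to the gradient \<open>q\<close> at the current
  point, not at \<open>(x0, t0)\<close>, is what annihilates the term of order \<open>\<epsilon>\<close> exactly.\<close>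

lemma consistency_lower:
  fixes \<phi> :: "(real^'n) \<times> real \<Rightarrow> real"
  assumes exp: "parabolic_expansion \<phi> (x0, t0) p \<tau> X" and X: "transpose X = X"
    and less: "ereal (\<tau> - \<nu> * norm p) + mcf_op_upper p X < lsc_envelope UNIV (\<lambda>y. ereal (f y)) x0"
  obtains \<delta> r \<epsilon>0 where "\<delta> > 0" "r > 0" "\<epsilon>0 > 0"
    "\<And>y s \<epsilon>. (y, s) \<in> ball (x0, t0) r \<Longrightarrow> 0 < \<epsilon> \<Longrightarrow> \<epsilon> < \<epsilon>0 \<Longrightarrow>
      \<exists>v\<in>orthonormal_tuples. \<exists>w\<in>sphere 0 1. \<forall>w'\<in>sphere 0 1. \<forall>b\<in>sign_tuples TYPE('n). (\<nu> \<ge> 0 \<longrightarrow> w' = w) \<longrightarrow>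
        \<phi> (y, s) + \<delta> * \<epsilon>\<^sup>2 \<le> \<phi> (game_move \<nu> \<epsilon> y v w' b, s - \<epsilon>\<^sup>2) + \<epsilon>\<^sup>2 * f y"
proof -
  obtain \<kappa> where \<kappa>: "ereal (\<tau> - \<nu> * norm p) + mcf_op_upper p X < ereal \<kappa>"
    "ereal \<kappa> < lsc_envelope UNIV (\<lambda>y. ereal (f y)) x0"
    using ereal_dense2[OF less] by blast
  obtain \<kappa>1 where \<kappa>1: "ereal \<kappa>1 < lsc_envelope UNIV (\<lambda>y. ereal (f y)) x0" "\<kappa> < \<kappa>1"
    using ereal_dense2[OF \<kappa>(2)] by auto
  define \<kappa>2 where "\<kappa>2 = \<kappa> - (\<tau> - \<nu> * norm p)"
  obtain \<rho> where \<rho>: "\<rho> > 0" "\<And>q. q \<noteq> 0 \<Longrightarrow> dist p q < \<rho> \<Longrightarrow> mcf_op q X < \<kappa>2"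
    using mcf_op_upper_less_D[OF ereal_add_less_D[OF \<kappa>(1)] X] unfolding \<kappa>2_def by blast
  obtain r1 where r1: "r1 > 0" "\<And>y. dist x0 y < r1 \<Longrightarrow> \<kappa>1 < f y"
    using lsc_envelope_greater_D[OF \<kappa>1(1)] by auto
  define \<delta> where "\<delta> = (\<kappa>1 - \<kappa>) / 2"
  have \<delta>: "\<delta> > 0" using \<kappa>1 by (simp add: \<delta>_def)
  define \<omega> where "\<omega> = min (\<delta> / (1 + \<bar>\<nu>\<bar>)) (\<rho> / 2)"
  have \<omega>: "\<omega> > 0" "(1 + \<bar>\<nu>\<bar>) * \<omega> \<le> \<delta>" "\<omega> \<le> \<rho> / 2"
  proof -
    show "\<omega> > 0" using \<delta> \<rho>(1) by (simp add: \<omega>_def add_pos_nonneg)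
    show "\<omega> \<le> \<rho> / 2" unfolding \<omega>_def by (rule min.cobounded2)
    have "\<omega> \<le> \<delta> / (1 + \<bar>\<nu>\<bar>)" by (simp add: \<omega>_def)
    then show "(1 + \<bar>\<nu>\<bar>) * \<omega> \<le> \<delta>" by (simp add: pos_le_divide_eq add_pos_nonneg mult_ac)
  qed
  obtain r2 \<epsilon>1 where r2: "r2 > 0" "\<epsilon>1 > 0" and step:
    "\<And>y s \<epsilon>. (y, s) \<in> ball (x0, t0) r2 \<Longrightarrow> 0 < \<epsilon> \<Longrightarrow> \<epsilon> < \<epsilon>1 \<Longrightarrow>
      \<exists>q\<in>ball p \<omega>. \<forall>v\<in>orthonormal_tuples. \<forall>w\<in>sphere 0 1. \<forall>b\<in>sign_tuples TYPE('n).
        move_error \<phi> q \<tau> X \<nu> \<epsilon> y s v w b \<le> \<omega> * \<epsilon>\<^sup>2"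
    using game_move_expansion[OF exp \<omega>(1), where \<nu> = \<nu>] by blast
  show ?thesis
  proof (rule that[of \<delta> "min r1 r2" \<epsilon>1])
    show "\<delta> > 0" "min r1 r2 > 0" "\<epsilon>1 > 0" using \<delta> r1 r2 by auto
    fix y s \<epsilon>
    assume ys: "(y, s) \<in> ball (x0, t0) (min r1 r2)" and \<epsilon>: "0 < \<epsilon>" "\<epsilon> < \<epsilon>1"
    have fy: "\<kappa>1 \<le> f y"
      using r1(2)[of y] ys dist_fst_le[of "(x0, t0)" "(y, s)"] by simp
    obtain q where q: "q \<in> ball p \<omega>" and qq: "\<And>v w b. v \<in> orthonormal_tuples \<Longrightarrow> w \<in> sphere 0 1 \<Longrightarrow> b \<in> sign_tuples TYPE('n) \<Longrightarrow>
        move_error \<phi> q \<tau> X \<nu> \<epsilon> y s v w b \<le> \<omega> * \<epsilon>\<^sup>2"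
      using step[of y s \<epsilon>] ys \<epsilon> by auto
    obtain v n where v: "v \<in> orthonormal_tuples" and n: "unit_normal v n" "q = norm q *\<^sub>R n"
      and lin: "\<And>b. q \<bullet> frame_sum v b = 0"
      and quad: "\<And>b. b \<in> sign_tuples TYPE('n) \<Longrightarrow>
        frame_sum v b \<bullet> (X *v frame_sum v b) = (\<Sum>j = 1..CARD('n) - 1. v j \<bullet> (X *v v j))"
      using diagonalising_frame[OF X, of q] by blast
    have n1: "norm n = 1" using n by (simp add: unit_normal_def)
    \<comment> \<open>If the gradient vanishes at the current point, a short multiple of the normal replaces it.\<close>
    obtain c where c: "c \<noteq> 0" "dist p (c *\<^sub>R n) < \<rho>"
    proof (cases "q = 0")
      case True
      have "dist p ((\<rho> / 2) *\<^sub>R n) \<le> norm p + \<rho> / 2"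
        using norm_triangle_ineq4[of p "(\<rho> / 2) *\<^sub>R n"] n1 \<rho>(1) by (simp add: dist_norm)
      also have "norm p < \<rho> / 2" using q True \<omega>(3) by simp
      finally show thesis using that[of "\<rho> / 2"] \<rho>(1) by simp
    next
      case False
      then show thesis using that[of "norm q"] n(2) q \<omega>(3) \<rho>(1) by simp
    qed
    have "c *\<^sub>R n \<noteq> 0" using c n1 by auto
    then have curv: "- \<kappa>2 \<le> (\<Sum>j = 1..CARD('n) - 1. v j \<bullet> (X *v v j))"
      using \<rho>(2)[OF _ c(2)] mcf_op_frame[OF v n(1) c(1), of X] by simp
    obtain w where w: "w \<in> sphere 0 1"
      "\<And>w'. w' \<in> sphere 0 1 \<Longrightarrow> (\<nu> \<ge> 0 \<Longrightarrow> w' = w) \<Longrightarrow> \<nu> * norm q \<le> \<nu> * (q \<bullet> w')"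
      using drift_lower[where q = q and \<nu> = \<nu>] by blast
    have drift: "\<nu> * norm p - \<bar>\<nu>\<bar> * \<omega> \<le> \<nu> * norm q"
      using drift_near[OF q, of \<nu>] by linarith
    have \<omega>': "\<bar>\<nu>\<bar> * \<omega> + \<omega> \<le> \<delta>" using \<omega>(2) by (simp add: algebra_simps)
    have "\<phi> (y, s) + \<delta> * \<epsilon>\<^sup>2 \<le> \<phi> (game_move \<nu> \<epsilon> y v w' b, s - \<epsilon>\<^sup>2) + \<epsilon>\<^sup>2 * f y"
      if w': "w' \<in> sphere 0 1" and b: "b \<in> sign_tuples TYPE('n)" and ww': "\<nu> \<ge> 0 \<longrightarrow> w' = w" for w' b
    proof -
      have "\<delta> \<le> \<nu> * (q \<bullet> w') - \<tau> + frame_sum v b \<bullet> (X *v frame_sum v b) - \<omega> + f y"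
      proof -
        have "\<kappa>2 = \<kappa> - \<tau> + \<nu> * norm p" "\<kappa>1 - \<kappa> = 2 * \<delta>" by (simp_all add: \<kappa>2_def \<delta>_def)
        then show ?thesis using drift w(2)[OF w'] ww' curv quad[OF b] fy \<omega>' by linarith
      qed
      then have "\<epsilon>\<^sup>2 * \<delta> \<le> \<epsilon>\<^sup>2 * (\<nu> * (q \<bullet> w') - \<tau> + frame_sum v b \<bullet> (X *v frame_sum v b) - \<omega> + f y)"
        by (intro mult_left_mono) auto
      also have "\<dots> = \<epsilon>\<^sup>2 * (\<nu> * (q \<bullet> w') - \<tau> + frame_sum v b \<bullet> (X *v frame_sum v b)) - \<omega> * \<epsilon>\<^sup>2 + \<epsilon>\<^sup>2 * f y"
        by (simp add: algebra_simps)
      finally show ?thesis using qq[OF v w' b] lin[of b] by (simp add: mult.commute[of \<delta>])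
    qed
    then show "\<exists>v\<in>orthonormal_tuples. \<exists>w\<in>sphere 0 1. \<forall>w'\<in>sphere 0 1. \<forall>b\<in>sign_tuples TYPE('n). (\<nu> \<ge> 0 \<longrightarrow> w' = w) \<longrightarrow>
        \<phi> (y, s) + \<delta> * \<epsilon>\<^sup>2 \<le> \<phi> (game_move \<nu> \<epsilon> y v w' b, s - \<epsilon>\<^sup>2) + \<epsilon>\<^sup>2 * f y"
      using v w(1) by blast
  qed
qed

section \<open>Relaxed limits\<close>

lemma eventually_relaxed_iff:
  fixes z :: "'a::metric_space"
  shows "(\<forall>\<^sub>F \<zeta> in nhds z \<times>\<^sub>F at_right (0::real). P \<zeta>) \<longleftrightarrow>
    (\<exists>r>0. \<forall>y\<in>ball z r. \<forall>\<epsilon>. 0 < \<epsilon> \<longrightarrow> \<epsilon> < r \<longrightarrow> P (y, \<epsilon>))"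
proof
  assume "\<forall>\<^sub>F \<zeta> in nhds z \<times>\<^sub>F at_right 0. P \<zeta>"
  then obtain A E where A: "eventually A (nhds z)" and E: "eventually E (at_right 0)"
    and P: "\<And>y \<epsilon>. A y \<Longrightarrow> E \<epsilon> \<Longrightarrow> P (y, \<epsilon>)"
    unfolding eventually_prod_filter by blast
  obtain a where a: "a > 0" "\<And>y. dist y z < a \<Longrightarrow> A y" using A unfolding eventually_nhds_metric by blast
  obtain e where e: "e > 0" "\<And>\<epsilon>. 0 < \<epsilon> \<Longrightarrow> \<epsilon> < e \<Longrightarrow> E \<epsilon>"
    using E unfolding eventually_at_right_field by blast
  show "\<exists>r>0. \<forall>y\<in>ball z r. \<forall>\<epsilon>. 0 < \<epsilon> \<longrightarrow> \<epsilon> < r \<longrightarrow> P (y, \<epsilon>)"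
    using a e P by (intro exI[of _ "min a e"]) (auto simp: dist_commute)
next
  assume "\<exists>r>0. \<forall>y\<in>ball z r. \<forall>\<epsilon>. 0 < \<epsilon> \<longrightarrow> \<epsilon> < r \<longrightarrow> P (y, \<epsilon>)"
  then obtain r where r: "r > 0" "\<And>y \<epsilon>. y \<in> ball z r \<Longrightarrow> 0 < \<epsilon> \<Longrightarrow> \<epsilon> < r \<Longrightarrow> P (y, \<epsilon>)" by blast
  have "\<forall>\<^sub>F y in nhds z. y \<in> ball z r" using r(1) by (intro eventually_nhds_in_open) auto
  moreover have "\<forall>\<^sub>F \<epsilon> in at_right 0. 0 < \<epsilon> \<and> \<epsilon> < r"
    unfolding eventually_at_right_field using r(1) by blast
  ultimately show "\<forall>\<^sub>F \<zeta> in nhds z \<times>\<^sub>F at_right 0. P \<zeta>"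
    unfolding eventually_prod_filter using r(2) by blast
qed

lemma upper_relaxed_limit_less_D:
  fixes z :: "'a::metric_space \<times> real"
  assumes "upper_relaxed_limit w z < c"
  obtains r where "r > 0" "\<And>y s \<epsilon>. (y, s) \<in> ball z r \<Longrightarrow> 0 < \<epsilon> \<Longrightarrow> \<epsilon> < r \<Longrightarrow> ereal (w \<epsilon> y s) < c"
proof -
  have "\<forall>\<^sub>F \<zeta> in nhds z \<times>\<^sub>F at_right 0. (\<lambda>((y, s), \<epsilon>). ereal (w \<epsilon> y s)) \<zeta> < c"
    using assms unfolding upper_relaxed_limit_def by (rule Limsup_lessD)
  then show ?thesis using that unfolding eventually_relaxed_iff by fastforce
qed

lemma upper_relaxed_limit_le_I:
  fixes z :: "'a::metric_space \<times> real"
  assumes "r > 0" "\<And>y s \<epsilon>. (y, s) \<in> ball z r \<Longrightarrow> 0 < \<epsilon> \<Longrightarrow> \<epsilon> < r \<Longrightarrow> ereal (w \<epsilon> y s) \<le> c"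
  shows "upper_relaxed_limit w z \<le> c"
  unfolding upper_relaxed_limit_def
proof (rule Limsup_bounded)
  show "\<forall>\<^sub>F \<zeta> in nhds z \<times>\<^sub>F at_right 0. (\<lambda>((y, s), \<epsilon>). ereal (w \<epsilon> y s)) \<zeta> \<le> c"
    unfolding eventually_relaxed_iff using assms by fastforce
qed

lemma less_upper_relaxed_limit_D:
  fixes z :: "'a::metric_space \<times> real"
  assumes "c < upper_relaxed_limit w z" "r > 0"
  obtains y s \<epsilon> where "(y, s) \<in> ball z r" "0 < \<epsilon>" "\<epsilon> < r" "c < ereal (w \<epsilon> y s)"
  using upper_relaxed_limit_le_I[of r z w c] assms by (meson not_le)

lemma lower_relaxed_limit_eq_uminus:
  "lower_relaxed_limit w z = - upper_relaxed_limit (\<lambda>\<epsilon> y s. - w \<epsilon> y s) z"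
proof -
  have "(\<lambda>((y, s), \<epsilon>). ereal (- w \<epsilon> y s)) = (\<lambda>\<zeta>. - (\<lambda>((y, s), \<epsilon>). ereal (w \<epsilon> y s)) \<zeta>)"
    by (auto simp: fun_eq_iff)
  then show ?thesis
    unfolding upper_relaxed_limit_def lower_relaxed_limit_def by (simp add: ereal_Limsup_uminus)
qed

lemma lower_le_upper_relaxed_limit: "lower_relaxed_limit w z \<le> upper_relaxed_limit w z"
  unfolding upper_relaxed_limit_def lower_relaxed_limit_def
  by (rule Liminf_le_Limsup) (simp add: prod_filter_eq_bot)

text \<open>Relaxed limits are semicontinuous, so that the envelopes occurring in the definition of
  viscosity solutions leave them unchanged.\<close>

lemma usc_envelope_upper_relaxed_limit:
  fixes z :: "'a::metric_space \<times> real"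
  assumes "z \<in> D"
  shows "usc_envelope D (upper_relaxed_limit w) z = upper_relaxed_limit w z"
proof (rule antisym)
  show "usc_envelope D (upper_relaxed_limit w) z \<le> upper_relaxed_limit w z"
    unfolding usc_envelope_def Limsup_le_iff
  proof (intro allI impI)
    fix c assume "upper_relaxed_limit w z < c"
    then obtain c' where c': "upper_relaxed_limit w z < c'" "c' < c" using dense by blast
    obtain r where r: "r > 0" "\<And>y s \<epsilon>. (y, s) \<in> ball z r \<Longrightarrow> 0 < \<epsilon> \<Longrightarrow> \<epsilon> < r \<Longrightarrow> ereal (w \<epsilon> y s) < c'"
      using upper_relaxed_limit_less_D[OF c'(1)] by metis
    have "upper_relaxed_limit w \<zeta> < c" if \<zeta>: "\<zeta> \<in> ball z (r / 2)" for \<zeta>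
    proof -
      have "upper_relaxed_limit w \<zeta> \<le> c'"
      proof (rule upper_relaxed_limit_le_I[of "r / 2"])
        fix y s \<epsilon> assume ys: "(y, s) \<in> ball \<zeta> (r / 2)" "0 < \<epsilon>" "\<epsilon> < r / 2"
        have "(y, s) \<in> ball z r" using ys(1) \<zeta> dist_triangle[of z "(y, s)" \<zeta>] by simp
        then show "ereal (w \<epsilon> y s) \<le> c'" using r(2)[of y s \<epsilon>] ys r(1) by simp
      qed (use r in simp)
      then show ?thesis using c'(2) by simp
    qed
    moreover have "\<forall>\<^sub>F \<zeta> in nhds z. \<zeta> \<in> ball z (r / 2)" using r(1) by (intro eventually_nhds_in_open) auto
    ultimately show "\<forall>\<^sub>F \<zeta> in inf (nhds z) (principal D). upper_relaxed_limit w \<zeta> < c"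
      unfolding eventually_inf_principal by (auto elim: eventually_mono)
  qed
  show "upper_relaxed_limit w z \<le> usc_envelope D (upper_relaxed_limit w) z"
  proof (rule ccontr)
    assume "\<not> ?thesis"
    then have "\<forall>\<^sub>F \<zeta> in inf (nhds z) (principal D). upper_relaxed_limit w \<zeta> < upper_relaxed_limit w z"
      unfolding usc_envelope_def not_le by (rule Limsup_lessD)
    then have "\<forall>\<^sub>F \<zeta> in nhds z. \<zeta> \<in> D \<longrightarrow> upper_relaxed_limit w \<zeta> < upper_relaxed_limit w z"
      by (simp add: eventually_inf_principal)
    from eventually_nhds_x_imp_x[OF this] assms show False by simp
  qed
qed

lemma lsc_envelope_lower_relaxed_limit:
  fixes z :: "'a::metric_space \<times> real"
  assumes "z \<in> D"
  shows "lsc_envelope D (lower_relaxed_limit w) z = lower_relaxed_limit w z"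
proof -
  have "lower_relaxed_limit w = (\<lambda>z. - upper_relaxed_limit (\<lambda>\<epsilon> y s. - w \<epsilon> y s) z)"
    using lower_relaxed_limit_eq_uminus by blast
  then show ?thesis
    using usc_envelope_upper_relaxed_limit[OF assms, of "\<lambda>\<epsilon> y s. - w \<epsilon> y s"]
    unfolding usc_envelope_def lsc_envelope_def by (simp add: ereal_Liminf_uminus)
qed

lemma compact_uniformly_below:
  fixes K :: "('a::metric_space \<times> real) set"
  assumes K: "compact K" and cont: "continuous_on K \<psi>" and "a > 0"
    and below: "\<And>z. z \<in> K \<Longrightarrow> upper_relaxed_limit w z \<le> ereal (\<psi> z - a)"
  obtains e where "e > 0" "\<And>y s \<epsilon>. (y, s) \<in> K \<Longrightarrow> 0 < \<epsilon> \<Longrightarrow> \<epsilon> < e \<Longrightarrow> w \<epsilon> y s < \<psi> (y, s) - a / 2"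
proof -
  have "\<exists>r>0. \<forall>y s \<epsilon>. (y, s) \<in> ball z r \<longrightarrow> (y, s) \<in> K \<longrightarrow> 0 < \<epsilon> \<longrightarrow> \<epsilon> < r \<longrightarrow> w \<epsilon> y s < \<psi> (y, s) - a / 2"
    if z: "z \<in> K" for z
  proof -
    have "upper_relaxed_limit w z < ereal (\<psi> z - 3 * a / 4)"
      using below[OF z] by (rule le_less_trans) (use \<open>a > 0\<close> in simp)
    then obtain r1 where r1: "r1 > 0" "\<And>y s \<epsilon>. (y, s) \<in> ball z r1 \<Longrightarrow> 0 < \<epsilon> \<Longrightarrow> \<epsilon> < r1 \<Longrightarrow> ereal (w \<epsilon> y s) < ereal (\<psi> z - 3 * a / 4)"
      using upper_relaxed_limit_less_D by metis
    obtain r2 where r2: "r2 > 0" "\<And>\<zeta>. \<zeta> \<in> K \<Longrightarrow> dist \<zeta> z < r2 \<Longrightarrow> dist (\<psi> \<zeta>) (\<psi> z) < a / 4"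
      using cont[unfolded continuous_on_iff, rule_format, OF z, of "a / 4"] \<open>a > 0\<close> by auto
    have "w \<epsilon> y s < \<psi> (y, s) - a / 2"
      if "(y, s) \<in> ball z (min r1 r2)" "(y, s) \<in> K" "0 < \<epsilon>" "\<epsilon> < min r1 r2" for y s \<epsilon>
    proof -
      have "w \<epsilon> y s < \<psi> z - 3 * a / 4" using r1(2)[of y s \<epsilon>] that by simp
      moreover have "dist (y, s) z < r2" using that by (simp add: dist_commute)
      then have "\<bar>\<psi> (y, s) - \<psi> z\<bar> < a / 4" using r2(2)[of "(y, s)"] that(2) unfolding dist_real_def by blast
      ultimately show ?thesis by argo
    qed
    then show ?thesis using r1(1) r2(1) by (intro exI[of _ "min r1 r2"]) simp
  qed
  then obtain r where r: "\<And>z. z \<in> K \<Longrightarrow> r z > 0" and below':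
    "\<And>z y s \<epsilon>. z \<in> K \<Longrightarrow> (y, s) \<in> ball z (r z) \<Longrightarrow> (y, s) \<in> K \<Longrightarrow> 0 < \<epsilon> \<Longrightarrow> \<epsilon> < r z \<Longrightarrow> w \<epsilon> y s < \<psi> (y, s) - a / 2"
    by metis
  obtain C where C: "C \<subseteq> K" "finite C" "K \<subseteq> (\<Union>z\<in>C. ball z (r z))"
    by (rule compactE_image[OF K, of K "\<lambda>z. ball z (r z)"]) (use r in force)+
  show ?thesis
  proof (rule that[of "Min (insert 1 (r ` C))"])
    show "Min (insert 1 (r ` C)) > 0" using C r by auto
    fix y s \<epsilon> assume *: "(y, s) \<in> K" "0 < \<epsilon>" "\<epsilon> < Min (insert 1 (r ` C))"
    then obtain z where "z \<in> C" "(y, s) \<in> ball z (r z)" using C(3) by blast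
    then show "w \<epsilon> y s < \<psi> (y, s) - a / 2" using below'[of z y s \<epsilon>] * C by auto
  qed
qed

text \<open>On the shell between the balls of radius \<open>\<rho> / 2\<close> and \<open>\<rho>\<close> the penalty \<open>\<theta>\<close> is bounded below, so
  for small \<open>\<epsilon>\<close> the function \<open>w \<epsilon> - \<psi>\<close> stays well below its values near \<open>z0\<close>, which approach \<open>0\<close> along
  some sequence. A point that is almost optimal in the closed ball therefore lies in the smaller
  ball. The functions \<open>w \<epsilon>\<close> need not attain a maximum, hence the tolerance \<open>\<delta> \<epsilon>\<close>.\<close>

lemma approximate_maximum:
  fixes z0 :: "'a::heine_borel \<times> real" and \<psi> \<theta> :: "'a \<times> real \<Rightarrow> real"
  assumes \<rho>: "\<rho> > 0" and \<psi>: "continuous_on (cball z0 \<rho>) \<psi>" and \<theta>: "continuous_on (cball z0 \<rho>) \<theta>"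
    and \<theta>0: "\<And>z. z \<noteq> z0 \<Longrightarrow> \<theta> z > 0"
    and top: "upper_relaxed_limit w z0 = ereal (\<psi> z0)"
    and le: "\<And>z. z \<in> cball z0 \<rho> \<Longrightarrow> upper_relaxed_limit w z \<le> ereal (\<psi> z - \<theta> z)"
    and bdd: "\<And>\<epsilon> y s. (y, s) \<in> cball z0 \<rho> \<Longrightarrow> w \<epsilon> y s \<le> B"
    and "\<eta> > 0" "e0 > 0" and \<delta>: "\<And>\<epsilon>. \<epsilon> > 0 \<Longrightarrow> \<delta> \<epsilon> > (0::real)"
  obtains \<epsilon> y s M where "0 < \<epsilon>" "\<epsilon> < e0" "(y, s) \<in> ball z0 (\<rho> / 2)" "- \<eta> < M"
    "\<And>y' s'. (y', s') \<in> cball z0 \<rho> \<Longrightarrow> w \<epsilon> y' s' \<le> \<psi> (y', s') + M"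
    "\<psi> (y, s) + M - \<delta> \<epsilon> < w \<epsilon> y s"
proof -
  define K where "K = cball z0 \<rho> - ball z0 (\<rho> / 2)"
  have K: "compact K" "K \<subseteq> cball z0 \<rho>" "z0 \<notin> K"
    using \<rho> by (auto simp: K_def intro: compact_diff)
  obtain a where a: "a > 0" "\<And>z. z \<in> K \<Longrightarrow> a \<le> \<theta> z"
  proof (cases "K = {}")
    case True
    then show thesis using that[of 1] by simp
  next
    case False
    then obtain z where "z \<in> K" "\<forall>y\<in>K. \<theta> z \<le> \<theta> y"
      using continuous_attains_inf[OF K(1), of \<theta>] continuous_on_subset[OF \<theta> K(2)] by blast
    then show thesis using that[of "\<theta> z"] \<theta>0[of z] K(3) by blast
  qed
  have "upper_relaxed_limit w z \<le> ereal (\<psi> z - a)" if "z \<in> K" for z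
    using le[of z] a(2)[OF that] that K(2) by (intro order_trans[OF le]) auto
  then obtain e1 where e1: "e1 > 0" "\<And>y s \<epsilon>. (y, s) \<in> K \<Longrightarrow> 0 < \<epsilon> \<Longrightarrow> \<epsilon> < e1 \<Longrightarrow> w \<epsilon> y s < \<psi> (y, s) - a / 2"
    using compact_uniformly_below[OF K(1) continuous_on_subset[OF \<psi> K(2)] a(1)] by metis
  define \<eta>' where "\<eta>' = min \<eta> (a / 2)"
  have \<eta>': "\<eta>' > 0" "\<eta>' \<le> \<eta>" "\<eta>' \<le> a / 2" using \<open>\<eta> > 0\<close> a by (auto simp: \<eta>'_def)
  obtain r where r: "r > 0" "\<And>\<zeta>. \<zeta> \<in> cball z0 \<rho> \<Longrightarrow> dist \<zeta> z0 < r \<Longrightarrow> dist (\<psi> \<zeta>) (\<psi> z0) < \<eta>' / 2"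
    using \<psi>[unfolded continuous_on_iff, rule_format, of z0 "\<eta>' / 2"] \<eta>'(1) \<rho> by auto
  have "ereal (\<psi> z0 - \<eta>' / 2) < upper_relaxed_limit w z0" using top \<eta>' by simp
  moreover have "Min {e0, e1, r, \<rho>} > 0" using e1 r \<rho> \<open>e0 > 0\<close> by simp
  ultimately obtain y1 s1 \<epsilon> where near: "(y1, s1) \<in> ball z0 (Min {e0, e1, r, \<rho>})" "0 < \<epsilon>" "\<epsilon> < Min {e0, e1, r, \<rho>}"
    "ereal (\<psi> z0 - \<eta>' / 2) < ereal (w \<epsilon> y1 s1)"
    by (rule less_upper_relaxed_limit_D)
  define F where "F \<zeta> = w \<epsilon> (fst \<zeta>) (snd \<zeta>) - \<psi> \<zeta>" for \<zeta>
  define M where "M = (SUP \<zeta>\<in>cball z0 \<rho>. F \<zeta>)"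
  have in1: "(y1, s1) \<in> cball z0 \<rho>" using near(1) by simp
  have "dist (\<psi> (y1, s1)) (\<psi> z0) < \<eta>' / 2" using r(2)[OF in1] near(1) by (simp add: dist_commute)
  moreover have "\<psi> z0 - \<eta>' / 2 < w \<epsilon> y1 s1" using near(4) by simp
  ultimately have F1: "- \<eta>' < F (y1, s1)" unfolding F_def dist_real_def fst_conv snd_conv by linarith
  obtain m where m: "\<And>\<zeta>. \<zeta> \<in> cball z0 \<rho> \<Longrightarrow> m \<le> \<psi> \<zeta>"
    using continuous_attains_inf[OF compact_cball _ \<psi>] \<rho> by (metis cball_eq_empty less_le_not_le not_le)
  have bddF: "bdd_above (F ` cball z0 \<rho>)"
  proof (rule bdd_aboveI2)
    fix \<zeta> assume "\<zeta> \<in> cball z0 \<rho>"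
    then show "F \<zeta> \<le> B - m" using bdd[of "fst \<zeta>" "snd \<zeta>" \<epsilon>] m[of \<zeta>] by (simp add: F_def)
  qed
  have FM: "F \<zeta> \<le> M" if "\<zeta> \<in> cball z0 \<rho>" for \<zeta>
    unfolding M_def by (rule cSUP_upper[OF that bddF])
  have "max (M - \<delta> \<epsilon>) (- \<eta>') < M" using \<delta>[OF near(2)] F1 FM[OF in1] by simp
  then obtain \<zeta> where \<zeta>: "\<zeta> \<in> cball z0 \<rho>" "max (M - \<delta> \<epsilon>) (- \<eta>') < F \<zeta>"
    unfolding M_def using less_cSUP_iff[OF _ bddF] in1 by blast
  have "\<zeta> \<notin> K"
  proof
    assume "\<zeta> \<in> K"
    then have "F \<zeta> < - (a / 2)" using e1(2)[of "fst \<zeta>" "snd \<zeta>" \<epsilon>] near by (simp add: F_def)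
    then show False using \<zeta>(2) \<eta>'(3) by simp
  qed
  then have \<zeta>in: "\<zeta> \<in> ball z0 (\<rho> / 2)" using \<zeta>(1) by (simp add: K_def)
  show ?thesis
  proof (rule that[of \<epsilon> "fst \<zeta>" "snd \<zeta>" M])
    show "- \<eta> < M" using F1 FM[OF in1] \<eta>'(2) by linarith
    show "w \<epsilon> y' s' \<le> \<psi> (y', s') + M" if "(y', s') \<in> cball z0 \<rho>" for y' s'
      using FM[OF that] by (simp add: F_def)
    show "\<psi> (fst \<zeta>, snd \<zeta>) + M - \<delta> \<epsilon> < w \<epsilon> (fst \<zeta>) (snd \<zeta>)" using \<zeta>(2) by (simp add: F_def)
  qed (use near \<zeta>in in auto)
qed

lemma lower_relaxed_limit_ge_I:
  assumes "upper_relaxed_limit (\<lambda>\<epsilon> y s. - w \<epsilon> y s) z \<le> ereal (- c)"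
  shows "ereal c \<le> lower_relaxed_limit w z"
  using assms unfolding lower_relaxed_limit_eq_uminus
  by (cases "upper_relaxed_limit (\<lambda>\<epsilon> y s. - w \<epsilon> y s) z") auto

section \<open>The value functions and their relaxed limits\<close>

text \<open>Continuity of the obstacles keeps the value functions bounded on bounded sets, uniformly in \<open>\<epsilon>\<close>
  and in time.\<close>

locale obstacle_game =
  fixes \<nu> :: real and f \<Psi>m \<Psi>p u0 :: "real^'n \<Rightarrow> real"
  assumes f_bounded: "locally_bounded f"
    and \<Psi>m_cont: "continuous_on UNIV \<Psi>m" and \<Psi>p_cont: "continuous_on UNIV \<Psi>p"
    and \<Psi>_le: "\<Psi>m x \<le> \<Psi>p x"
    and u0_cont: "continuous_on UNIV u0"
    and u0_between: "\<Psi>m x \<le> u0 x" "u0 x \<le> \<Psi>p x"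
begin

abbreviation u :: "real \<Rightarrow> real^'n \<Rightarrow> real \<Rightarrow> real" where
  "u \<equiv> game_value \<nu> f \<Psi>m \<Psi>p u0"

lemma u_initial: "s \<le> 0 \<Longrightarrow> u \<epsilon> y s = u0 y"
  by (subst game_value.simps) simp

lemma u_step:
  "0 < s \<Longrightarrow> 0 < \<epsilon> \<Longrightarrow> u \<epsilon> y s =
    max (\<Psi>m y) (min (\<Psi>p y) (game_step \<nu> f \<epsilon> (\<lambda>x. u \<epsilon> x (s - \<epsilon>\<^sup>2)) y))"
  by (subst game_value.simps) simp

lemma u_between: "\<Psi>m y \<le> u \<epsilon> y s" "u \<epsilon> y s \<le> \<Psi>p y"
  using u0_between[of y] \<Psi>_le[of y] by (subst game_value.simps, auto)+

lemma u_bounded_cball: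
  obtains B where "\<And>\<epsilon> y s. y \<in> cball x R \<Longrightarrow> \<bar>u \<epsilon> y s\<bar> \<le> B"
proof -
  have "bounded (\<Psi>m ` cball x R)" "bounded (\<Psi>p ` cball x R)"
    by (intro compact_imp_bounded compact_continuous_image continuous_on_subset[OF \<Psi>m_cont]
        continuous_on_subset[OF \<Psi>p_cont]; simp)+
  then obtain B1 B2 where B: "\<forall>c\<in>\<Psi>m ` cball x R. norm c \<le> B1" "\<forall>c\<in>\<Psi>p ` cball x R. norm c \<le> B2"
    unfolding bounded_iff by blast
  have "\<bar>u \<epsilon> y s\<bar> \<le> max B1 B2" if "y \<in> cball x R" for \<epsilon> y s
  proof -
    have "\<bar>\<Psi>m y\<bar> \<le> B1" "\<bar>\<Psi>p y\<bar> \<le> B2" using B that by auto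
    then show ?thesis using u_between(1)[of y \<epsilon> s] u_between(2)[of \<epsilon> y s] by linarith
  qed
  then show ?thesis using that by blast
qed

lemma u_moves_bounded:
  assumes "0 < \<epsilon>" "\<epsilon> \<le> 1"
  obtains B where "\<And>(v :: nat \<Rightarrow> real^'n) w b s. v \<in> orthonormal_tuples \<Longrightarrow> w \<in> sphere 0 1 \<Longrightarrow> b \<in> sign_tuples TYPE('n) \<Longrightarrow>
      \<bar>u \<epsilon> (game_move \<nu> \<epsilon> y v w b) s\<bar> \<le> B"
proof -
  obtain B where "\<And>\<epsilon>' z s. z \<in> cball y ((2 * real CARD('n) + \<bar>\<nu>\<bar>) * \<epsilon>) \<Longrightarrow> \<bar>u \<epsilon>' z s\<bar> \<le> B"
    using u_bounded_cball[of y "(2 * real CARD('n) + \<bar>\<nu>\<bar>) * \<epsilon>"] by metis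
  then show ?thesis using that dist_game_move_le assms by (metis mem_cball)
qed

lemma relaxed_limits_between:
  "ereal (\<Psi>m x) \<le> lower_relaxed_limit u (x, t)" "upper_relaxed_limit u (x, t) \<le> ereal (\<Psi>p x)"
proof -
  have upper: "upper_relaxed_limit w (x, t) \<le> ereal (h x)"
    if h: "continuous_on UNIV h" and w: "\<And>\<epsilon> y s. w \<epsilon> y s \<le> h y" for h :: "real^'n \<Rightarrow> real" and w
  proof (rule ereal_le_epsilon2)
    fix e :: real assume "e > 0"
    then obtain d where d: "d > 0" "\<And>y. dist y x < d \<Longrightarrow> dist (h y) (h x) < e"
      using h unfolding continuous_on_iff by (metis UNIV_I)
    show "upper_relaxed_limit w (x, t) \<le> ereal (h x) + ereal e"
    proof (rule upper_relaxed_limit_le_I[OF d(1)])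
      fix y s \<epsilon> assume "(y, s) \<in> ball (x, t) d"
      then have "dist y x < d" using dist_fst_le[of "(x, t)" "(y, s)"] by (simp add: dist_commute)
      then show "ereal (w \<epsilon> y s) \<le> ereal (h x) + ereal e"
        using d(2)[of y] w[of \<epsilon> y s] by (simp add: dist_real_def abs_less_iff)
    qed
  qed
  show "upper_relaxed_limit u (x, t) \<le> ereal (\<Psi>p x)"
    by (rule upper[OF \<Psi>p_cont u_between(2)])
  have "upper_relaxed_limit (\<lambda>\<epsilon> y s. - u \<epsilon> y s) (x, t) \<le> ereal (- \<Psi>m x)"
    by (rule upper) (use u_between(1) in \<open>auto intro: continuous_intros \<Psi>m_cont\<close>)
  then show "ereal (\<Psi>m x) \<le> lower_relaxed_limit u (x, t)"
    by (rule lower_relaxed_limit_ge_I)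
qed

lemma relaxed_limits_real:
  obtains a b where "lower_relaxed_limit u z = ereal a" "upper_relaxed_limit u z = ereal b"
    "\<Psi>m (fst z) \<le> a" "a \<le> b" "b \<le> \<Psi>p (fst z)"
proof -
  have 1: "ereal (\<Psi>m (fst z)) \<le> lower_relaxed_limit u z" "upper_relaxed_limit u z \<le> ereal (\<Psi>p (fst z))"
    using relaxed_limits_between[of "fst z" "snd z"] by simp_all
  have 2: "lower_relaxed_limit u z \<le> upper_relaxed_limit u z" by (rule lower_le_upper_relaxed_limit)
  show ?thesis
    using that 1 2 by (cases "lower_relaxed_limit u z"; cases "upper_relaxed_limit u z") auto
qed

subsection \<open>The initial trace\<close>

text \<open>One choice of constants serves the upper and the lower barrier: \<open>K\<close> makes the paraboloid exceed the
  oscillation of the values at distance at least \<open>r\<close>, and \<open>C\<close> bounds both the change of the paraboloid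
  in one move, up to its term of order \<open>\<epsilon>\<close>, and the running payoff.\<close>

lemma barrier_data:
  assumes \<eta>: "\<eta> > 0"
  obtains r K C e where "0 < r" "r \<le> 1" "0 \<le> K" "0 \<le> C" "0 < e"
    "\<And>y. dist x y < r \<Longrightarrow> \<bar>u0 y - u0 x\<bar> \<le> \<eta>"
    "\<And>y s \<epsilon>. dist x y \<le> 2 \<Longrightarrow> r \<le> dist x y \<Longrightarrow> \<bar>u \<epsilon> y s - u0 x\<bar> \<le> K * (dist x y)\<^sup>2"
    "\<And>y \<epsilon> (v :: nat \<Rightarrow> real^'n) w b. dist x y < r \<Longrightarrow> 0 < \<epsilon> \<Longrightarrow> \<epsilon> < e \<Longrightarrow>
      v \<in> orthonormal_tuples \<Longrightarrow> w \<in> sphere 0 1 \<Longrightarrow> b \<in> sign_tuples TYPE('n) \<Longrightarrow>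
      dist x (game_move \<nu> \<epsilon> y v w b) \<le> 2 \<and>
      \<bar>K * (dist x (game_move \<nu> \<epsilon> y v w b))\<^sup>2 - K * (dist x y)\<^sup>2
        - K * (2 * sqrt 2 * \<epsilon>) * ((y - x) \<bullet> frame_sum v b)\<bar> + \<epsilon>\<^sup>2 * \<bar>f y\<bar> \<le> C * \<epsilon>\<^sup>2"
proof -
  obtain r1 where r1: "r1 > 0" "bounded (f ` ball x r1)"
    using f_bounded unfolding locally_bounded_def by blast
  then obtain F where "\<forall>c\<in>f ` ball x r1. norm c \<le> F"
    unfolding bounded_iff by blast
  then have F: "\<bar>f y\<bar> \<le> F" if "y \<in> ball x r1" for y using that by auto
  obtain r2 where r2: "r2 > 0" "\<And>y. dist y x < r2 \<Longrightarrow> dist (u0 y) (u0 x) < \<eta>"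
    using u0_cont \<eta> unfolding continuous_on_iff by (metis UNIV_I)
  define r where "r = Min {1, r1, r2}"
  have r: "0 < r" "r \<le> 1" "r \<le> r1" "r \<le> r2" using r1 r2 by (auto simp: r_def)
  obtain B where B: "\<And>\<epsilon> y s. y \<in> cball x 2 \<Longrightarrow> \<bar>u \<epsilon> y s\<bar> \<le> B"
    using u_bounded_cball by blast
  have B0: "0 \<le> B" using B[of x 1 0] by simp
  define K where "K = (B + \<bar>u0 x\<bar>) / r\<^sup>2"
  have K: "0 \<le> K" "K * r\<^sup>2 = B + \<bar>u0 x\<bar>" using B0 r by (simp_all add: K_def)
  define D where "D = 2 * real CARD('n) + \<bar>\<nu>\<bar>"
  have D: "0 < D" by (simp add: D_def add_pos_nonneg)
  define C where "C = K * (2 * \<bar>\<nu>\<bar> + D\<^sup>2) + \<bar>F\<bar>"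
  define e where "e = min 1 (1 / D)"
  show ?thesis
  proof (rule that[of r K C e])
    show "0 < r" "r \<le> 1" "0 \<le> K" "0 \<le> C" "0 < e" using r K D by (auto simp: C_def e_def)
    show "\<bar>u0 y - u0 x\<bar> \<le> \<eta>" if "dist x y < r" for y
      using r2(2)[of y] that r by (simp add: dist_commute dist_real_def)
    show "\<bar>u \<epsilon> y s - u0 x\<bar> \<le> K * (dist x y)\<^sup>2" if "dist x y \<le> 2" "r \<le> dist x y" for y s \<epsilon>
    proof -
      have "\<bar>u \<epsilon> y s - u0 x\<bar> \<le> B + \<bar>u0 x\<bar>" using B[of y \<epsilon> s] that by simp
      also have "\<dots> = K * r\<^sup>2" using K by simp
      also have "\<dots> \<le> K * (dist x y)\<^sup>2" using that r K by (intro mult_left_mono power_mono) auto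
      finally show ?thesis .
    qed
    fix y \<epsilon> and v :: "nat \<Rightarrow> real^'n" and w b
    assume y: "dist x y < r" and \<epsilon>: "0 < \<epsilon>" "\<epsilon> < e"
      and v: "v \<in> orthonormal_tuples" and w: "w \<in> sphere (0 :: real^'n) 1" and b: "b \<in> sign_tuples TYPE('n)"
    have \<epsilon>1: "\<epsilon> \<le> 1" "D * \<epsilon> \<le> 1" using \<epsilon> D by (auto simp: e_def field_simps)
    let ?s = "frame_sum v b"
    define a where "a = y - x"
    define k where "k = (sqrt 2 * \<epsilon>) *\<^sub>R ?s + (\<nu> * \<epsilon>\<^sup>2) *\<^sub>R w"
    have a: "norm a = dist x y" "norm a \<le> 1" using y r by (auto simp: a_def dist_norm norm_minus_commute)
    have k: "norm k \<le> D * \<epsilon>" unfolding k_def D_def by (rule norm_displacement_le[OF v b w \<epsilon>(1) \<epsilon>1(1)])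
    have "game_move \<nu> \<epsilon> y v w b - x = a + k" by (simp add: game_move_def a_def k_def)
    then have m: "dist x (game_move \<nu> \<epsilon> y v w b) = norm (a + k)"
      by (metis dist_commute dist_norm)
    have "norm (a + k) \<le> 2" using norm_triangle_ineq[of a k] k a \<epsilon>1 by linarith
    moreover have "\<bar>K * (norm (a + k))\<^sup>2 - K * (norm a)\<^sup>2 - K * (2 * sqrt 2 * \<epsilon>) * (a \<bullet> ?s)\<bar> + \<epsilon>\<^sup>2 * \<bar>f y\<bar> \<le> C * \<epsilon>\<^sup>2"
    proof -
      have ak: "2 * (a \<bullet> k) = (2 * sqrt 2 * \<epsilon>) * (a \<bullet> ?s) + 2 * \<nu> * \<epsilon>\<^sup>2 * (a \<bullet> w)"
        unfolding k_def inner_add_right inner_scaleR_right by simp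
      have "(norm (a + k))\<^sup>2 = (norm a)\<^sup>2 + 2 * (a \<bullet> k) + (norm k)\<^sup>2"
        by (simp add: power2_norm_eq_inner inner_add_left inner_add_right inner_commute)
      then have eq: "(norm (a + k))\<^sup>2 - (norm a)\<^sup>2 - (2 * sqrt 2 * \<epsilon>) * (a \<bullet> ?s) = 2 * \<nu> * \<epsilon>\<^sup>2 * (a \<bullet> w) + (norm k)\<^sup>2"
        unfolding ak by simp
      have "\<bar>a \<bullet> w\<bar> \<le> 1" using Cauchy_Schwarz_ineq2[of a w] a w by simp
      then have "\<bar>2 * \<nu> * \<epsilon>\<^sup>2 * (a \<bullet> w)\<bar> \<le> 2 * \<bar>\<nu>\<bar> * \<epsilon>\<^sup>2 * 1"
        unfolding abs_mult by (intro mult_mono) auto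
      moreover have "(norm k)\<^sup>2 \<le> D\<^sup>2 * \<epsilon>\<^sup>2"
        using power_mono[OF k norm_ge_zero, of 2] by (simp add: power_mult_distrib)
      ultimately have "\<bar>2 * \<nu> * \<epsilon>\<^sup>2 * (a \<bullet> w) + (norm k)\<^sup>2\<bar> \<le> (2 * \<bar>\<nu>\<bar> + D\<^sup>2) * \<epsilon>\<^sup>2"
        using zero_le_power2[of "norm k"] unfolding distrib_right by linarith
      then have "K * \<bar>2 * \<nu> * \<epsilon>\<^sup>2 * (a \<bullet> w) + (norm k)\<^sup>2\<bar> \<le> K * ((2 * \<bar>\<nu>\<bar> + D\<^sup>2) * \<epsilon>\<^sup>2)"
        using K(1) by (rule mult_left_mono)
      moreover have "\<bar>K * (norm (a + k))\<^sup>2 - K * (norm a)\<^sup>2 - K * (2 * sqrt 2 * \<epsilon>) * (a \<bullet> ?s)\<bar>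
          = K * \<bar>2 * \<nu> * \<epsilon>\<^sup>2 * (a \<bullet> w) + (norm k)\<^sup>2\<bar>"
      proof -
        have "K * (norm (a + k))\<^sup>2 - K * (norm a)\<^sup>2 - K * (2 * sqrt 2 * \<epsilon>) * (a \<bullet> ?s)
            = K * ((norm (a + k))\<^sup>2 - (norm a)\<^sup>2 - (2 * sqrt 2 * \<epsilon>) * (a \<bullet> ?s))"
          by (simp only: right_diff_distrib mult.assoc)
        then show ?thesis unfolding eq by (simp only: abs_mult abs_of_nonneg[OF K(1)])
      qed
      moreover have "\<epsilon>\<^sup>2 * \<bar>f y\<bar> \<le> \<epsilon>\<^sup>2 * \<bar>F\<bar>"
        using F[of y] y r by (intro mult_left_mono) auto
      ultimately show ?thesis by (simp add: C_def algebra_simps)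
    qed
    ultimately show "dist x (game_move \<nu> \<epsilon> y v w b) \<le> 2 \<and>
      \<bar>K * (dist x (game_move \<nu> \<epsilon> y v w b))\<^sup>2 - K * (dist x y)\<^sup>2
        - K * (2 * sqrt 2 * \<epsilon>) * ((y - x) \<bullet> ?s)\<bar> + \<epsilon>\<^sup>2 * \<bar>f y\<bar> \<le> C * \<epsilon>\<^sup>2"
      unfolding m a(1)[symmetric] a_def[symmetric] by blast
  qed
qed

text \<open>The shift \<open>s + \<epsilon>\<^sup>2\<close> makes the barrier gain exactly \<open>C \<epsilon>\<^sup>2\<close> at every step from a positive time,
  including the last one, which overshoots to a time in \<open>(- \<epsilon>\<^sup>2, 0]\<close>.\<close>

lemma initial_barrier:
  assumes \<eta>: "\<eta> > 0"
  obtains K C e where "0 \<le> K" "0 \<le> C" "0 < e"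
    "\<And>y s \<epsilon>. dist x y \<le> 2 \<Longrightarrow> 0 < \<epsilon> \<Longrightarrow> \<epsilon> < e \<Longrightarrow>
       \<bar>u \<epsilon> y s - u0 x\<bar> \<le> \<eta> + K * (dist x y)\<^sup>2 + C * max 0 (s + \<epsilon>\<^sup>2)"
proof -
  obtain r K C e where r: "0 < r" "r \<le> 1" and K: "0 \<le> K" and C: "0 \<le> C" and e: "0 < e"
    and near: "\<And>y. dist x y < r \<Longrightarrow> \<bar>u0 y - u0 x\<bar> \<le> \<eta>"
    and far: "\<And>y s \<epsilon>. dist x y \<le> 2 \<Longrightarrow> r \<le> dist x y \<Longrightarrow> \<bar>u \<epsilon> y s - u0 x\<bar> \<le> K * (dist x y)\<^sup>2"
    and move: "\<And>y \<epsilon> (v :: nat \<Rightarrow> real^'n) w b. dist x y < r \<Longrightarrow> 0 < \<epsilon> \<Longrightarrow> \<epsilon> < e \<Longrightarrow>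
      v \<in> orthonormal_tuples \<Longrightarrow> w \<in> sphere 0 1 \<Longrightarrow> b \<in> sign_tuples TYPE('n) \<Longrightarrow>
      dist x (game_move \<nu> \<epsilon> y v w b) \<le> 2 \<and>
      \<bar>K * (dist x (game_move \<nu> \<epsilon> y v w b))\<^sup>2 - K * (dist x y)\<^sup>2
        - K * (2 * sqrt 2 * \<epsilon>) * ((y - x) \<bullet> frame_sum v b)\<bar> + \<epsilon>\<^sup>2 * \<bar>f y\<bar> \<le> C * \<epsilon>\<^sup>2"
    using barrier_data[OF \<eta>, of x] by blast
  define h where "h y t = \<eta> + K * (dist x y)\<^sup>2 + C * max 0 t" for y t
  have "\<bar>u \<epsilon> y s - u0 x\<bar> \<le> h y (s + \<epsilon>\<^sup>2)"
    if \<epsilon>: "0 < \<epsilon>" "\<epsilon> < min 1 e" and y: "dist x y \<le> 2" and s: "s \<le> real N * \<epsilon>\<^sup>2" for N y s \<epsilon>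
    using y s
  proof (induction N arbitrary: y s)
    case 0
    have h0: "\<eta> \<le> h y (s + \<epsilon>\<^sup>2)" "K * (dist x y)\<^sup>2 \<le> h y (s + \<epsilon>\<^sup>2)"
      using \<eta> K C by (simp_all add: h_def)
    show ?case
    proof (cases "dist x y < r")
      case True
      then show ?thesis using near[OF True] u_initial[of s \<epsilon> y] 0 h0 by simp
    next
      case False
      then show ?thesis using far[OF 0(1), of \<epsilon> s] h0 by simp
    qed
  next
    case (Suc N)
    have h0: "\<eta> \<le> h y (s + \<epsilon>\<^sup>2)" "K * (dist x y)\<^sup>2 \<le> h y (s + \<epsilon>\<^sup>2)"
      using \<eta> K C by (simp_all add: h_def)
    consider "r \<le> dist x y" | "dist x y < r" "s \<le> 0" | "dist x y < r" "0 < s" by linarith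
    then show ?case
    proof cases
      case 1
      then show ?thesis using far[OF Suc.prems(1), of \<epsilon> s] h0 by simp
    next
      case 2
      then show ?thesis using near[OF 2(1)] u_initial[of s \<epsilon> y] h0 by simp
    next
      case 3
      have \<epsilon>': "\<epsilon> < e" "\<epsilon> \<le> 1" using \<epsilon> by auto
      note mv = move[OF 3(1) \<epsilon>(1) \<epsilon>'(1)]
      have "s - \<epsilon>\<^sup>2 \<le> real N * \<epsilon>\<^sup>2" using Suc.prems(2) by (simp add: algebra_simps)
      then have IH: "\<bar>u \<epsilon> y' (s - \<epsilon>\<^sup>2) - u0 x\<bar> \<le> \<eta> + K * (dist x y')\<^sup>2 + C * s" if "dist x y' \<le> 2" for y'
        using Suc.IH[OF that, of "s - \<epsilon>\<^sup>2"] 3 by (simp add: h_def)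
      have hs: "h y (s + \<epsilon>\<^sup>2) = \<eta> + K * (dist x y)\<^sup>2 + C * s + C * \<epsilon>\<^sup>2"
        using 3 by (simp add: h_def distrib_left)
      obtain B where B: "\<And>(v :: nat \<Rightarrow> real^'n) w b s. v \<in> orthonormal_tuples \<Longrightarrow> w \<in> sphere 0 1 \<Longrightarrow> b \<in> sign_tuples TYPE('n) \<Longrightarrow>
          \<bar>u \<epsilon> (game_move \<nu> \<epsilon> y v w b) s\<bar> \<le> B"
        using u_moves_bounded[OF \<epsilon>(1) \<epsilon>'(2), of y] by blast
      let ?S = "game_step \<nu> f \<epsilon> (\<lambda>x. u \<epsilon> x (s - \<epsilon>\<^sup>2)) y"
      have f: "- (\<epsilon>\<^sup>2 * \<bar>f y\<bar>) \<le> \<epsilon>\<^sup>2 * f y" "\<epsilon>\<^sup>2 * f y \<le> \<epsilon>\<^sup>2 * \<bar>f y\<bar>"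
        using mult_left_mono[of "- \<bar>f y\<bar>" "f y" "\<epsilon>\<^sup>2"] mult_left_mono[of "f y" "\<bar>f y\<bar>" "\<epsilon>\<^sup>2"]
        by (simp_all add: minus_le_iff abs_ge_minus_self)
      have "?S \<le> u0 x + h y (s + \<epsilon>\<^sup>2)"
      proof (rule game_step_le[where g = "\<lambda>x. u \<epsilon> x (s - \<epsilon>\<^sup>2)", OF B])
        fix v :: "nat \<Rightarrow> real^'n" and w assume v: "v \<in> orthonormal_tuples" and w: "w \<in> sphere (0 :: real^'n) 1"
        obtain b where b: "b \<in> sign_tuples TYPE('n)" "(y - x) \<bullet> frame_sum v b \<le> 0"
          by (rule exists_signs_curvature_le[of "y - x" v 0])
        have "K * (2 * sqrt 2 * \<epsilon>) * ((y - x) \<bullet> frame_sum v b) \<le> 0"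
          using b(2) K \<epsilon>(1) by (intro mult_nonneg_nonpos) auto
        then have "u \<epsilon> (game_move \<nu> \<epsilon> y v w b) (s - \<epsilon>\<^sup>2) + \<epsilon>\<^sup>2 * f y \<le> u0 x + h y (s + \<epsilon>\<^sup>2)"
          using mv[OF v w b(1)] IH[of "game_move \<nu> \<epsilon> y v w b"] f hs by linarith
        then show "\<exists>w'\<in>sphere 0 1. \<exists>b\<in>sign_tuples TYPE('n). (\<nu> \<ge> 0 \<longrightarrow> w' = w) \<and>
            u \<epsilon> (game_move \<nu> \<epsilon> y v w' b) (s - \<epsilon>\<^sup>2) + \<epsilon>\<^sup>2 * f y \<le> u0 x + h y (s + \<epsilon>\<^sup>2)"
          using w b(1) by blast
      qed
      moreover have "u0 x - h y (s + \<epsilon>\<^sup>2) \<le> ?S"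
      proof -
        obtain v :: "nat \<Rightarrow> real^'n" where v: "v \<in> orthonormal_tuples" "\<And>b. (y - x) \<bullet> frame_sum v b = 0"
          using frame_orthogonal_to[of "y - x"] by blast
        obtain w where w: "w \<in> sphere (0 :: real^'n) 1" using sphere_ne by blast
        show ?thesis
        proof (rule game_step_ge[where g = "\<lambda>x. u \<epsilon> x (s - \<epsilon>\<^sup>2)", OF B v(1) w])
          fix w' :: "real^'n" and b assume w': "w' \<in> sphere 0 1" and b: "b \<in> sign_tuples TYPE('n)"
          have "K * (2 * sqrt 2 * \<epsilon>) * ((y - x) \<bullet> frame_sum v b) = 0" by (simp only: v(2) mult_zero_right)
          then show "u0 x - h y (s + \<epsilon>\<^sup>2) \<le> u \<epsilon> (game_move \<nu> \<epsilon> y v w' b) (s - \<epsilon>\<^sup>2) + \<epsilon>\<^sup>2 * f y"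
            using mv[OF v(1) w' b] IH[of "game_move \<nu> \<epsilon> y v w' b"] f hs by linarith
        qed
      qed
      moreover have "\<Psi>m y \<le> u0 x + h y (s + \<epsilon>\<^sup>2)" "u0 x - h y (s + \<epsilon>\<^sup>2) \<le> \<Psi>p y"
        using u0_between[of y] near[OF 3(1)] h0 by linarith+
      ultimately show ?thesis
        unfolding u_step[OF 3(2) \<epsilon>(1)] abs_le_iff by (auto simp: max_def min_def)
    qed
  qed
  note main = this
  show ?thesis
  proof (rule that[OF K C])
    show "0 < min 1 e" using e by simp
    fix y s \<epsilon> assume y: "dist x y \<le> 2" and \<epsilon>: "0 < \<epsilon>" "\<epsilon> < min 1 e"
    obtain N where "s / \<epsilon>\<^sup>2 \<le> real N" using real_arch_simple by blast
    then have "s \<le> real N * \<epsilon>\<^sup>2" using \<epsilon> by (simp add: divide_le_eq)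
    from main[OF \<epsilon> y this] show "\<bar>u \<epsilon> y s - u0 x\<bar> \<le> \<eta> + K * (dist x y)\<^sup>2 + C * max 0 (s + \<epsilon>\<^sup>2)"
      by (simp add: h_def)
  qed
qed

lemma u_near_initial:
  assumes \<eta>: "\<eta> > 0"
  obtains r where "r > 0" "\<And>y s \<epsilon>. (y, s) \<in> ball (x, 0) r \<Longrightarrow> 0 < \<epsilon> \<Longrightarrow> \<epsilon> < r \<Longrightarrow> \<bar>u \<epsilon> y s - u0 x\<bar> \<le> \<eta>"
proof -
  obtain K C e where K: "0 \<le> K" and C: "0 \<le> C" and e: "0 < e"
    and bar: "\<And>y s \<epsilon>. dist x y \<le> 2 \<Longrightarrow> 0 < \<epsilon> \<Longrightarrow> \<epsilon> < e \<Longrightarrow>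
       \<bar>u \<epsilon> y s - u0 x\<bar> \<le> \<eta> / 2 + K * (dist x y)\<^sup>2 + C * max 0 (s + \<epsilon>\<^sup>2)"
    using initial_barrier[of "\<eta> / 2" x, OF half_gt_zero[OF \<eta>]] by blast
  define Q where "Q = K + 2 * C + 1"
  have Q: "Q > 0" using K C by (simp add: Q_def)
  define r where "r = Min {1, e, \<eta> / (2 * Q)}"
  have r: "0 < r" "r \<le> 1" "r \<le> e" "r \<le> \<eta> / (2 * Q)" using e \<eta> Q by (auto simp: r_def)
  have rQ: "r * Q \<le> \<eta> / 2" using r(4) Q by (simp add: field_simps)
  show ?thesis
  proof (rule that[OF r(1)])
    fix y and s \<epsilon> :: real assume ys: "(y, s) \<in> ball (x, 0) r" and \<epsilon>: "0 < \<epsilon>" "\<epsilon> < r"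
    have y: "dist x y < r" "\<bar>s\<bar> < r"
      using ys dist_fst_le[of "(x, 0)" "(y, s)"] dist_snd_le[of "(x, 0)" "(y, s)"] by (auto simp: dist_real_def)
    have sq: "t\<^sup>2 \<le> r" if "0 \<le> t" "t < r" for t :: real
      using mult_mono[of t r t 1] that r by (simp add: power2_eq_square)
    have "K * (dist x y)\<^sup>2 \<le> K * r" using K sq[of "dist x y"] y by (intro mult_left_mono) auto
    moreover have "C * max 0 (s + \<epsilon>\<^sup>2) \<le> C * (2 * r)"
      using C sq[of \<epsilon>] \<epsilon> y by (intro mult_left_mono) auto
    moreover have "K * r + C * (2 * r) \<le> r * Q" using r by (simp add: Q_def algebra_simps)
    ultimately show "\<bar>u \<epsilon> y s - u0 x\<bar> \<le> \<eta>"
      using bar[of y \<epsilon> s] y r \<epsilon> rQ by simp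
  qed
qed

lemma initial_trace:
  "upper_relaxed_limit u (x, 0) = ereal (u0 x)" "lower_relaxed_limit u (x, 0) = ereal (u0 x)"
proof -
  have upper: "upper_relaxed_limit w (x, 0) \<le> ereal c"
    if w: "\<And>\<epsilon> y s. w \<epsilon> y s \<le> c + \<bar>u \<epsilon> y s - u0 x\<bar>" for w c
  proof (rule ereal_le_epsilon2)
    fix \<eta> :: real assume "\<eta> > 0"
    then obtain r where r: "r > 0" "\<And>y s \<epsilon>. (y, s) \<in> ball (x, 0) r \<Longrightarrow> 0 < \<epsilon> \<Longrightarrow> \<epsilon> < r \<Longrightarrow> \<bar>u \<epsilon> y s - u0 x\<bar> \<le> \<eta>"
      using u_near_initial[of \<eta> x] by blast
    show "upper_relaxed_limit w (x, 0) \<le> ereal c + ereal \<eta>"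
    proof (rule upper_relaxed_limit_le_I[OF r(1)])
      fix y and s \<epsilon> :: real assume "(y, s) \<in> ball (x, 0) r" "0 < \<epsilon>" "\<epsilon> < r"
      from r(2)[OF this] w[of \<epsilon> y s] show "ereal (w \<epsilon> y s) \<le> ereal c + ereal \<eta>" by simp
    qed
  qed
  have "upper_relaxed_limit u (x, 0) \<le> ereal (u0 x)" by (rule upper) linarith
  moreover have "ereal (u0 x) \<le> lower_relaxed_limit u (x, 0)"
    by (rule lower_relaxed_limit_ge_I, rule upper) linarith
  ultimately show "upper_relaxed_limit u (x, 0) = ereal (u0 x)" "lower_relaxed_limit u (x, 0) = ereal (u0 x)"
    using lower_le_upper_relaxed_limit[of u "(x, 0)"] by (auto intro: antisym order_trans)
qed

end

section \<open>Viscosity inequalities\<close>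

lemma open_open_spacetime: "open (open_spacetime :: ((real^'n) \<times> real) set)"
  unfolding open_spacetime_def by (intro open_Times) auto

lemma small_step_size:
  fixes D \<rho> \<delta> g \<epsilon>0 :: real
  assumes "D > 0" "\<rho> > 0" "\<delta> > 0" "g > 0" "\<epsilon>0 > 0"
  obtains e where "e > 0" "\<And>\<epsilon>. 0 < \<epsilon> \<Longrightarrow> \<epsilon> < e \<Longrightarrow> \<epsilon> \<le> 1 \<and> \<epsilon> < \<epsilon>0 \<and> D * \<epsilon> \<le> \<rho> / 2 \<and> \<delta> * \<epsilon>\<^sup>2 \<le> g / 2"
proof
  let ?e = "Min {1, \<epsilon>0, \<rho> / (2 * D), g / (2 * \<delta>)}"
  show "?e > 0" using assms by simp
  fix \<epsilon> :: real assume \<epsilon>: "0 < \<epsilon>" "\<epsilon> < ?e"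
  have "D * \<epsilon> \<le> D * (\<rho> / (2 * D))" using \<epsilon> assms by (intro mult_left_mono) auto
  then have 1: "D * \<epsilon> \<le> \<rho> / 2" using assms by simp
  have "\<delta> * \<epsilon>\<^sup>2 \<le> \<delta> * \<epsilon>" using \<epsilon> assms by (simp add: power2_eq_square mult_left_le)
  also have "\<dots> \<le> \<delta> * (g / (2 * \<delta>))" using \<epsilon> assms by (intro mult_left_mono) auto
  finally show "\<epsilon> \<le> 1 \<and> \<epsilon> < \<epsilon>0 \<and> D * \<epsilon> \<le> \<rho> / 2 \<and> \<delta> * \<epsilon>\<^sup>2 \<le> g / 2" using 1 \<epsilon> assms by simp
qed

lemma positive_near:
  fixes G :: "(real^'n) \<times> real \<Rightarrow> real"
  assumes G: "continuous_on open_spacetime G" and z0: "z0 \<in> open_spacetime" and g: "g < G z0"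
  obtains d where "d > 0" "\<And>z. dist z0 z < d \<Longrightarrow> g < G z"
proof -
  have "isCont G z0" using G open_open_spacetime z0 continuous_on_eq_continuous_at by blast
  then obtain d where d: "d > 0" "\<And>z. dist z z0 < d \<Longrightarrow> \<bar>G z - G z0\<bar> < G z0 - g"
    unfolding continuous_at_eps_delta dist_real_def using g by (metis diff_gt_0_iff_gt)
  show ?thesis
  proof (rule that[OF d(1)])
    fix z assume "dist z0 z < d"
    then have "\<bar>G z - G z0\<bar> < G z0 - g" using d(2) by (simp add: dist_commute)
    then show "g < G z" by linarith
  qed
qed

lemma cball_subset_open_spacetime:
  fixes z0 :: "(real^'n) \<times> real"
  assumes "\<rho> < snd z0"
  shows "cball z0 \<rho> \<subseteq> open_spacetime"
proof
  fix z assume "z \<in> cball z0 \<rho>"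
  then have "\<bar>snd z0 - snd z\<bar> < snd z0" using dist_snd_le[of z0 z] assms by (simp add: dist_real_def)
  then show "z \<in> open_spacetime" by (auto simp: open_spacetime_def mem_Times_iff)
qed

text \<open>The additive constant gives the perturbed function the value \<open>c\<close> at \<open>z0\<close>; in the applications
  \<open>c\<close> is the relaxed limit there.\<close>

lemma perturbed_test_function:
  fixes \<phi> :: "(real^'n) \<times> real \<Rightarrow> real"
  assumes smooth: "smooth_fun_on open_spacetime \<phi>" and z0: "z0 \<in> open_spacetime"
  shows "parabolic_expansion (\<lambda>z. \<phi> z + (c - \<phi> z0) + strict_bump z0 z) z0
      (space_grad \<phi> z0) (time_deriv \<phi> z0) (space_hessian \<phi> z0)" (is ?plus)
    and "parabolic_expansion (\<lambda>z. \<phi> z + (c - \<phi> z0) - strict_bump z0 z) z0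
      (space_grad \<phi> z0) (time_deriv \<phi> z0) (space_hessian \<phi> z0)" (is ?minus)
    and "transpose (space_hessian \<phi> z0) = space_hessian \<phi> z0"
    and "continuous_on open_spacetime \<phi>"
proof -
  have C2: "times_differentiable_on (Suc (Suc 0)) open_spacetime \<phi>"
    using smooth unfolding smooth_fun_on_def by blast
  note exp = parabolic_expansion_add[OF parabolic_expansion_smooth[OF C2 open_open_spacetime z0]
      parabolic_expansion_const[of "c - \<phi> z0" z0]]
  show ?plus
    using parabolic_expansion_add[OF exp parabolic_expansion_strict_bump[of z0]] by simp
  show ?minus
    using parabolic_expansion_add[OF exp parabolic_expansion_uminus[OF parabolic_expansion_strict_bump[of z0]]] by simp
  show "transpose (space_hessian \<phi> z0) = space_hessian \<phi> z0"
    by (rule space_hessian_symmetric[OF C2 open_open_spacetime z0])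
  show "continuous_on open_spacetime \<phi>"
    using smooth unfolding smooth_fun_on_def by (metis times_differentiable_on.simps(1))
qed

context obstacle_game
begin

lemma subsolution_test:
  assumes smooth: "smooth_fun_on open_spacetime \<phi>" and t: "t > 0"
    and max: "\<forall>\<^sub>F z in nhds (x, t). upper_relaxed_limit u z - ereal (\<phi> z)
      \<le> upper_relaxed_limit u (x, t) - ereal (\<phi> (x, t))"
    and above: "ereal (\<Psi>m x) < upper_relaxed_limit u (x, t)"
  shows "ereal (time_deriv \<phi> (x, t) - \<nu> * norm (space_grad \<phi> (x, t)))
      + mcf_op_lower (space_grad \<phi> (x, t)) (space_hessian \<phi> (x, t)) \<le> usc_envelope UNIV (\<lambda>y. ereal (f y)) x"
proof (rule ccontr)
  assume "\<not> ?thesis"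
  then have less: "usc_envelope UNIV (\<lambda>y. ereal (f y)) x < ereal (time_deriv \<phi> (x, t) - \<nu> * norm (space_grad \<phi> (x, t)))
      + mcf_op_lower (space_grad \<phi> (x, t)) (space_hessian \<phi> (x, t))" by simp
  define z0 where "z0 = (x, t)"
  have z0: "z0 \<in> open_spacetime" using t by (simp add: z0_def open_spacetime_def)
  note pert = perturbed_test_function[OF smooth z0]
  obtain c where c: "upper_relaxed_limit u z0 = ereal c" using relaxed_limits_real[of z0] by metis
  define \<psi> where "\<psi> z = \<phi> z + (c - \<phi> z0) + strict_bump z0 z" for z
  have \<psi>0: "\<psi> z0 = c" by (simp add: \<psi>_def)
  have \<psi>_cont: "continuous_on open_spacetime \<psi>"
    unfolding \<psi>_def by (intro continuous_intros pert(4))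
  have exp: "parabolic_expansion \<psi> (x, t) (space_grad \<phi> (x, t)) (time_deriv \<phi> (x, t)) (space_hessian \<phi> (x, t))"
    using pert(1)[of c] unfolding \<psi>_def[abs_def] z0_def .
  obtain \<delta> r \<epsilon>0 where \<delta>: "\<delta> > 0" and r: "r > 0" and \<epsilon>0: "\<epsilon>0 > 0" and step:
    "\<And>y s \<epsilon> v (w :: real^'n). (y, s) \<in> ball (x, t) r \<Longrightarrow> 0 < \<epsilon> \<Longrightarrow> \<epsilon> < \<epsilon>0 \<Longrightarrow> v \<in> orthonormal_tuples \<Longrightarrow> w \<in> sphere 0 1 \<Longrightarrow>
      \<exists>w'\<in>sphere 0 1. \<exists>b\<in>sign_tuples TYPE('n). (\<nu> \<ge> 0 \<longrightarrow> w' = w) \<and>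
        \<psi> (game_move \<nu> \<epsilon> y v w' b, s - \<epsilon>\<^sup>2) + \<epsilon>\<^sup>2 * f y \<le> \<psi> (y, s) - \<delta> * \<epsilon>\<^sup>2"
    using consistency_upper[OF exp pert(3)[unfolded z0_def] less] by blast
  define g where "g = (c - \<Psi>m x) / 2"
  have g: "g > 0" using above c by (simp add: g_def z0_def)
  have "continuous_on open_spacetime (\<lambda>z. \<psi> z - \<Psi>m (fst z))"
    by (intro continuous_intros \<psi>_cont continuous_on_compose2[OF \<Psi>m_cont]) auto
  moreover have "g < \<psi> z0 - \<Psi>m (fst z0)" using \<psi>0 g by (simp add: g_def z0_def)
  ultimately obtain \<rho>1 where \<rho>1: "\<rho>1 > 0" "\<And>z. dist z0 z < \<rho>1 \<Longrightarrow> g < \<psi> z - \<Psi>m (fst z)"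
    using positive_near[of "\<lambda>z. \<psi> z - \<Psi>m (fst z)" z0 g] z0 by blast
  obtain \<rho>2 where \<rho>2: "\<rho>2 > 0" "\<And>z. dist z0 z < \<rho>2 \<Longrightarrow> upper_relaxed_limit u z - ereal (\<phi> z) \<le> ereal c - ereal (\<phi> z0)"
    using max unfolding eventually_nhds_metric z0_def[symmetric] c by (metis dist_commute)
  define \<rho> where "\<rho> = Min {r, \<rho>1, \<rho>2, t} / 2"
  have \<rho>: "\<rho> > 0" "\<rho> < r" "\<rho> < \<rho>1" "\<rho> < \<rho>2" "\<rho> < t"
    using r \<rho>1 \<rho>2 t by (auto simp: \<rho>_def min_def)
  have sub: "cball z0 \<rho> \<subseteq> open_spacetime"
    by (rule cball_subset_open_spacetime) (use \<rho>(5) in \<open>simp add: z0_def\<close>)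
  obtain B where B: "\<And>\<epsilon> y s. y \<in> cball x \<rho> \<Longrightarrow> \<bar>u \<epsilon> y s\<bar> \<le> B" using u_bounded_cball by blast
  define D where "D = 2 * real CARD('n) + \<bar>\<nu>\<bar> + 1"
  have D: "D > 0" by (simp add: D_def add_nonneg_pos)
  obtain e0 where e0: "e0 > 0" "\<And>\<epsilon>. 0 < \<epsilon> \<Longrightarrow> \<epsilon> < e0 \<Longrightarrow> \<epsilon> \<le> 1 \<and> \<epsilon> < \<epsilon>0 \<and> D * \<epsilon> \<le> \<rho> / 2 \<and> \<delta> * \<epsilon>\<^sup>2 \<le> g / 2"
    using small_step_size[OF D \<rho>(1) \<delta> g \<epsilon>0] by blast
  obtain \<epsilon> y s M where \<epsilon>: "0 < \<epsilon>" "\<epsilon> < e0" and ys: "(y, s) \<in> ball z0 (\<rho> / 2)" and M: "- (g / 2) < M"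
    and upper: "\<And>y' s'. (y', s') \<in> cball z0 \<rho> \<Longrightarrow> u \<epsilon> y' s' \<le> \<psi> (y', s') + M"
    and near: "\<psi> (y, s) + M - \<delta> * \<epsilon>\<^sup>2 < u \<epsilon> y s"
  proof (rule approximate_maximum[of \<rho> z0 \<psi> "strict_bump z0" u B "g / 2" e0 "\<lambda>\<epsilon>. \<delta> * \<epsilon>\<^sup>2"])
    show "continuous_on (cball z0 \<rho>) \<psi>" using \<psi>_cont sub by (rule continuous_on_subset)
    show "upper_relaxed_limit u z0 = ereal (\<psi> z0)" using c \<psi>0 by simp
    show "upper_relaxed_limit u z \<le> ereal (\<psi> z - strict_bump z0 z)" if "z \<in> cball z0 \<rho>" for z
    proof -
      obtain b where b: "upper_relaxed_limit u z = ereal b" using relaxed_limits_real[of z] by metis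
      have "dist z0 z < \<rho>2" using that \<rho>(4) by simp
      from \<rho>2(2)[OF this] show ?thesis by (simp add: b \<psi>_def)
    qed
    show "u \<epsilon> y s \<le> B" if "(y, s) \<in> cball z0 \<rho>" for \<epsilon> y s
      using B[of y \<epsilon> s] that dist_fst_le[of z0 "(y, s)"] by (simp add: z0_def)
  qed (use \<rho> g e0 \<delta> in \<open>auto intro: continuous_on_strict_bump strict_bump_pos\<close>)
  have \<epsilon>1: "\<epsilon> \<le> 1" "\<epsilon> < \<epsilon>0" and D\<epsilon>: "D * \<epsilon> \<le> \<rho> / 2" and \<delta>\<epsilon>: "\<delta> * \<epsilon>\<^sup>2 \<le> g / 2"
    using e0(2)[OF \<epsilon>] by auto
  have ys': "(y, s) \<in> cball z0 \<rho>" using ys \<rho>(1) by simp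
  then have s: "s > 0" using sub by (auto simp: open_spacetime_def)
  have "g < \<psi> (y, s) - \<Psi>m y" using \<rho>1(2)[of "(y, s)"] ys' \<rho>(3) by simp
  then have "\<Psi>m y < u \<epsilon> y s" using near M \<delta>\<epsilon> by linarith
  then have "u \<epsilon> y s \<le> game_step \<nu> f \<epsilon> (\<lambda>x. u \<epsilon> x (s - \<epsilon>\<^sup>2)) y"
    unfolding u_step[OF s \<epsilon>(1)] by (auto simp: max_def min_def split: if_splits)
  also have "\<dots> \<le> \<psi> (y, s) + M - \<delta> * \<epsilon>\<^sup>2"
  proof -
    obtain B' where B': "\<And>(v :: nat \<Rightarrow> real^'n) w b s. v \<in> orthonormal_tuples \<Longrightarrow> w \<in> sphere 0 1 \<Longrightarrow> b \<in> sign_tuples TYPE('n) \<Longrightarrow>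
        \<bar>u \<epsilon> (game_move \<nu> \<epsilon> y v w b) s\<bar> \<le> B'"
      using u_moves_bounded[OF \<epsilon>(1) \<epsilon>1(1), of y] by blast
    show ?thesis
    proof (rule game_step_le[where g = "\<lambda>x. u \<epsilon> x (s - \<epsilon>\<^sup>2)", OF B'])
      fix v :: "nat \<Rightarrow> real^'n" and w assume v: "v \<in> orthonormal_tuples" and w: "w \<in> sphere (0 :: real^'n) 1"
      have "(y, s) \<in> ball (x, t) r" using ys' \<rho>(2) by (simp add: z0_def)
      from step[OF this \<epsilon>(1) \<epsilon>1(2) v w] obtain w' b where wb: "w' \<in> sphere 0 1" "b \<in> sign_tuples TYPE('n)" "\<nu> \<ge> 0 \<longrightarrow> w' = w"
        and le: "\<psi> (game_move \<nu> \<epsilon> y v w' b, s - \<epsilon>\<^sup>2) + \<epsilon>\<^sup>2 * f y \<le> \<psi> (y, s) - \<delta> * \<epsilon>\<^sup>2" by blast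
      have "(game_move \<nu> \<epsilon> y v w' b, s - \<epsilon>\<^sup>2) \<in> cball z0 \<rho>"
        using move_in_cball[OF ys \<epsilon>(1) \<epsilon>1(1) _ v wb(1,2)] D\<epsilon> unfolding D_def by blast
      from upper[OF this] have "u \<epsilon> (game_move \<nu> \<epsilon> y v w' b) (s - \<epsilon>\<^sup>2) + \<epsilon>\<^sup>2 * f y \<le> \<psi> (y, s) + M - \<delta> * \<epsilon>\<^sup>2"
        using le by linarith
      then show "\<exists>w'\<in>sphere 0 1. \<exists>b\<in>sign_tuples TYPE('n). (\<nu> \<ge> 0 \<longrightarrow> w' = w) \<and>
          u \<epsilon> (game_move \<nu> \<epsilon> y v w' b) (s - \<epsilon>\<^sup>2) + \<epsilon>\<^sup>2 * f y \<le> \<psi> (y, s) + M - \<delta> * \<epsilon>\<^sup>2"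
        using wb by blast
    qed
  qed
  finally show False using near by linarith
qed

lemma supersolution_test:
  assumes smooth: "smooth_fun_on open_spacetime \<phi>" and t: "t > 0"
    and min: "\<forall>\<^sub>F z in nhds (x, t). lower_relaxed_limit u (x, t) - ereal (\<phi> (x, t))
      \<le> lower_relaxed_limit u z - ereal (\<phi> z)"
    and below: "lower_relaxed_limit u (x, t) < ereal (\<Psi>p x)"
  shows "lsc_envelope UNIV (\<lambda>y. ereal (f y)) x \<le> ereal (time_deriv \<phi> (x, t) - \<nu> * norm (space_grad \<phi> (x, t)))
      + mcf_op_upper (space_grad \<phi> (x, t)) (space_hessian \<phi> (x, t))"
proof (rule ccontr)
  assume "\<not> ?thesis"
  then have less: "ereal (time_deriv \<phi> (x, t) - \<nu> * norm (space_grad \<phi> (x, t)))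
      + mcf_op_upper (space_grad \<phi> (x, t)) (space_hessian \<phi> (x, t)) < lsc_envelope UNIV (\<lambda>y. ereal (f y)) x" by simp
  define z0 where "z0 = (x, t)"
  have z0: "z0 \<in> open_spacetime" using t by (simp add: z0_def open_spacetime_def)
  note pert = perturbed_test_function[OF smooth z0]
  have neg: "upper_relaxed_limit (\<lambda>\<epsilon> y s. - u \<epsilon> y s) z = - lower_relaxed_limit u z" for z
    by (simp add: lower_relaxed_limit_eq_uminus)
  obtain c where c: "lower_relaxed_limit u z0 = ereal c" using relaxed_limits_real[of z0] by metis
  define \<psi> where "\<psi> z = \<phi> z + (c - \<phi> z0) - strict_bump z0 z" for z
  have \<psi>0: "\<psi> z0 = c" by (simp add: \<psi>_def)
  have \<psi>_cont: "continuous_on open_spacetime \<psi>"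
    unfolding \<psi>_def by (intro continuous_intros pert(4))
  have exp: "parabolic_expansion \<psi> (x, t) (space_grad \<phi> (x, t)) (time_deriv \<phi> (x, t)) (space_hessian \<phi> (x, t))"
    using pert(2)[of c] unfolding \<psi>_def[abs_def] z0_def .
  obtain \<delta> r \<epsilon>0 where \<delta>: "\<delta> > 0" and r: "r > 0" and \<epsilon>0: "\<epsilon>0 > 0" and step:
    "\<And>y s \<epsilon>. (y, s) \<in> ball (x, t) r \<Longrightarrow> 0 < \<epsilon> \<Longrightarrow> \<epsilon> < \<epsilon>0 \<Longrightarrow>
      \<exists>v\<in>orthonormal_tuples. \<exists>w\<in>sphere 0 1. \<forall>w'\<in>sphere 0 1. \<forall>b\<in>sign_tuples TYPE('n). (\<nu> \<ge> 0 \<longrightarrow> w' = w) \<longrightarrow>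
        \<psi> (y, s) + \<delta> * \<epsilon>\<^sup>2 \<le> \<psi> (game_move \<nu> \<epsilon> y v w' b, s - \<epsilon>\<^sup>2) + \<epsilon>\<^sup>2 * f y"
    using consistency_lower[OF exp pert(3)[unfolded z0_def] less] by blast
  define g where "g = (\<Psi>p x - c) / 2"
  have g: "g > 0" using below c by (simp add: g_def z0_def)
  have "continuous_on open_spacetime (\<lambda>z. \<Psi>p (fst z) - \<psi> z)"
    by (intro continuous_intros \<psi>_cont continuous_on_compose2[OF \<Psi>p_cont]) auto
  moreover have "g < \<Psi>p (fst z0) - \<psi> z0" using \<psi>0 g by (simp add: g_def z0_def)
  ultimately obtain \<rho>1 where \<rho>1: "\<rho>1 > 0" "\<And>z. dist z0 z < \<rho>1 \<Longrightarrow> g < \<Psi>p (fst z) - \<psi> z"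
    using positive_near[of "\<lambda>z. \<Psi>p (fst z) - \<psi> z" z0 g] z0 by blast
  obtain \<rho>2 where \<rho>2: "\<rho>2 > 0" "\<And>z. dist z0 z < \<rho>2 \<Longrightarrow> ereal c - ereal (\<phi> z0) \<le> lower_relaxed_limit u z - ereal (\<phi> z)"
    using min unfolding eventually_nhds_metric z0_def[symmetric] c by (metis dist_commute)
  define \<rho> where "\<rho> = Min {r, \<rho>1, \<rho>2, t} / 2"
  have \<rho>: "\<rho> > 0" "\<rho> < r" "\<rho> < \<rho>1" "\<rho> < \<rho>2" "\<rho> < t"
    using r \<rho>1 \<rho>2 t by (auto simp: \<rho>_def min_def)
  have sub: "cball z0 \<rho> \<subseteq> open_spacetime"
    by (rule cball_subset_open_spacetime) (use \<rho>(5) in \<open>simp add: z0_def\<close>)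
  obtain B where B: "\<And>\<epsilon> y s. y \<in> cball x \<rho> \<Longrightarrow> \<bar>u \<epsilon> y s\<bar> \<le> B" using u_bounded_cball by blast
  define D where "D = 2 * real CARD('n) + \<bar>\<nu>\<bar> + 1"
  have D: "D > 0" by (simp add: D_def add_nonneg_pos)
  obtain e0 where e0: "e0 > 0" "\<And>\<epsilon>. 0 < \<epsilon> \<Longrightarrow> \<epsilon> < e0 \<Longrightarrow> \<epsilon> \<le> 1 \<and> \<epsilon> < \<epsilon>0 \<and> D * \<epsilon> \<le> \<rho> / 2 \<and> \<delta> * \<epsilon>\<^sup>2 \<le> g / 2"
    using small_step_size[OF D \<rho>(1) \<delta> g \<epsilon>0] by blast
  obtain \<epsilon> y s M where \<epsilon>: "0 < \<epsilon>" "\<epsilon> < e0" and ys: "(y, s) \<in> ball z0 (\<rho> / 2)" and M: "- (g / 2) < M"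
    and lower: "\<And>y' s'. (y', s') \<in> cball z0 \<rho> \<Longrightarrow> - u \<epsilon> y' s' \<le> - \<psi> (y', s') + M"
    and near: "- \<psi> (y, s) + M - \<delta> * \<epsilon>\<^sup>2 < - u \<epsilon> y s"
  proof (rule approximate_maximum[of \<rho> z0 "\<lambda>z. - \<psi> z" "strict_bump z0" "\<lambda>\<epsilon> y s. - u \<epsilon> y s" B "g / 2" e0 "\<lambda>\<epsilon>. \<delta> * \<epsilon>\<^sup>2"])
    show "continuous_on (cball z0 \<rho>) (\<lambda>z. - \<psi> z)"
      by (intro continuous_on_minus continuous_on_subset[OF \<psi>_cont sub])
    show "upper_relaxed_limit (\<lambda>\<epsilon> y s. - u \<epsilon> y s) z0 = ereal (- \<psi> z0)" using c \<psi>0 neg by simp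
    show "upper_relaxed_limit (\<lambda>\<epsilon> y s. - u \<epsilon> y s) z \<le> ereal (- \<psi> z - strict_bump z0 z)" if "z \<in> cball z0 \<rho>" for z
    proof -
      obtain b where b: "lower_relaxed_limit u z = ereal b" using relaxed_limits_real[of z] by metis
      have "dist z0 z < \<rho>2" using that \<rho>(4) by simp
      from \<rho>2(2)[OF this] show ?thesis by (simp add: b neg \<psi>_def)
    qed
    show "- u \<epsilon> y s \<le> B" if "(y, s) \<in> cball z0 \<rho>" for \<epsilon> y s
      using B[of y \<epsilon> s] that dist_fst_le[of z0 "(y, s)"] by (simp add: z0_def)
  qed (use \<rho> g e0 \<delta> in \<open>auto intro: continuous_on_strict_bump strict_bump_pos\<close>)
  have \<epsilon>1: "\<epsilon> \<le> 1" "\<epsilon> < \<epsilon>0" and D\<epsilon>: "D * \<epsilon> \<le> \<rho> / 2" and \<delta>\<epsilon>: "\<delta> * \<epsilon>\<^sup>2 \<le> g / 2"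
    using e0(2)[OF \<epsilon>] by auto
  have ys': "(y, s) \<in> cball z0 \<rho>" using ys \<rho>(1) by simp
  then have s: "s > 0" using sub by (auto simp: open_spacetime_def)
  have "\<psi> (y, s) - M + \<delta> * \<epsilon>\<^sup>2 \<le> game_step \<nu> f \<epsilon> (\<lambda>x. u \<epsilon> x (s - \<epsilon>\<^sup>2)) y"
  proof -
    obtain B' where B': "\<And>(v :: nat \<Rightarrow> real^'n) w b s. v \<in> orthonormal_tuples \<Longrightarrow> w \<in> sphere 0 1 \<Longrightarrow> b \<in> sign_tuples TYPE('n) \<Longrightarrow>
        \<bar>u \<epsilon> (game_move \<nu> \<epsilon> y v w b) s\<bar> \<le> B'"
      using u_moves_bounded[OF \<epsilon>(1) \<epsilon>1(1), of y] by blast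
    have "(y, s) \<in> ball (x, t) r" using ys' \<rho>(2) by (simp add: z0_def)
    from step[OF this \<epsilon>(1) \<epsilon>1(2)] obtain v w where v: "v \<in> orthonormal_tuples" and w: "w \<in> sphere (0 :: real^'n) 1"
      and le: "\<And>w' b. w' \<in> sphere 0 1 \<Longrightarrow> b \<in> sign_tuples TYPE('n) \<Longrightarrow> (\<nu> \<ge> 0 \<longrightarrow> w' = w) \<Longrightarrow>
        \<psi> (y, s) + \<delta> * \<epsilon>\<^sup>2 \<le> \<psi> (game_move \<nu> \<epsilon> y v w' b, s - \<epsilon>\<^sup>2) + \<epsilon>\<^sup>2 * f y" by blast
    show ?thesis
    proof (rule game_step_ge[where g = "\<lambda>x. u \<epsilon> x (s - \<epsilon>\<^sup>2)", OF B' v w])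
      fix w' :: "real^'n" and b assume wb: "w' \<in> sphere 0 1" "b \<in> sign_tuples TYPE('n)" "\<nu> \<ge> 0 \<Longrightarrow> w' = w"
      have "(game_move \<nu> \<epsilon> y v w' b, s - \<epsilon>\<^sup>2) \<in> cball z0 \<rho>"
        using move_in_cball[OF ys \<epsilon>(1) \<epsilon>1(1) _ v wb(1,2)] D\<epsilon> unfolding D_def by blast
      from lower[OF this] show "\<psi> (y, s) - M + \<delta> * \<epsilon>\<^sup>2 \<le> u \<epsilon> (game_move \<nu> \<epsilon> y v w' b) (s - \<epsilon>\<^sup>2) + \<epsilon>\<^sup>2 * f y"
        using le[OF wb(1,2)] wb(3) by linarith
    qed
  qed
  moreover have "game_step \<nu> f \<epsilon> (\<lambda>x. u \<epsilon> x (s - \<epsilon>\<^sup>2)) y \<le> u \<epsilon> y s"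
  proof -
    have "g < \<Psi>p y - \<psi> (y, s)" using \<rho>1(2)[of "(y, s)"] ys' \<rho>(3) by simp
    then have "u \<epsilon> y s < \<Psi>p y" using near M \<delta>\<epsilon> by linarith
    then show ?thesis unfolding u_step[OF s \<epsilon>(1)] by (auto simp: max_def min_def split: if_splits)
  qed
  ultimately show False using near by linarith
qed

lemma envelopes_relaxed_limits:
  assumes "t \<ge> 0"
  shows "usc_envelope closed_spacetime (upper_relaxed_limit u) (x, t) = upper_relaxed_limit u (x, t)"
    and "lsc_envelope closed_spacetime (lower_relaxed_limit u) (x, t) = lower_relaxed_limit u (x, t)"
  using assms by (auto intro!: usc_envelope_upper_relaxed_limit lsc_envelope_lower_relaxed_limit
      simp: closed_spacetime_def)

lemma eventually_positive_time:
  fixes x :: "real^'n" and t :: real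
  assumes "t > 0"
  shows "\<forall>\<^sub>F z in nhds (x, t). snd z \<ge> 0"
proof -
  have "\<forall>\<^sub>F z in nhds (x, t). z \<in> open_spacetime"
    using assms by (intro eventually_nhds_in_open open_open_spacetime) (simp add: open_spacetime_def)
  then show ?thesis by (rule eventually_mono) (auto simp: open_spacetime_def)
qed

lemma viscosity_subsolution_upper: "viscosity_subsolution \<nu> f \<Psi>m \<Psi>p u0 (upper_relaxed_limit u)"
  unfolding viscosity_subsolution_def Let_def
proof (intro conjI allI impI ballI)
  fix z :: "(real^'n) \<times> real"
  show "\<bar>upper_relaxed_limit u z\<bar> \<noteq> \<infinity>" using relaxed_limits_real[of z] by force
next
  fix x :: "real^'n" and t :: real assume t: "t > 0"
  show "ereal (\<Psi>m x) \<le> usc_envelope closed_spacetime (upper_relaxed_limit u) (x, t)"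
    using t relaxed_limits_between(1)[of x t] lower_le_upper_relaxed_limit[of u "(x, t)"]
    by (simp add: envelopes_relaxed_limits)
  show "usc_envelope closed_spacetime (upper_relaxed_limit u) (x, t) \<le> ereal (\<Psi>p x)"
    using t relaxed_limits_between(2)[of x t] by (simp add: envelopes_relaxed_limits)
next
  fix x show "usc_envelope closed_spacetime (upper_relaxed_limit u) (x, 0) \<le> ereal (u0 x)"
    by (simp add: envelopes_relaxed_limits initial_trace)
next
  fix \<phi> and x :: "real^'n" and t :: real
  assume \<phi>: "smooth_fun_on open_spacetime \<phi>" and t: "t > 0"
    and max: "\<forall>\<^sub>F z in nhds (x, t). usc_envelope closed_spacetime (upper_relaxed_limit u) z - ereal (\<phi> z)
      \<le> usc_envelope closed_spacetime (upper_relaxed_limit u) (x, t) - ereal (\<phi> (x, t))"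
    and above: "ereal (\<Psi>m x) < usc_envelope closed_spacetime (upper_relaxed_limit u) (x, t)"
  show "ereal (time_deriv \<phi> (x, t) - \<nu> * norm (space_grad \<phi> (x, t)))
      + mcf_op_lower (space_grad \<phi> (x, t)) (space_hessian \<phi> (x, t)) \<le> usc_envelope UNIV (\<lambda>y. ereal (f y)) x"
  proof (rule subsolution_test[OF \<phi> t])
    show "\<forall>\<^sub>F z in nhds (x, t). upper_relaxed_limit u z - ereal (\<phi> z) \<le> upper_relaxed_limit u (x, t) - ereal (\<phi> (x, t))"
      using max eventually_positive_time[OF t]
    proof eventually_elim
      case (elim z)
      then show ?case using t envelopes_relaxed_limits(1)[of "snd z" "fst z"] envelopes_relaxed_limits(1)[of t x] by simp
    qed
    show "ereal (\<Psi>m x) < upper_relaxed_limit u (x, t)"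
      using above t by (simp add: envelopes_relaxed_limits)
  qed
qed

lemma viscosity_supersolution_lower: "viscosity_supersolution \<nu> f \<Psi>m \<Psi>p u0 (lower_relaxed_limit u)"
  unfolding viscosity_supersolution_def Let_def
proof (intro conjI allI impI ballI)
  fix z :: "(real^'n) \<times> real"
  show "\<bar>lower_relaxed_limit u z\<bar> \<noteq> \<infinity>" using relaxed_limits_real[of z] by force
next
  fix x :: "real^'n" and t :: real assume t: "t > 0"
  show "lsc_envelope closed_spacetime (lower_relaxed_limit u) (x, t) \<le> ereal (\<Psi>p x)"
    using t relaxed_limits_between(2)[of x t] lower_le_upper_relaxed_limit[of u "(x, t)"]
    by (simp add: envelopes_relaxed_limits)
  show "ereal (\<Psi>m x) \<le> lsc_envelope closed_spacetime (lower_relaxed_limit u) (x, t)"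
    using t relaxed_limits_between(1)[of x t] by (simp add: envelopes_relaxed_limits)
next
  fix x show "ereal (u0 x) \<le> lsc_envelope closed_spacetime (lower_relaxed_limit u) (x, 0)"
    by (simp add: envelopes_relaxed_limits initial_trace)
next
  fix \<phi> and x :: "real^'n" and t :: real
  assume \<phi>: "smooth_fun_on open_spacetime \<phi>" and t: "t > 0"
    and min: "\<forall>\<^sub>F z in nhds (x, t). lsc_envelope closed_spacetime (lower_relaxed_limit u) (x, t) - ereal (\<phi> (x, t))
      \<le> lsc_envelope closed_spacetime (lower_relaxed_limit u) z - ereal (\<phi> z)"
    and below: "lsc_envelope closed_spacetime (lower_relaxed_limit u) (x, t) < ereal (\<Psi>p x)"
  show "lsc_envelope UNIV (\<lambda>y. ereal (f y)) x \<le> ereal (time_deriv \<phi> (x, t) - \<nu> * norm (space_grad \<phi> (x, t)))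
      + mcf_op_upper (space_grad \<phi> (x, t)) (space_hessian \<phi> (x, t))"
  proof (rule supersolution_test[OF \<phi> t])
    show "\<forall>\<^sub>F z in nhds (x, t). lower_relaxed_limit u (x, t) - ereal (\<phi> (x, t)) \<le> lower_relaxed_limit u z - ereal (\<phi> z)"
      using min eventually_positive_time[OF t]
    proof eventually_elim
      case (elim z)
      then show ?case using t envelopes_relaxed_limits(2)[of "snd z" "fst z"] envelopes_relaxed_limits(2)[of t x] by simp
    qed
    show "lower_relaxed_limit u (x, t) < ereal (\<Psi>p x)"
      using below t by (simp add: envelopes_relaxed_limits)
  qed
qed

end

theorem propositionA3:
  fixes \<nu> :: real
    and f \<Psi>m \<Psi>p u0 :: "real^'n \<Rightarrow> real"
  assumes "CARD('n) \<ge> 2"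
    and "locally_bounded f"
    and "\<exists>L. L-lipschitz_on UNIV \<Psi>m"
    and "\<exists>L. L-lipschitz_on UNIV \<Psi>p"
    and "\<And>x. \<Psi>m x \<le> \<Psi>p x"
    and "continuous_on UNIV u0"
    and "\<And>x. \<Psi>m x \<le> u0 x \<and> u0 x \<le> \<Psi>p x"
  shows "let u = game_value \<nu> f \<Psi>m \<Psi>p u0 in
      viscosity_subsolution \<nu> f \<Psi>m \<Psi>p u0 (upper_relaxed_limit u)
      \<and> viscosity_supersolution \<nu> f \<Psi>m \<Psi>p u0 (lower_relaxed_limit u)
      \<and> (\<forall>x. upper_relaxed_limit u (x, 0) = ereal (u0 x)
              \<and> lower_relaxed_limit u (x, 0) = ereal (u0 x))"
proof -
  interpret obstacle_game \<nu> f \<Psi>m \<Psi>p u0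
    by unfold_locales (use assms lipschitz_on_continuous_on in auto)
  show ?thesis
    unfolding Let_def
    using viscosity_subsolution_upper viscosity_supersolution_lower initial_trace by blast
qed

end
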